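(* Let $0<\alpha<1$ and $0\le\gamma<\alpha$. For $k\ge1$, the distribution $\nu_k^{\rm sb}$ of the first $k$ marginals of the size-biased form $\nu^{\rm sb}_{\alpha,\gamma}$ of $$\nu_{\alpha,\gamma}(ds)=\left(\gamma+(1-\alpha-\gamma)\sum_{i\neq j}s_is_j\right){\rm PD}^*_{\alpha,-\alpha-\gamma}(ds)$$ is given, for $x=(x_1,\ldots,x_k)$, by $$\nu^{\rm sb}_k(dx)=\left(\gamma+(1-\alpha-\gamma)\left(1-\sum_{i=1}^kx_i^2-\frac{1-\alpha}{1+(k-1)\alpha-\gamma}\Big(1-\sum_{i=1}^kx_i\Big)^2\right)\right){\rm GEM}^*_{\alpha,-\alpha-\gamma}(dx),$$ where ${\rm GEM}^*_{\alpha,-\alpha-\gamma}(dx)$ denotes the distribution of the first $k$ marginals of ${\rm GEM}^*_{\alpha,-\alpha-\gamma}$.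
   Context: $\mathcal{S}^\downarrow=\{s=(s_i)_{i\ge1}:s_1\ge s_2\ge\ldots\ge0,\ \sum_is_i\le1\}$. For $0<\alpha<1$ and $\theta>-2\alpha$, ${\rm PD}^*_{\alpha,\theta}$ is the ($\sigma$-finite) measure on $\mathcal{S}^\downarrow$ given by $$\int f\,d{\rm PD}^*_{\alpha,\theta}=\mathbb{E}\big(\sigma_1^{-\theta}f(\Delta\sigma_{[0,1]}/\sigma_1)\big),$$ where $\sigma$ is an $\alpha$-stable subordinator with $\mathbb{E}(e^{-\lambda\sigma_1})=e^{-\lambda^\alpha}$ and $\Delta\sigma_{[0,1]}$ is the sequence of its jumps on $[0,1]$ in decreasing order. The sum $\sum_{i\ne j}$ is over ordered pairs of distinct positive integers. Size-biased form. For a dislocation measure $\nu$ on $\mathcal{S}^\downarrow$ (i.e. $\nu(\{(1,0,0,\ldots)\})=0$, $\int(1-s_1)\nu(ds)<\infty$) with $\nu(\{s:\sum_is_i<1\})=0$, the size-biased dislocation measure $\nu^{\rm sb}$ is the measure on $[0,1]^{\mathbb{N}}$ with first $k$ marginals $$\nu_k^{\rm sb}(A_1\times\cdots\times A_k)=\nu^{\rm sb}(A_1\times\cdots\times A_k\times[0,1]^{\mathbb{N}})=\sum_{i_1,\ldots,i_k\ge1\ \text{distinct}}\ \int_{\{s\in\mathcal{S}^\downarrow:\,s_{i_1}\in A_1,\ldots,s_{i_k}\in A_k\}}\frac{s_{i_1}\cdots s_{i_k}}{\prod_{j=1}^{k-1}\big(1-\sum_{l=1}^js_{i_l}\big)}\,\nu(ds)$$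 for all $k\ge1$ and Borel sets $A_1,\ldots,A_k\subseteq[0,1]$. ${\rm GEM}^*_{\alpha,\theta}$ is the size-biased dislocation measure associated in this way with $\nu={\rm PD}^*_{\alpha,\theta}$. *)

theory Defs
  imports "HOL-Probability.Probability"
begin

text \<open>Sequences are indexed from 0: the entry \<open>s\<^sub>i\<close>, \<open>i \<ge> 1\<close>, is \<open>s (i - 1)\<close>.\<close>

definition mass_partitions :: "(nat \<Rightarrow> real) set" where
  "mass_partitions = {s. decseq s \<and> (\<forall>i. 0 \<le> s i) \<and> summable s \<and> (\<Sum>i. s i) \<le> 1}"

definition mass_partition_space :: "(nat \<Rightarrow> real) measure" where
  "mass_partition_space = restrict_space (\<Pi>\<^sub>M i\<in>UNIV. borel) mass_partitions"

locale subordinator = prob_space M for M :: "'a measure" +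
  fixes \<sigma> :: "real \<Rightarrow> 'a \<Rightarrow> real"
  assumes measurable: "t \<ge> 0 \<Longrightarrow> random_variable borel (\<sigma> t)"
    and start: "\<omega> \<in> space M \<Longrightarrow> \<sigma> 0 \<omega> = 0"
    and nondecreasing: "\<omega> \<in> space M \<Longrightarrow> mono_on {0..} (\<lambda>t. \<sigma> t \<omega>)"
    and right_continuous: "\<omega> \<in> space M \<Longrightarrow> t \<ge> 0 \<Longrightarrow> continuous (at_right t) (\<lambda>t. \<sigma> t \<omega>)"
    and stationary_increments: "s \<ge> 0 \<Longrightarrow> h \<ge> 0 \<Longrightarrow>
      distr M borel (\<lambda>\<omega>. \<sigma> (s + h) \<omega> - \<sigma> s \<omega>) = distr M borel (\<sigma> h)"
    and independent_increments: "u 0 \<ge> 0 \<Longrightarrow> mono u \<Longrightarrow>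
      indep_vars (\<lambda>_. borel) (\<lambda>i \<omega>. \<sigma> (u (Suc i)) \<omega> - \<sigma> (u i) \<omega>) {..<n::nat}"

text \<open>Stationarity and independence of the increments extend the normalisation at time 1
  to \<open>E (exp (- l * \<sigma> t)) = exp (- t * l powr \<alpha>)\<close> for all times \<open>t\<close>.\<close>

locale stable_subordinator = subordinator M \<sigma> for M :: "'a measure" and \<sigma> +
  fixes \<alpha> :: real
  assumes laplace: "l \<ge> 0 \<Longrightarrow> expectation (\<lambda>\<omega>. exp (- l * \<sigma> 1 \<omega>)) = exp (- (l powr \<alpha>))"

definition jump :: "(real \<Rightarrow> real) \<Rightarrow> real \<Rightarrow> real" where
  "jump f t = f t - Lim (at_left t) f"

text \<open>\<open>ranked T a n\<close> is the \<open>(n + 1)\<close>-st largest value, counted with multiplicity, of a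
  nonnegative family \<open>a\<close> indexed by \<open>T\<close>, expressed as a maximum of minima; it is 0 if there are
  fewer than \<open>n + 1\<close> indices.\<close>

definition ranked :: "'i set \<Rightarrow> ('i \<Rightarrow> real) \<Rightarrow> nat \<Rightarrow> real" where
  "ranked T a n = Sup (insert 0 {Min (a ` J) |J. J \<subseteq> T \<and> finite J \<and> card J = Suc n})"

lemma ranked_ge_iff:
  assumes fin: "\<And>y. y > 0 \<Longrightarrow> finite {t \<in> T. y \<le> a t}" and x: "x > 0"
  shows "x \<le> ranked T a n \<longleftrightarrow> n < card {t \<in> T. x \<le> a t}"
proof -
  let ?S = "{Min (a ` J) |J. J \<subseteq> T \<and> finite J \<and> card J = Suc n}"
  have iff: "(\<exists>v\<in>?S. y \<le> v) \<longleftrightarrow> n < card {t \<in> T. y \<le> a t}" if y: "y > 0" for y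
  proof
    assume "\<exists>v\<in>?S. y \<le> v"
    then obtain J where J: "J \<subseteq> T" "finite J" "card J = Suc n" "y \<le> Min (a ` J)" by auto
    then have "J \<noteq> {}" by auto
    then have "J \<subseteq> {t \<in> T. y \<le> a t}" using J by auto
    then have "card J \<le> card {t \<in> T. y \<le> a t}" using card_mono fin[OF y] by blast
    then show "n < card {t \<in> T. y \<le> a t}" using J(3) by simp
  next
    assume "n < card {t \<in> T. y \<le> a t}"
    then obtain J where J: "J \<subseteq> {t \<in> T. y \<le> a t}" "card J = Suc n"
      by (metis Suc_leI obtain_subset_with_card_n)
    have fJ: "finite J" "J \<noteq> {}" using J(2) card.infinite by fastforce+
    have "y \<le> Min (a ` J)" using J fJ by auto
    moreover have "Min (a ` J) \<in> ?S" using J fJ by blast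
    ultimately show "\<exists>v\<in>?S. y \<le> v" by blast
  qed
  let ?L = "a ` {t \<in> T. x \<le> a t}"
  have finL: "finite ?L" using fin[OF x] by simp
  have S_sub: "v \<in> ?L \<or> v < x" if "v \<in> ?S" for v
  proof -
    from that obtain J where J: "J \<subseteq> T" "finite J" "card J = Suc n" "v = Min (a ` J)" by auto
    then have "a ` J \<noteq> {}" by auto
    then have "v \<in> a ` J" using J by simp
    then show ?thesis using J(1) by force
  qed
  have bdd: "bdd_above (insert 0 ?S)"
  proof (rule bdd_aboveI)
    fix v assume "v \<in> insert 0 ?S"
    then show "v \<le> Max (insert x ?L)"
      using S_sub[of v] finL x Max_ge[of "insert x ?L" v] Max_ge[of "insert x ?L" x] by fastforce
  qed
  show ?thesis
  proof
    assume le: "x \<le> ranked T a n"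
    show "n < card {t \<in> T. x \<le> a t}"
    proof (rule ccontr)
      assume "\<not> ?thesis"
      then have none: "\<And>v. v \<in> ?S \<Longrightarrow> v < x" using iff[OF x] by fastforce
      let ?B = "a ` {t \<in> T. x / 2 \<le> a t} \<inter> {..<x}"
      have finB: "finite ?B" using fin[of "x/2"] x by simp
      have "v \<le> Max (insert (x/2) ?B)" if "v \<in> insert 0 ?S" for v
      proof (cases "v < x / 2")
        case True
        then show ?thesis using finB Max_ge[of "insert (x/2) ?B" "x/2"] by force
      next
        case False
        then have "v \<in> ?S" using that x by auto
        then obtain J where J: "J \<subseteq> T" "finite J" "card J = Suc n" "v = Min (a ` J)" by auto
        then have "a ` J \<noteq> {}" by auto
        then have "v \<in> a ` J" using J by simp
        then have "v \<in> ?B" using J(1) False none[OF \<open>v \<in> ?S\<close>] by force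
        then show ?thesis using finB by simp
      qed
      then have "ranked T a n \<le> Max (insert (x/2) ?B)"
        unfolding ranked_def by (intro cSup_least) auto
      also have "\<dots> < x" using finB x by auto
      finally show False using le by simp
    qed
  next
    assume "n < card {t \<in> T. x \<le> a t}"
    then obtain v where "v \<in> ?S" "x \<le> v" using iff[OF x] by blast
    then show "x \<le> ranked T a n"
      unfolding ranked_def using cSup_upper[OF _ bdd, of v] by force
  qed
qed

text \<open>The push-forward under \<open>\<Delta>\<sigma>\<^bsub>[0,1]\<^esub> / \<sigma>\<^sub>1\<close> of the law reweighted by \<open>\<sigma>\<^sub>1\<close> to the power \<open>- \<theta>\<close>;
  the parameter \<open>\<alpha>\<close> enters through \<open>\<sigma>\<close>. There is no jump at time 0, since \<open>\<sigma>\<^sub>0 = 0\<close>.\<close>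

definition PD_star :: "'a measure \<Rightarrow> (real \<Rightarrow> 'a \<Rightarrow> real) \<Rightarrow> real \<Rightarrow> (nat \<Rightarrow> real) measure" where
  "PD_star M \<sigma> \<theta> =
     distr (density M (\<lambda>\<omega>. ennreal (\<sigma> 1 \<omega> powr (- \<theta>)))) mass_partition_space
       (\<lambda>\<omega> i. ranked {0<..1} (jump (\<lambda>t. \<sigma> t \<omega>)) i / \<sigma> 1 \<omega>)"

abbreviation unit_interval :: "real measure" where
  "unit_interval \<equiv> restrict_space borel {0..1}"

text \<open>The distinct indices \<open>i\<^sub>1, \<dots>, i\<^sub>k\<close> form a distinct list \<open>is\<close> of length \<open>k\<close>, with
  \<open>i\<^sub>j\<close> stored at position \<open>j - 1\<close>.\<close>

definition is_size_biased :: "(nat \<Rightarrow> real) measure \<Rightarrow> (nat \<Rightarrow> real) measure \<Rightarrow> bool" where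
  "is_size_biased \<nu> N \<longleftrightarrow>
     sets N = sets (\<Pi>\<^sub>M i\<in>UNIV. unit_interval) \<and>
     (\<forall>k\<ge>1. \<forall>A. (\<forall>j<k. A j \<in> sets unit_interval) \<longrightarrow>
        emeasure N {x \<in> space N. \<forall>j<k. x j \<in> A j} =
        (\<Sum>\<^sub>\<infinity>is | length is = k \<and> distinct is.
           \<integral>\<^sup>+s\<in>{s \<in> space \<nu>. \<forall>j<k. s (is ! j) \<in> A j}.
             ennreal ((\<Prod>j<k. s (is ! j)) / (\<Prod>j=1..<k. 1 - (\<Sum>l<j. s (is ! l)))) \<partial>\<nu>))"

text \<open>Meant for dislocation measures \<open>\<nu>\<close>, i.e. \<open>\<nu> {(1,0,0,\<dots>)} = 0\<close> and \<open>\<integral> (1 - s\<^sub>1) d\<nu> < \<infinity>\<close>,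
  carried by the sequences of total mass 1.\<close>

definition size_biased :: "(nat \<Rightarrow> real) measure \<Rightarrow> (nat \<Rightarrow> real) measure" where
  "size_biased \<nu> = (THE N. is_size_biased \<nu> N)"

definition GEM_star :: "'a measure \<Rightarrow> (real \<Rightarrow> 'a \<Rightarrow> real) \<Rightarrow> real \<Rightarrow> (nat \<Rightarrow> real) measure" where
  "GEM_star M \<sigma> \<theta> = size_biased (PD_star M \<sigma> \<theta>)"

definition first_marginals :: "nat \<Rightarrow> (nat \<Rightarrow> real) measure \<Rightarrow> (nat \<Rightarrow> real) measure" where
  "first_marginals k N = distr N (\<Pi>\<^sub>M i\<in>{..<k}. unit_interval) (\<lambda>x. restrict x {..<k})"

definition alpha_gamma_dislocation ::
  "'a measure \<Rightarrow> (real \<Rightarrow> 'a \<Rightarrow> real) \<Rightarrow> real \<Rightarrow> real \<Rightarrow> (nat \<Rightarrow> real) measure" where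
  "alpha_gamma_dislocation M \<sigma> \<alpha> \<gamma> =
     density (PD_star M \<sigma> (- \<alpha> - \<gamma>))
       (\<lambda>s. ennreal (\<gamma> + (1 - \<alpha> - \<gamma>) * (\<Sum>\<^sub>\<infinity>(i, j)\<in>{(i, j). i \<noteq> j}. s i * s j)))"

end

theory Submission
  imports Defs "HOL-Real_Asymp.Real_Asymp"
begin

text \<open>
  The jumps of the subordinator on \<open>[0,1]\<close> form a Poisson process with intensity the Levy measure
  \<open>\<mu>(dx) = \<alpha> / \<Gamma>(1 - \<alpha>) x\<^bsup>- 1 - \<alpha>\<^esup> dx\<close>. All that is needed of this is a Mecke formula, which comes from
  cutting \<open>[0,1]\<close> into \<open>n\<close> cells: sums over tuples of the i.i.d. increments converge pathwise to sums
  over tuples of jumps, and \<open>n\<close> times the law of an increment converges vaguely to \<open>\<mu>\<close>.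

  Given the first \<open>k\<close> size-biased picks \<open>x\<close>, write \<open>\<Sum>\<^sub>i\<^sub>\<noteq>\<^sub>j s\<^sub>i s\<^sub>j = 1 - \<Sum>\<^sub>i s\<^sub>i\<^sup>2\<close> and split the squares into those
  of \<open>x\<close> and those of the remaining parts. The Mecke formula for \<open>k + 1\<close> and for \<open>k\<close> jumps together with
  the scaling \<open>\<mu>(r dx) = r\<^bsup>- \<alpha>\<^esup> \<mu>(dx)\<close> reduces the replacement of the latter by
  \<open>(1 - \<alpha>) / (1 + q) (1 - \<Sum> x)\<^sup>2\<close>, where \<open>q = (k - 1) \<alpha> - \<gamma>\<close>, to the identity
  \<open>\<integral> y\<^sup>2 E (\<sigma>\<^sub>1 + y)\<^bsup>- q - 2\<^esup> \<mu>(dy) = (1 - \<alpha>) / (1 + q) E \<sigma>\<^sub>1\<^bsup>- q\<^esup>\<close>, in which both sides are Gamma integrals of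
  the Laplace transform. Size-biased measures exist because the successive picks can be driven by
  i.i.d. uniform variables.
\<close>

section \<open>Increasing paths and their jumps\<close>

text \<open>Two obstacles shape the proof. First, the hypotheses describe only increments and one
  Laplace transform, so left limits, measurability of the ranked jumps, absence of drift and
  positivity of all ranks have to be derived. The Mecke formula is therefore stated for the sampled
  jumps and the rest \<open>T - sum\<close> of the path, which might a priori contain a drift; its
  case of a single jump then shows that there is none. Second, the measures are infinite and 1 -
  \<alpha> - \<gamma> can have either sign, so the two densities cannot be compared by subtracting
  integrals. Everything is computed in the extended nonnegative reals. The one cancellation that is
  needed rests on the finiteness of the integral of \<open>1 - x 0\<close>, which is the dislocation
  condition seen through the first pick; its proof uses \<gamma> < \<alpha>. The constant arises as
  follows. The second derivative of \<open>l powr \<alpha>\<close> supplies the factor 1 - \<alpha>,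
  and the two Gamma integrals have exponents \<open>q + 2\<close> and \<open>q + 1\<close>, so that
  \<open>Gamma (q + 2) = (q + 1) * Gamma (q + 1)\<close> supplies the denominator.\<close>

definition jump_rank :: "(real \<Rightarrow> real) \<Rightarrow> nat \<Rightarrow> real"
  where "jump_rank f i = ranked {0<..1} (jump f) i"

definition increment :: "(real \<Rightarrow> real) \<Rightarrow> nat \<Rightarrow> nat \<Rightarrow> real"
  where "increment f n c = f (real (Suc c) / real n) - f (real c / real n)"

text \<open>The cells are the intervals \<open>(c/n, (c+1)/n]\<close>. Closing them on the right
  puts a jump at a grid point into the earlier cell, whose increment runs from below
  \<open>t\<close> up to \<open>f t\<close> and so contains the jump.\<close>

definition cell :: "nat \<Rightarrow> real \<Rightarrow> nat"
  where "cell n t = nat \<lceil>real n * t\<rceil> - 1"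

locale increasing_path =
  fixes f :: "real \<Rightarrow> real"
  assumes mono: "mono_on {0..} f"
    and right_cont: "t \<ge> 0 \<Longrightarrow> continuous (at_right t) f"
    and zero: "f 0 = 0"
begin

lemma le: "0 \<le> s \<Longrightarrow> s \<le> t \<Longrightarrow> f s \<le> f t"
  using mono by (auto simp: mono_on_def)

text \<open>\<open>jump\<close> is defined through the description operator \<open>Lim\<close>,
  about which nothing is known until a limit exists. For a nondecreasing path it is the supremum of
  the values before \<open>t\<close>.\<close>

lemma left_tendsto:
  assumes t: "t > 0"
  shows "(f \<longlongrightarrow> Lim (at_left t) f) (at_left t)"
proof -
  let ?S = "Sup (f ` {0..<t})"
  have bdd: "bdd_above (f ` {0..<t})" by (rule bdd_aboveI[of _ "f t"]) (auto intro: le)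
  have ne: "f ` {0..<t} \<noteq> {}" using t by auto
  have "(f \<longlongrightarrow> ?S) (at_left t)"
  proof (rule order_tendstoI)
    fix a assume "a < ?S"
    then obtain s where s: "s \<in> {0..<t}" "a < f s"
      using less_cSup_iff[OF ne bdd] by auto
    have "eventually (\<lambda>x. x \<in> {s<..<t}) (at_left t)"
      using s by (intro eventually_at_left_real) auto
    then show "eventually (\<lambda>x. a < f x) (at_left t)"
    proof eventually_elim
      case (elim x)
      then have "f s \<le> f x" using s by (intro le) auto
      then show ?case using s by simp
    qed
  next
    fix a assume a: "?S < a"
    have "eventually (\<lambda>x. x \<in> {0<..<t}) (at_left t)"
      using t by (intro eventually_at_left_real) auto
    then show "eventually (\<lambda>x. f x < a) (at_left t)"
    proof eventually_elim
      case (elim x)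
      then have "f x \<le> ?S" by (intro cSup_upper[OF _ bdd]) auto
      then show ?case using a by simp
    qed
  qed
  then show ?thesis using tendsto_Lim[OF trivial_limit_at_left_real] by metis
qed

lemma le_left_limit:
  assumes "0 \<le> s" "s < t"
  shows "f s \<le> Lim (at_left t) f"
proof (rule tendsto_lowerbound[OF left_tendsto])
  show "eventually (\<lambda>x. f s \<le> f x) (at_left t)"
    using eventually_at_left_real[OF assms(2)]
    by eventually_elim (use assms in \<open>auto intro: le\<close>)
qed (use assms in auto)

text \<open>Induction on the largest jump time \<open>t\<close>: if \<open>s\<close> is the largest
  of the other times, or \<open>a\<close> if there are none, the jump at \<open>t\<close> is at most
  \<open>f t - f s\<close>, and the bounds telescope.\<close>

lemma sum_jumps_le:
  assumes "finite J" "0 \<le> a" "a \<le> b" "J \<subseteq> {a<..b}"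
  shows "sum (jump f) J \<le> f b - f a"
  using assms
proof (induction J arbitrary: b rule: finite_linorder_max_induct)
  case empty
  then show ?case using le by simp
next
  case (insert t J)
  define s where "s = Max (insert a J)"
  have s: "a \<le> s" "s < t" "J \<subseteq> {a<..s}"
    using insert.prems insert.hyps by (auto simp: s_def)
  have "sum (jump f) J \<le> f s - f a" using insert.IH[of s] insert.prems s by simp
  moreover have "jump f t \<le> f t - f s"
    unfolding jump_def using le_left_limit[of s t] s insert.prems by simp
  moreover have "f t \<le> f b" using insert.prems by (intro le) auto
  ultimately show ?case using insert.hyps s by (subst sum.insert) auto
qed

lemma jump_le: "t \<in> {0<..1} \<Longrightarrow> jump f t \<le> f 1"
  using sum_jumps_le[of "{t}" 0 1] zero by auto

text \<open>No more than \<open>f 1 / y\<close> jumps can have size \<open>y\<close>, because all of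
  them together fit into \<open>f 1\<close>. This is the finiteness that
  \<open>ranked_ge_iff\<close> asks for.\<close>

lemma finite_big_jumps:
  assumes "y > 0"
  shows "finite {t \<in> {0<..1}. y \<le> jump f t}"
proof (rule ccontr)
  assume "infinite {t \<in> {0<..1}. y \<le> jump f t}"
  then obtain J where J: "finite J" "card J = Suc (nat \<lfloor>f 1 / y\<rfloor>)" "J \<subseteq> {t \<in> {0<..1}. y \<le> jump f t}"
    using infinite_arbitrarily_large by blast
  have "real (card J) * y \<le> sum (jump f) J"
    using sum_mono[of J "\<lambda>_. y" "jump f"] J by auto
  also have "\<dots> \<le> f 1" using sum_jumps_le[of J 0 1] J zero by force
  finally have "real (card J) \<le> f 1 / y" using assms by (simp add: field_simps)
  then show False using J(2) by linarith
qed

section \<open>Ranked jumps of a path\<close>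

abbreviation rank where "rank \<equiv> jump_rank f"

lemma rank_ge_iff: "x > 0 \<Longrightarrow> x \<le> rank i \<longleftrightarrow> i < card {t \<in> {0<..1}. x \<le> jump f t}"
  unfolding jump_rank_def by (rule ranked_ge_iff[OF finite_big_jumps])

lemma rank_nonneg: "0 \<le> rank i"
proof -
  let ?S = "{Min (jump f ` J) |J. J \<subseteq> {0<..1::real} \<and> finite J \<and> card J = Suc i}"
  have "bdd_above (insert 0 ?S)"
  proof (rule bdd_aboveI)
    fix v assume "v \<in> insert 0 ?S"
    then consider "v = 0" | J where "J \<subseteq> {0<..1}" "finite J" "card J = Suc i" "v = Min (jump f ` J)"
      by auto
    then show "v \<le> f 1"
    proof cases
      case 1 then show ?thesis using le[of 0 1] zero by simp
    next
      case 2
      then have "jump f ` J \<noteq> {}" by auto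
      then have "v \<in> jump f ` J" using 2 by simp
      then obtain t where "t \<in> {0<..1}" "v = jump f t" using 2 by auto
      then show ?thesis using jump_le by simp
    qed
  qed
  then show ?thesis unfolding jump_rank_def ranked_def by (intro cSup_upper) auto
qed

lemma rank_zero_iff: "rank i = 0 \<longleftrightarrow> \<not> rank i > 0"
  using rank_nonneg[of i] by linarith

lemma rank_decseq: "decseq rank"
proof (rule decseq_SucI)
  fix i
  show "rank (Suc i) \<le> rank i"
  proof (cases "rank (Suc i) > 0")
    case True
    then show ?thesis using rank_ge_iff[OF True, of "Suc i"] rank_ge_iff[OF True, of i] by simp
  next
    case False
    then show ?thesis using rank_nonneg[of i] by simp
  qed
qed

lemma big_rank_eq: "y > 0 \<Longrightarrow> {i. y \<le> rank i} = {..<card {t \<in> {0<..1}. y \<le> jump f t}}"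
  using rank_ge_iff by auto

text \<open>Sorting the finitely many jump times of size at least \<open>y\<close> by decreasing
  jump matches them with the first ranks. It is the only passage from ranks back to jump times,
  which are needed to locate the jumps in cells.\<close>

lemma rank_enumerates:
  assumes y: "y > 0"
  obtains d where "bij_betw d {i. y \<le> rank i} {t \<in> {0<..1}. y \<le> jump f t}"
    "\<And>i. y \<le> rank i \<Longrightarrow> jump f (d i) = rank i"
proof -
  let ?D = "{t \<in> {0<..1}. y \<le> jump f t}"
  have fin: "finite ?D" by (rule finite_big_jumps[OF y])
  obtain l where l: "set l = ?D" "distinct l" "sorted (map (\<lambda>t. - jump f t) l)"
  proof -
    obtain l0 where "set l0 = ?D" "distinct l0" using finite_distinct_list[OF fin] by auto
    then show ?thesis using that[of "sort_key (\<lambda>t. - jump f t) l0"] by auto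
  qed
  define m where "m = length l"
  have m: "m = card ?D" using l distinct_card[of l] by (simp add: m_def)
  have ranks: "{i. y \<le> rank i} = {..<m}" using big_rank_eq[OF y] m by simp
  have dec: "jump f (l ! j) \<le> jump f (l ! i)" if "i \<le> j" "j < m" for i j
    using sorted_nth_mono[OF l(3), of i j] that by (simp add: m_def)
  have bij: "bij_betw (nth l) {..<m} ?D"
    using bij_betw_nth[OF l(2), of "{..<m}" ?D] l m_def by simp
  \<comment> \<open>\<open>rank_ge_iff\<close> describes ranks by thresholds only. Two numbers of
    size at least \<open>y\<close> that exceed the same thresholds \<open>x\<close> from
    \<open>y\<close> on are equal.\<close>
  have iff: "x \<le> rank i \<longleftrightarrow> x \<le> jump f (l ! i)" if "i < m" "x \<ge> y" for i x
  proof -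
    have "{t \<in> {0<..1}. x \<le> jump f t} = nth l ` {j. j < m \<and> x \<le> jump f (l ! j)}"
    proof -
      have "{t \<in> {0<..1}. x \<le> jump f t} = {t \<in> ?D. x \<le> jump f t}" using that by auto
      also have "\<dots> = {t \<in> nth l ` {..<m}. x \<le> jump f t}" using bij by (simp add: bij_betw_def)
      finally show ?thesis by auto
    qed
    then have card: "card {t \<in> {0<..1}. x \<le> jump f t} = card {j. j < m \<and> x \<le> jump f (l ! j)}"
      using bij by (auto simp: bij_betw_def intro!: card_image intro: inj_on_subset)
    have "x \<le> rank i \<longleftrightarrow> i < card {j. j < m \<and> x \<le> jump f (l ! j)}"
      using rank_ge_iff[of x] y that card by auto
    also have "\<dots> \<longleftrightarrow> x \<le> jump f (l ! i)"
    proof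
      assume "i < card {j. j < m \<and> x \<le> jump f (l ! j)}"
      then have "\<not> {j. j < m \<and> x \<le> jump f (l ! j)} \<subseteq> {..<i}"
        using card_mono[of "{..<i}" "{j. j < m \<and> x \<le> jump f (l ! j)}"] by auto
      then obtain j where "j < m" "x \<le> jump f (l ! j)" "i \<le> j" by (auto simp: subset_eq not_less)
      then show "x \<le> jump f (l ! i)" using dec[of i j] by simp
    next
      assume "x \<le> jump f (l ! i)"
      then have "{..i} \<subseteq> {j. j < m \<and> x \<le> jump f (l ! j)}"
        using dec[OF _ \<open>i < m\<close>] \<open>i < m\<close> by (auto intro: order_trans)
      then have "card {..i} \<le> card {j. j < m \<and> x \<le> jump f (l ! j)}" by (intro card_mono) auto
      then show "i < card {j. j < m \<and> x \<le> jump f (l ! j)}" by simp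
    qed
    finally show ?thesis .
  qed
  have "jump f (l ! i) = rank i" if "y \<le> rank i" for i
  proof -
    have i: "i < m" using that ranks by auto
    then have "l ! i \<in> ?D" using bij by (auto simp: bij_betw_def)
    then have "y \<le> jump f (l ! i)" by simp
    then show ?thesis using iff[OF i, of "jump f (l ! i)"] iff[OF i, of "rank i"] that by auto
  qed
  then show ?thesis using that bij ranks by auto
qed

text \<open>A rank equal to 0 may be mere padding without a jump time. Hence only the positive ranks
  in \<open>I\<close> are matched with times, the smallest of them serving as threshold for
  \<open>rank_enumerates\<close>.\<close>

lemma rank_sum_as_jump_sum:
  assumes "finite I"
  obtains J where "finite J" "J \<subseteq> {0<..1}" "\<forall>t\<in>J. jump f t > 0" "sum rank I = sum (jump f) J"
proof -
  let ?I = "{i \<in> I. rank i > 0}"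
  have split: "sum rank I = sum rank ?I"
    using assms by (intro sum.mono_neutral_right) (auto simp: rank_zero_iff)
  show ?thesis
  proof (cases "?I = {}")
    case True
    then show ?thesis using that[of "{}"] split by (simp only: sum.empty) simp
  next
    case False
    define y where "y = Min (rank ` ?I)"
    have "y \<in> rank ` ?I" unfolding y_def using False assms by (intro Min_in) auto
    then have y: "y > 0" by auto
    have yI: "?I \<subseteq> {i. y \<le> rank i}" using assms by (auto simp: y_def)
    obtain d where d: "bij_betw d {i. y \<le> rank i} {t \<in> {0<..1}. y \<le> jump f t}"
      "\<And>i. y \<le> rank i \<Longrightarrow> jump f (d i) = rank i" using rank_enumerates[OF y] by metis
    have inj: "inj_on d ?I" using d(1) yI by (auto simp: bij_betw_def intro: inj_on_subset)
    show ?thesis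
    proof (rule that)
      show "finite (d ` ?I)" using assms by simp
      show "d ` ?I \<subseteq> {0<..1}" using bij_betw_imp_surj_on[OF d(1)] yI by blast
      show "\<forall>t\<in>d ` ?I. jump f t > 0" using d(2) yI by auto
      show "sum rank I = sum (jump f) (d ` ?I)"
        unfolding split using sum.reindex[OF inj, of "jump f"] d(2) yI by (auto intro!: sum.cong)
    qed
  qed
qed

lemma sum_rank_le:
  assumes "finite I"
  shows "sum rank I \<le> f 1"
proof -
  obtain J where "finite J" "J \<subseteq> {0<..1}" "sum rank I = sum (jump f) J"
    using rank_sum_as_jump_sum[OF assms] by metis
  then show ?thesis using sum_jumps_le[of J 0 1] zero by simp
qed

lemma rank_summable: "summable rank"
  using sum_rank_le rank_nonneg by (intro summableI_nonneg_bounded[of rank "f 1"]) auto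

lemma suminf_rank_le: "suminf rank \<le> f 1"
  using sum_rank_le rank_summable by (intro suminf_le_const) auto

section \<open>Increments over the cells of a grid\<close>

abbreviation incr where "incr \<equiv> increment f"

lemma incr_nonneg: "0 \<le> incr n c"
  unfolding increment_def using le[of "real c / real n" "real (Suc c) / real n"]
  by (simp add: divide_right_mono)

lemma sum_incr: "n > 0 \<Longrightarrow> (\<Sum>c<n. incr n c) = f 1"
  using sum_lessThan_telescope[of "\<lambda>c. f (real c / real n)" n] zero by (simp add: increment_def)

text \<open>The increment over a cell without jumps is mass that jumps cannot account for: all other
  jumps together would be at most \<open>f 1 - incr n c\<close>, less than the sum of the
  ranks.\<close>

lemma jump_in_cell:
  assumes "n > 0" "c < n" "suminf rank = f 1" "incr n c > 0"
  shows "\<exists>t \<in> {real c / real n<..real (Suc c) / real n}. jump f t > 0"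
proof (rule ccontr)
  assume none: "\<not> ?thesis"
  let ?a = "real c / real n" and ?b = "real (Suc c) / real n"
  have ab: "0 \<le> ?a" "?a \<le> ?b" "?b \<le> 1" using assms by (auto simp: divide_simps)
  have bound: "sum (jump f) J \<le> f 1 - incr n c" if J: "finite J" "J \<subseteq> {0<..1}" "\<forall>t\<in>J. jump f t > 0" for J
  proof -
    have "J = {t\<in>J. t \<le> ?a} \<union> {t\<in>J. t > ?b}" using none J by fastforce
    moreover have "sum (jump f) ({t\<in>J. t \<le> ?a} \<union> {t\<in>J. t > ?b})
        = sum (jump f) {t\<in>J. t \<le> ?a} + sum (jump f) {t\<in>J. t > ?b}"
      using J ab by (intro sum.union_disjoint) auto
    moreover have "sum (jump f) {t\<in>J. t \<le> ?a} \<le> f ?a - f 0"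
      using J ab by (intro sum_jumps_le) auto
    moreover have "sum (jump f) {t\<in>J. t > ?b} \<le> f 1 - f ?b"
      using J ab by (intro sum_jumps_le) auto
    ultimately show ?thesis using zero by (simp add: increment_def)
  qed
  have "suminf rank \<le> f 1 - incr n c"
  proof (rule suminf_le_const[OF rank_summable])
    fix N
    obtain J where "finite J" "J \<subseteq> {0<..1}" "\<forall>t\<in>J. jump f t > 0" "sum rank {..<N} = sum (jump f) J"
      using rank_sum_as_jump_sum[of "{..<N}"] by (metis finite_lessThan)
    then show "sum rank {..<N} \<le> f 1 - incr n c" using bound[of J] by simp
  qed
  then show False using assms by simp
qed

text \<open>Each of the \<open>i + 1\<close> cells of the grid of mesh \<open>1 / (i + 1)\<close>
  contains a jump, so there are at least \<open>i + 1\<close> jumps. Infinitely many positive parts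
  guarantee later that mass is left after any number of picks.\<close>

lemma rank_pos:
  assumes sum: "suminf rank = f 1" and pos: "\<And>n c. c < n \<Longrightarrow> incr n c > 0"
  shows "rank i > 0"
proof -
  let ?n = "Suc i"
  have "\<exists>t. t \<in> {real c / real ?n<..real (Suc c) / real ?n} \<and> jump f t > 0" if "c < ?n" for c
    using jump_in_cell[of ?n c] that pos[of c ?n] sum by blast
  then obtain \<tau> where \<tau>: "\<And>c. c < ?n \<Longrightarrow> \<tau> c \<in> {real c / real ?n<..real (Suc c) / real ?n}"
    "\<And>c. c < ?n \<Longrightarrow> jump f (\<tau> c) > 0" by metis
  have less: "\<tau> c < \<tau> c'" if "c < c'" "c' < ?n" for c c'
  proof -
    have "\<tau> c \<le> real (Suc c) / real ?n" using \<tau>(1)[of c] that by auto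
    also have "\<dots> \<le> real c' / real ?n" using that by (intro divide_right_mono) auto
    also have "\<dots> < \<tau> c'" using \<tau>(1)[of c'] that by auto
    finally show ?thesis .
  qed
  have inj: "inj_on \<tau> {..<?n}"
  proof (rule inj_onI)
    fix c c' assume "c \<in> {..<?n}" "c' \<in> {..<?n}" "\<tau> c = \<tau> c'"
    then show "c = c'" using less[of c c'] less[of c' c] by (cases c c' rule: linorder_cases) auto
  qed
  define y where "y = Min (jump f ` \<tau> ` {..<?n})"
  have "y \<in> jump f ` \<tau> ` {..<?n}" unfolding y_def by (intro Min_in) (auto simp: lessThan_empty_iff)
  then have y: "y > 0" using \<tau> by auto
  have "\<tau> ` {..<?n} \<subseteq> {t \<in> {0<..1}. y \<le> jump f t}"
  proof
    fix t assume "t \<in> \<tau> ` {..<?n}"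
    then obtain c where c: "c < ?n" "t = \<tau> c" by auto
    have "real (Suc c) / real ?n \<le> 1" "0 \<le> real c / real ?n" using c by (auto simp: divide_simps)
    moreover have "y \<le> jump f t" unfolding y_def using c by (intro Min_le) auto
    moreover have "real c / real ?n < \<tau> c" "\<tau> c \<le> real (Suc c) / real ?n" using \<tau>(1)[OF c(1)] by auto
    ultimately have "0 < \<tau> c" "\<tau> c \<le> 1" "y \<le> jump f t" by linarith+
    then show "t \<in> {t \<in> {0<..1}. y \<le> jump f t}" using c by auto
  qed
  then have "card (\<tau> ` {..<?n}) \<le> card {t \<in> {0<..1}. y \<le> jump f t}"
    using finite_big_jumps[OF y] by (intro card_mono) auto
  then have "y \<le> rank i" using rank_ge_iff[OF y] card_image[OF inj] by simp
  then show ?thesis using y by simp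
qed

lemma cell_bounds:
  assumes "t \<in> {0<..1}" "n > 0"
  shows "cell n t < n" "real (cell n t) / real n < t" "t \<le> real (Suc (cell n t)) / real n"
proof -
  have pos: "real n * t > 0" using assms by simp
  then have "\<lceil>real n * t\<rceil> \<ge> 1" by linarith
  then have c: "real (cell n t) = real_of_int \<lceil>real n * t\<rceil> - 1"
    unfolding cell_def by linarith
  have "real n * t \<le> real n" using assms by (simp add: mult_left_le)
  then have "\<lceil>real n * t\<rceil> \<le> int n" by (simp add: ceiling_le_iff)
  then show "cell n t < n" using c by linarith
  show "real (cell n t) / real n < t"
    using c assms by (simp add: pos_divide_less_eq mult.commute) linarith
  show "t \<le> real (Suc (cell n t)) / real n"
    using c assms by (simp add: pos_le_divide_eq mult.commute)
qed

lemma cell_unique: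
  assumes "n > 0" "real c / real n < t" "t \<le> real (Suc c) / real n"
  shows "cell n t = c"
proof -
  have "real c < real n * t" "real n * t \<le> real c + 1"
    using assms by (simp_all add: pos_divide_less_eq pos_le_divide_eq mult.commute add.commute)
  then have "\<lceil>real n * t\<rceil> = int c + 1" by (simp add: ceiling_eq_iff)
  then show ?thesis by (simp add: cell_def nat_add_distrib)
qed

lemma right_nbhd:
  assumes "t \<ge> 0" "\<eta> > 0"
  obtains b where "b > t" "\<And>x. t \<le> x \<Longrightarrow> x < b \<Longrightarrow> f x < f t + \<eta>"
proof -
  have "(f \<longlongrightarrow> f t) (at_right t)" using right_cont[OF assms(1)] by (simp add: continuous_within)
  then have "eventually (\<lambda>x. f x < f t + \<eta>) (at_right t)"
    using assms by (intro order_tendstoD(2)) auto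
  then obtain b where "b > t" "\<And>x. t < x \<Longrightarrow> x < b \<Longrightarrow> f x < f t + \<eta>"
    by (auto simp: eventually_at_right_field)
  then show ?thesis using that[of b] assms by (metis less_add_same_cancel1 order_le_less)
qed

lemma left_nbhd:
  assumes "t > 0" "\<eta> > 0"
  obtains a where "a < t" "\<And>x. a < x \<Longrightarrow> x < t \<Longrightarrow> Lim (at_left t) f - \<eta> < f x"
proof -
  have "eventually (\<lambda>x. Lim (at_left t) f - \<eta> < f x) (at_left t)"
    using assms by (intro order_tendstoD(1)[OF left_tendsto]) auto
  then show ?thesis using that by (auto simp: eventually_at_left_field)
qed

lemma cell_ends_tendsto:
  assumes t: "t \<in> {0<..1}"
  shows "(\<lambda>n. real (cell n t) / real n) \<longlonglongrightarrow> t"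
    and "(\<lambda>n. real (Suc (cell n t)) / real n) \<longlonglongrightarrow> t"
proof -
  have lim1: "(\<lambda>n. t + 1 / real n) \<longlonglongrightarrow> t + 0" "(\<lambda>n. t - 1 / real n) \<longlonglongrightarrow> t - 0"
    by (intro tendsto_intros lim_1_over_n)+
  have ev: "\<forall>\<^sub>F n in sequentially. real (cell n t) / real n < t \<and> t \<le> real (cell n t) / real n + 1 / real n
      \<and> real (Suc (cell n t)) / real n = real (cell n t) / real n + 1 / real n"
    using eventually_gt_at_top[of "0::nat"]
    by eventually_elim (use cell_bounds[OF t] in \<open>auto simp: add_divide_distrib add.commute\<close>)
  show "(\<lambda>n. real (cell n t) / real n) \<longlonglongrightarrow> t"
    by (rule tendsto_sandwich[OF _ _ lim1(2)[simplified] tendsto_const])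
      (use ev in \<open>auto elim!: eventually_mono\<close>)
  show "(\<lambda>n. real (Suc (cell n t)) / real n) \<longlonglongrightarrow> t"
    by (rule tendsto_sandwich[OF _ _ tendsto_const lim1(1)[simplified]])
      (use ev in \<open>auto elim!: eventually_mono\<close>)
qed

lemma incr_cell_tendsto:
  assumes t: "t \<in> {0<..1}"
  shows "(\<lambda>n. incr n (cell n t)) \<longlonglongrightarrow> jump f t"
proof -
  have "filterlim (\<lambda>n. real (cell n t) / real n) (at_left t) sequentially"
    by (intro tendsto_imp_filterlim_at_left cell_ends_tendsto[OF t]
      eventually_mono[OF eventually_gt_at_top[of "0::nat"]] cell_bounds(2)[OF t])
  then have left: "(\<lambda>n. f (real (cell n t) / real n)) \<longlonglongrightarrow> Lim (at_left t) f"
    using filterlim_compose[OF left_tendsto] t by auto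
  \<comment> \<open>The right end of the cell may be \<open>t\<close> itself, so it need not tend to
    \<open>t\<close> within \<open>at_right t\<close>. Monotonicity gives the lower bound and
    \<open>right_nbhd\<close> the upper one.\<close>
  have right: "(\<lambda>n. f (real (Suc (cell n t)) / real n)) \<longlonglongrightarrow> f t"
  proof (rule order_tendstoI)
    fix a assume "a < f t"
    show "\<forall>\<^sub>F n in sequentially. a < f (real (Suc (cell n t)) / real n)"
      using eventually_gt_at_top[of "0::nat"]
    proof eventually_elim
      case (elim n)
      have "f t \<le> f (real (Suc (cell n t)) / real n)"
        using cell_bounds(3)[OF t elim] t by (intro le) auto
      then show ?case using \<open>a < f t\<close> by simp
    qed
  next
    fix a assume a: "f t < a"
    obtain b where b: "b > t" "\<And>x. t \<le> x \<Longrightarrow> x < b \<Longrightarrow> f x < f t + (a - f t)"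
      using right_nbhd[of t "a - f t"] a t by auto
    show "\<forall>\<^sub>F n in sequentially. f (real (Suc (cell n t)) / real n) < a"
      using eventually_gt_at_top[of "0::nat"] order_tendstoD(2)[OF cell_ends_tendsto(2)[OF t] b(1)]
      by eventually_elim (use b(2) cell_bounds(3)[OF t] in auto)
  qed
  show ?thesis unfolding increment_def jump_def by (intro tendsto_diff left right)
qed

lemma cell_separates:
  assumes "s \<in> {0<..1}" "t \<in> {0<..1}" "s \<noteq> t"
  shows "\<forall>\<^sub>F n in sequentially. cell n s \<noteq> cell n t"
proof (rule ccontr)
  assume "\<not> ?thesis"
  then have fr: "\<exists>\<^sub>F n in sequentially. cell n s = cell n t" by (simp add: frequently_def)
  have "(\<lambda>n. real (cell n s) / real n - real (cell n t) / real n) \<longlonglongrightarrow> s - t"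
    using assms by (intro tendsto_diff cell_ends_tendsto)
  then have "\<forall>\<^sub>F n in sequentially. real (cell n s) / real n - real (cell n t) / real n \<noteq> 0"
    using assms by (intro tendsto_imp_eventually_ne) auto
  then have "\<forall>\<^sub>F n in sequentially. cell n s \<noteq> cell n t" by (auto elim!: eventually_mono)
  then show False using fr by (simp add: frequently_def)
qed

text \<open>On either side of \<open>t\<close> the path stays close to its one-sided limit, so
  within a small neighbourhood an increment can be large only if it straddles a large jump at
  \<open>t\<close>. The gap \<open>y' - y\<close> is split in two halves, one for each side.\<close>

lemma small_increments_nbhd:
  assumes y: "0 < y" "y < y'" and t: "t \<in> {0..1}"
  shows "\<exists>U. open U \<and> t \<in> U \<and> (\<forall>r s. 0 \<le> r \<longrightarrow> r < s \<longrightarrow> r \<in> U \<longrightarrow> s \<in> U \<longrightarrow>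
    r < t \<and> t \<le> s \<and> y \<le> jump f t \<or> f s - f r < y')"
proof -
  define \<eta> where "\<eta> = (y' - y) / 2"
  have \<eta>: "\<eta> > 0" "\<eta> < y'" "y + 2 * \<eta> = y'" using y by (auto simp: \<eta>_def field_simps)
  obtain b where b: "b > t" "\<And>x. t \<le> x \<Longrightarrow> x < b \<Longrightarrow> f x < f t + \<eta>"
    using right_nbhd[of t \<eta>] t \<eta> by auto
  have right: "f s - f r < y'" if "t \<le> r" "r < s" "s < b" for r s
    using b(2)[of s] le[of t r] that t \<eta> by auto
  show ?thesis
  proof (cases "t = 0")
    case True
    show ?thesis
      by (rule exI[of _ "{..<b}"]) (use b True right in auto)
  next
    case False
    then have t0: "t > 0" using t by auto
    obtain a where a: "a < t" "\<And>x. a < x \<Longrightarrow> x < t \<Longrightarrow> Lim (at_left t) f - \<eta> < f x"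
      using left_nbhd[OF t0 \<eta>(1)] by auto
    have left: "f s - f r < y'" if "0 \<le> r" "a < r" "r < s" "s < t" for r s
      using a(2)[of r] le_left_limit[of s t] that \<eta> by auto
    have mid: "f s - f r < y'" if "a < r" "r < t" "t \<le> s" "s < b" "jump f t < y" for r s
      using a(2)[of r] b(2)[of s] that \<eta> by (auto simp: jump_def)
    show ?thesis
    proof (intro exI[of _ "{a<..<b}"] conjI allI impI)
      fix r s assume rs: "0 \<le> r" "r < s" "r \<in> {a<..<b}" "s \<in> {a<..<b}"
      consider "t \<le> r" | "s < t" | "r < t" "t \<le> s" "jump f t < y" | "r < t" "t \<le> s" "y \<le> jump f t" by linarith
      then show "r < t \<and> t \<le> s \<and> y \<le> jump f t \<or> f s - f r < y'"
        by cases (use rs left[of r s] right[of r s] mid[of r s] in \<open>auto simp: not_le\<close>)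
    qed (use a b in auto)
  qed
qed

text \<open>The neighbourhoods of \<open>small_increments_nbhd\<close> cover the compact interval
  \<open>{0..1}\<close>. Once the mesh is below a Lebesgue number of this cover, every closed cell
  lies in one of them, which makes the local statement uniform.\<close>

lemma small_incr:
  assumes y: "0 < y" "y < y'"
  shows "\<forall>\<^sub>F n in sequentially. \<forall>c<n. c \<notin> cell n ` {t \<in> {0<..1}. y \<le> jump f t} \<longrightarrow> incr n c < y'"
proof -
  obtain U where U: "\<And>t. t \<in> {0..1} \<Longrightarrow> open (U t) \<and> t \<in> U t \<and> (\<forall>r s. 0 \<le> r \<longrightarrow> r < s \<longrightarrow> r \<in> U t \<longrightarrow> s \<in> U t \<longrightarrow>
    r < t \<and> t \<le> s \<and> y \<le> jump f t \<or> f s - f r < y')"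
    using small_increments_nbhd[OF y] by metis
  obtain \<delta> where \<delta>: "\<delta> > 0" "\<And>T. T \<subseteq> {0..1} \<Longrightarrow> diameter T < \<delta> \<Longrightarrow> \<exists>B\<in>U ` {0..1}. T \<subseteq> B"
  proof (rule Lebesgue_number_lemma[of "{0..1::real}" "U ` {0..1}"])
    show "{0..1} \<subseteq> \<Union> (U ` {0..1})" using U by blast
  qed (use U in auto)
  have "(\<lambda>n. 1 / real n) \<longlonglongrightarrow> 0" by (rule lim_1_over_n)
  then have "\<forall>\<^sub>F n in sequentially. 1 / real n < \<delta>" using \<delta>(1) by (rule order_tendstoD(2))
  then show ?thesis using eventually_gt_at_top[of "0::nat"]
  proof eventually_elim
    case (elim n)
    show ?case
    proof (intro allI impI)
      fix c assume c: "c < n" "c \<notin> cell n ` {t \<in> {0<..1}. y \<le> jump f t}"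
      define r s where "r = real c / real n" and "s = real (Suc c) / real n"
      have rs: "0 \<le> r" "r < s" "s \<le> 1" "s - r = 1 / real n"
        using c by (auto simp: r_def s_def field_simps)
      have "{r..s} \<subseteq> {0..1}" "diameter {r..s} < \<delta>" using rs elim by (auto simp: diameter_closed_interval)
      then obtain t where t: "t \<in> {0..1}" "{r..s} \<subseteq> U t" using \<delta>(2) by blast
      have "r \<in> U t" "s \<in> U t" using t rs by auto
      then have "r < t \<and> t \<le> s \<and> y \<le> jump f t \<or> f s - f r < y'" using U[OF t(1)] rs by blast
      moreover have "\<not> (r < t \<and> t \<le> s \<and> y \<le> jump f t)"
      proof
        assume a: "r < t \<and> t \<le> s \<and> y \<le> jump f t"
        then have "cell n t = c" using elim by (intro cell_unique) (auto simp: r_def s_def)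
        then show False using c(2) a rs t by auto
      qed
      ultimately show "incr n c < y'" by (auto simp only: increment_def r_def s_def)
    qed
  qed
qed

text \<open>The interface between grid and ranking used for all pathwise limits: the finitely many
  big jumps eventually occupy different cells, their increments converge to the ranks, and all other
  increments are small.\<close>

lemma rank_cells:
  assumes y: "y > 0"
  obtains m e where "{i. y \<le> rank i} = {..<m}"
    "\<forall>\<^sub>F n in sequentially. inj_on (e n) {..<m} \<and> e n ` {..<m} \<subseteq> {..<n}"
    "\<And>i. i < m \<Longrightarrow> (\<lambda>n. incr n (e n i)) \<longlonglongrightarrow> rank i"
    "\<And>y'. y < y' \<Longrightarrow> \<forall>\<^sub>F n in sequentially. \<forall>c<n. c \<notin> e n ` {..<m} \<longrightarrow> incr n c < y'"
proof -
  obtain d where d: "bij_betw d {i. y \<le> rank i} {t \<in> {0<..1}. y \<le> jump f t}"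
    "\<And>i. y \<le> rank i \<Longrightarrow> jump f (d i) = rank i" using rank_enumerates[OF y] by metis
  obtain m where m: "{i. y \<le> rank i} = {..<m}" using big_rank_eq[OF y] by metis
  have dm: "d i \<in> {0<..1}" if "i < m" for i
    using bij_betwE[OF d(1)] m that by blast
  have dd: "d i \<noteq> d j" if "i < m" "j < m" "i \<noteq> j" for i j
    using bij_betw_imp_inj_on[OF d(1)] m that by (auto simp: inj_on_def)
  show ?thesis
  proof (rule that[of m "\<lambda>n i. cell n (d i)", OF m])
    have "\<forall>\<^sub>F n in sequentially. \<forall>p\<in>{..<m} \<times> {..<m}. fst p \<noteq> snd p \<longrightarrow> cell n (d (fst p)) \<noteq> cell n (d (snd p))"
    proof (intro eventually_ball_finite ballI)
      fix p assume p: "p \<in> {..<m} \<times> {..<m}"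
      show "\<forall>\<^sub>F n in sequentially. fst p \<noteq> snd p \<longrightarrow> cell n (d (fst p)) \<noteq> cell n (d (snd p))"
      proof (cases "fst p = snd p")
        case False
        then show ?thesis
          using cell_separates[of "d (fst p)" "d (snd p)"] p dm dd[of "fst p" "snd p"]
          by (auto elim!: eventually_mono)
      qed simp
    qed auto
    then show "\<forall>\<^sub>F n in sequentially. inj_on (\<lambda>i. cell n (d i)) {..<m} \<and> (\<lambda>i. cell n (d i)) ` {..<m} \<subseteq> {..<n}"
      using eventually_gt_at_top[of "0::nat"]
    proof eventually_elim
      case (elim n)
      have "cell n (d i) < n" if "i < m" for i using cell_bounds(1)[OF dm[OF that] elim(2)] .
      moreover have "inj_on (\<lambda>i. cell n (d i)) {..<m}"
      proof (rule inj_onI)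
        fix i j assume "i \<in> {..<m}" "j \<in> {..<m}" "cell n (d i) = cell n (d j)"
        then show "i = j" using bspec[OF elim(1), of "(i, j)"] by auto
      qed
      ultimately show ?case by auto
    qed
    show "(\<lambda>n. incr n (cell n (d i))) \<longlonglongrightarrow> rank i" if "i < m" for i
    proof -
      have "i \<in> {i. y \<le> rank i}" unfolding m using that by simp
      then show ?thesis using incr_cell_tendsto[OF dm[OF that]] d(2)[of i] by simp
    qed
    show "\<forall>\<^sub>F n in sequentially. \<forall>c<n. c \<notin> (\<lambda>i. cell n (d i)) ` {..<m} \<longrightarrow> incr n c < y'" if "y < y'" for y'
    proof -
      have "{t \<in> {0<..1}. y \<le> jump f t} = d ` {..<m}"
        using bij_betw_imp_surj_on[OF d(1)] m by simp
      then show ?thesis using small_incr[OF y that] by (simp add: image_image)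
    qed
  qed
qed

text \<open>Expresses a rank through countably many increments, which yields the measurability of
  the ranked jumps. The margin \<open>1 / (q + 1)\<close> leaves room for increments that only
  approach the jumps.\<close>

lemma less_rank_iff:
  assumes x: "x \<ge> 0"
  shows "x < rank i \<longleftrightarrow>
    (\<exists>q. \<forall>\<^sub>F n in sequentially. i < card {c \<in> {..<n}. x + 1 / real (Suc q) \<le> incr n c})"
proof
  assume "x < rank i"
  then obtain q where q: "1 / real (Suc q) < rank i - x" using nat_approx_posE[of "rank i - x"] by auto
  define y where "y = x + 1 / real (Suc q)"
  have y: "y > 0" "y < rank i" using q x by (auto simp: y_def add_nonneg_pos)
  obtain m e where m: "{i. y \<le> rank i} = {..<m}"
    "\<forall>\<^sub>F n in sequentially. inj_on (e n) {..<m} \<and> e n ` {..<m} \<subseteq> {..<n}"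
    "\<And>i. i < m \<Longrightarrow> (\<lambda>n. incr n (e n i)) \<longlonglongrightarrow> rank i"
    "\<And>y'. y < y' \<Longrightarrow> \<forall>\<^sub>F n in sequentially. \<forall>c<n. c \<notin> e n ` {..<m} \<longrightarrow> incr n c < y'"
    using rank_cells[OF y(1)] by blast
  have "i \<in> {i. y \<le> rank i}" using y by simp
  then have i: "i < m" unfolding m(1) by simp
  have "\<forall>\<^sub>F n in sequentially. \<forall>j\<in>{..i}. y < incr n (e n j)"
  proof (intro eventually_ball_finite ballI)
    fix j assume "j \<in> {..i}"
    then have "y < rank j" "j < m" using y rank_decseq i by (auto intro: less_le_trans decseqD)
    then show "\<forall>\<^sub>F n in sequentially. y < incr n (e n j)" using m(3) order_tendstoD(1) by blast
  qed simp
  then have "\<forall>\<^sub>F n in sequentially. i < card {c \<in> {..<n}. y \<le> incr n c}"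
    using m(2)
  proof eventually_elim
    case (elim n)
    have inj: "inj_on (e n) {..i}" using elim i by (auto intro: inj_on_subset)
    have "e n j \<in> {..<n}" if "j \<le> i" for j using elim(2) i that by (auto simp: image_subset_iff)
    then have "e n ` {..i} \<subseteq> {c \<in> {..<n}. y \<le> incr n c}" using elim(1) by (auto intro: less_imp_le)
    then have "card (e n ` {..i}) \<le> card {c \<in> {..<n}. y \<le> incr n c}" by (intro card_mono) auto
    then show ?case using card_image[OF inj] by simp
  qed
  then show "\<exists>q. \<forall>\<^sub>F n in sequentially. i < card {c \<in> {..<n}. x + 1 / real (Suc q) \<le> incr n c}"
    unfolding y_def by blast
next
  assume "\<exists>q. \<forall>\<^sub>F n in sequentially. i < card {c \<in> {..<n}. x + 1 / real (Suc q) \<le> incr n c}"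
  then obtain q where q: "\<forall>\<^sub>F n in sequentially. i < card {c \<in> {..<n}. x + 1 / real (Suc q) \<le> incr n c}" by blast
  define y' y where "y' = x + 1 / real (Suc q)" and "y = x + 1 / real (Suc q) / 2"
  have y: "0 < y" "y < y'" "x < y" using x by (auto simp: y'_def y_def field_simps add_pos_nonneg)
  show "x < rank i"
  proof (rule ccontr)
    assume "\<not> x < rank i"
    then have iy: "\<not> y \<le> rank i" using y by auto
    obtain m e where m: "{i. y \<le> rank i} = {..<m}"
      "\<forall>\<^sub>F n in sequentially. inj_on (e n) {..<m} \<and> e n ` {..<m} \<subseteq> {..<n}"
      "\<And>i. i < m \<Longrightarrow> (\<lambda>n. incr n (e n i)) \<longlonglongrightarrow> rank i"
      "\<And>y'. y < y' \<Longrightarrow> \<forall>\<^sub>F n in sequentially. \<forall>c<n. c \<notin> e n ` {..<m} \<longrightarrow> incr n c < y'"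
      using rank_cells[OF y(1)] by blast
    have mi: "m \<le> i" using m(1) iy by (metis lessThan_iff mem_Collect_eq not_less)
    have "\<forall>\<^sub>F n in sequentially. False"
      using m(4)[OF y(2)] q
    proof eventually_elim
      case (elim n)
      have "{c \<in> {..<n}. y' \<le> incr n c} \<subseteq> e n ` {..<m}" using elim(1) by force
      then have "card {c \<in> {..<n}. y' \<le> incr n c} \<le> card (e n ` {..<m})" by (intro card_mono) auto
      also have "\<dots> \<le> m" using card_image_le[of "{..<m}" "e n"] by simp
      finally show False using elim(2) mi by (simp add: y'_def)
    qed
    then show False by simp
  qed
qed

end

section \<open>Sums over tuples of distinct indices\<close>

definition distinct_lists :: "nat \<Rightarrow> 'a set \<Rightarrow> 'a list set"
  where "distinct_lists k A = {xs. length xs = k \<and> distinct xs \<and> set xs \<subseteq> A}"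

lemma finite_distinct_lists [simp, intro]: "finite A \<Longrightarrow> finite (distinct_lists k A)"
  unfolding distinct_lists_def
  by (rule finite_subset[OF _ finite_lists_length_eq[of A k]]) auto

lemma distinct_lists_1: "bij_betw (\<lambda>i. [i]) (UNIV :: nat set) (distinct_lists 1 UNIV)"
  by (auto simp: bij_betw_def inj_on_def distinct_lists_def length_Suc_conv image_iff)

lemma countable_distinct_lists [simp, intro]: "countable (distinct_lists k (A :: nat set))"
  by (rule countableI_type)

lemma distinct_lists_image:
  assumes "inj_on e A"
  shows "distinct_lists k (e ` A) = map e ` distinct_lists k A" "inj_on (map e) (distinct_lists k A)"
proof -
  show "inj_on (map e) (distinct_lists k A)"
    proof (rule inj_on_mapI)
      show "inj_on e (\<Union> (set ` distinct_lists k A))"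
        by (rule inj_on_subset[OF assms]) (auto simp: distinct_lists_def)
    qed
  show "distinct_lists k (e ` A) = map e ` distinct_lists k A"
  proof (intro equalityI subsetI)
    fix xs assume xs: "xs \<in> distinct_lists k (e ` A)"
    then have "map e (map (inv_into A e) xs) = xs"
      by (auto simp: distinct_lists_def f_inv_into_f subset_iff intro!: map_idI)
    moreover have "map (inv_into A e) xs \<in> distinct_lists k A"
      using xs by (auto simp: distinct_lists_def distinct_map inv_into_into subset_iff
        intro!: inj_on_subset[OF inj_on_inv_into[of "set xs" e A]])
    ultimately show "xs \<in> map e ` distinct_lists k A" by (metis imageI)
  next
    fix xs assume "xs \<in> map e ` distinct_lists k A"
    then show "xs \<in> distinct_lists k (e ` A)"
      using assms by (force simp: distinct_lists_def distinct_map intro: inj_on_subset)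
  qed
qed

context increasing_path
begin

text \<open>Since each \<open>h j\<close> vanishes below \<open>z\<close>, eventually only lists
  through the cells of the finitely many big jumps contribute. What remains is a sum over a fixed
  finite index set, whose terms converge by continuity.\<close>

lemma sum_incr_lists_tendsto:
  assumes z: "0 < y" "y < z"
    and cont: "\<And>j. j < k \<Longrightarrow> continuous_on UNIV (h j)"
    and h0: "\<And>j x. j < k \<Longrightarrow> x < z \<Longrightarrow> h j x = (0::real)"
  shows "(\<lambda>n. \<Sum>cs\<in>distinct_lists k {..<n}. \<Prod>j<k. h j (incr n (cs ! j)))
    \<longlonglongrightarrow> (\<Sum>is\<in>distinct_lists k {i. y \<le> rank i}. \<Prod>j<k. h j (rank (is ! j)))"
proof -
  obtain m e where m: "{i. y \<le> rank i} = {..<m}"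
    "\<forall>\<^sub>F n in sequentially. inj_on (e n) {..<m} \<and> e n ` {..<m} \<subseteq> {..<n}"
    "\<And>i. i < m \<Longrightarrow> (\<lambda>n. incr n (e n i)) \<longlonglongrightarrow> rank i"
    "\<And>y'. y < y' \<Longrightarrow> \<forall>\<^sub>F n in sequentially. \<forall>c<n. c \<notin> e n ` {..<m} \<longrightarrow> incr n c < y'"
    using rank_cells[OF z(1)] by blast
  have "\<forall>\<^sub>F n in sequentially. (\<Sum>is\<in>distinct_lists k {..<m}. \<Prod>j<k. h j (incr n (e n (is ! j))))
    = (\<Sum>cs\<in>distinct_lists k {..<n}. \<Prod>j<k. h j (incr n (cs ! j)))"
    using m(2) m(4)[OF z(2)]
  proof eventually_elim
    case (elim n)
    have inj: "inj_on (e n) {..<m}" and sub: "e n ` {..<m} \<subseteq> {..<n}" using elim by auto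
    have "(\<Sum>cs\<in>distinct_lists k {..<n}. \<Prod>j<k. h j (incr n (cs ! j)))
      = (\<Sum>cs\<in>distinct_lists k (e n ` {..<m}). \<Prod>j<k. h j (incr n (cs ! j)))"
    proof (rule sum.mono_neutral_right)
      show "\<forall>cs\<in>distinct_lists k {..<n} - distinct_lists k (e n ` {..<m}). (\<Prod>j<k. h j (incr n (cs ! j))) = 0"
      proof
        fix cs assume cs: "cs \<in> distinct_lists k {..<n} - distinct_lists k (e n ` {..<m})"
        then obtain c where c: "c \<in> set cs" "c \<notin> e n ` {..<m}" "c < n"
          by (auto simp: distinct_lists_def)
        then obtain j where "j < k" "cs ! j = c" using cs by (auto simp: distinct_lists_def in_set_conv_nth)
        then show "(\<Prod>j<k. h j (incr n (cs ! j))) = 0"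
          using h0[of j "incr n c"] elim c by (intro prod_zero) auto
      qed
      show "distinct_lists k (e n ` {..<m}) \<subseteq> distinct_lists k {..<n}"
        using sub unfolding distinct_lists_def by blast
    qed auto
    also have "\<dots> = (\<Sum>is\<in>distinct_lists k {..<m}. \<Prod>j<k. h j (incr n (map (e n) is ! j)))"
      unfolding distinct_lists_image(1)[OF inj]
      by (subst sum.reindex[OF distinct_lists_image(2)[OF inj]]) simp
    also have "\<dots> = (\<Sum>is\<in>distinct_lists k {..<m}. \<Prod>j<k. h j (incr n (e n (is ! j))))"
      by (intro sum.cong prod.cong) (auto simp: distinct_lists_def)
    finally show ?case by simp
  qed
  moreover have "(\<lambda>n. \<Sum>is\<in>distinct_lists k {..<m}. \<Prod>j<k. h j (incr n (e n (is ! j))))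
      \<longlonglongrightarrow> (\<Sum>is\<in>distinct_lists k {..<m}. \<Prod>j<k. h j (rank (is ! j)))"
  proof (intro tendsto_sum tendsto_prod)
    fix "is" j assume "is \<in> distinct_lists k {..<m}" "j \<in> {..<k}"
    then have "is ! j < m" "j < k" by (auto simp: distinct_lists_def subset_iff)
    then show "(\<lambda>n. h j (incr n (e n (is ! j)))) \<longlonglongrightarrow> h j (rank (is ! j))"
      using continuous_on_tendsto_compose[OF cont m(3)] by auto
  qed
  ultimately show ?thesis unfolding m(1) by (rule Lim_transform_eventually[rotated])
qed

end

section \<open>Laplace transforms\<close>

lemma integral_polynomial_exp:
  fixes P :: "real measure"
  assumes "finite_measure P" and [measurable_cong]: "sets P = sets borel" and "AE x in P. x \<ge> 0"
    and "\<And>x. p x = (\<Sum>i\<le>n. a i * x ^ i)"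
  shows "integrable P (\<lambda>x. p (exp (- x)))"
    and "(\<integral>x. p (exp (- x)) \<partial>P) = (\<Sum>i\<le>n. a i * (\<integral>x. exp (- (real i * x)) \<partial>P))"
proof -
  interpret finite_measure P by fact
  have int: "integrable P (\<lambda>x. exp (- (real i * x)))" for i
    by (rule integrable_const_bound[where B=1]) (use assms(3) in auto)
  have eq: "p (exp (- x)) = (\<Sum>i\<le>n. a i * exp (- (real i * x)))" for x
    by (simp add: assms(4) exp_of_nat_mult[symmetric])
  show "integrable P (\<lambda>x. p (exp (- x)))" unfolding eq by (intro Bochner_Integration.integrable_sum integrable_mult_right int)
  show "(\<integral>x. p (exp (- x)) \<partial>P) = (\<Sum>i\<le>n. a i * (\<integral>x. exp (- (real i * x)) \<partial>P))"
    unfolding eq using int by (subst Bochner_Integration.integral_sum) auto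
qed

lemma integral_exp_approx:
  fixes P :: "real measure"
  assumes P: "finite_measure P" "sets P = sets borel" "AE x in P. x \<ge> 0"
    and g: "continuous_on {0..1} g" and p: "\<And>x. p x = (\<Sum>i\<le>n. a i * x ^ i)"
    and close: "\<And>x. x \<in> {0..1} \<Longrightarrow> \<bar>g x - p x\<bar> \<le> e"
    and meas: "(\<lambda>x. g (exp (- x))) \<in> borel_measurable borel"
  shows "\<bar>(\<integral>x. g (exp (- x)) \<partial>P) - (\<Sum>i\<le>n. a i * (\<integral>x. exp (- (real i * x)) \<partial>P))\<bar> \<le> e * measure P (space P)"
proof -
  interpret finite_measure P by fact
  have [measurable]: "(\<lambda>x. g (exp (- x))) \<in> borel_measurable P"
    using meas measurable_cong_sets[OF P(2) refl] by blast
  obtain B where B: "\<And>x. x \<in> {0..1} \<Longrightarrow> norm (g x) \<le> B"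
    using compact_imp_bounded[OF compact_continuous_image[OF g compact_Icc]] unfolding bounded_iff by blast
  have int: "integrable P (\<lambda>x. g (exp (- x)))"
    by (rule integrable_const_bound[where B=B]) (use P(3) B in auto)
  note pint = integral_polynomial_exp[OF P p]
  have "\<bar>(\<integral>x. g (exp (- x)) \<partial>P) - (\<integral>x. p (exp (- x)) \<partial>P)\<bar> = \<bar>\<integral>x. g (exp (- x)) - p (exp (- x)) \<partial>P\<bar>"
    using int pint(1) by simp
  also have "\<dots> \<le> (\<integral>x. \<bar>g (exp (- x)) - p (exp (- x))\<bar> \<partial>P)" by (rule integral_abs_bound)
  also have "\<dots> \<le> (\<integral>x. e \<partial>P)"
    by (intro integral_mono_AE integrable_abs Bochner_Integration.integrable_diff int pint(1))
      (use P(3) close in auto)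
  also have "\<dots> = e * measure P (space P)" by (simp add: mult.commute)
  finally show ?thesis unfolding pint(2) .
qed

text \<open>Polynomials in \<open>exp (- x)\<close> are dense in the continuous functions of \<open>exp (- x)\<close>.\<close>

lemma tendsto_integral_of_laplace:
  fixes P :: "nat \<Rightarrow> real measure" and Q :: "real measure"
  assumes P: "\<And>n. finite_measure (P n)" "\<And>n. sets (P n) = sets borel" "\<And>n. AE x in P n. x \<ge> 0"
    and Q: "finite_measure Q" "sets Q = sets borel" "AE x in Q. x \<ge> 0"
    and lim: "\<And>i. (\<lambda>n. \<integral>x. exp (- (real i * x)) \<partial>P n) \<longlonglongrightarrow> (\<integral>x. exp (- (real i * x)) \<partial>Q)"
    and g: "continuous_on {0..1} (g :: real \<Rightarrow> real)" and meas: "(\<lambda>x. g (exp (- x))) \<in> borel_measurable borel"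
  shows "(\<lambda>n. \<integral>x. g (exp (- x)) \<partial>P n) \<longlonglongrightarrow> (\<integral>x. g (exp (- x)) \<partial>Q)"
proof (rule LIMSEQ_I)
  fix r :: real assume r: "r > 0"
  have mass: "(\<lambda>n. measure (P n) (space (P n))) \<longlonglongrightarrow> measure Q (space Q)" using lim[of 0] by simp
  \<comment> \<open>Eventually all the masses are below \<open>m\<close>, so replacing
    \<open>g\<close> by a polynomial within \<open>e\<close> costs at most
    \<open>e * m = r / 4\<close> in each integral.\<close>
  define m where "m = measure Q (space Q) + 1"
  have m: "m > 0" by (simp add: m_def add_nonneg_pos)
  define e where "e = r / (4 * m)"
  have e: "e > 0" using r m by (simp add: e_def)
  obtain p where "real_polynomial_function p" and close: "\<And>x. x \<in> {0..1} \<Longrightarrow> \<bar>g x - p x\<bar> < e"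
    using Stone_Weierstrass_real_polynomial_function[OF compact_Icc g e] by auto
  then obtain a n where p: "p = (\<lambda>x. \<Sum>i\<le>n. a i * x ^ i)"
    using real_polynomial_function_iff_sum by auto
  let ?S = "\<lambda>R. \<Sum>i\<le>n. a i * (\<integral>x. exp (- (real i * x)) \<partial>R)"
  have "(\<lambda>k. ?S (P k)) \<longlonglongrightarrow> ?S Q" by (intro tendsto_intros lim)
  then have "\<forall>\<^sub>F k in sequentially. dist (?S (P k)) (?S Q) < r / 4" using r by (intro tendstoD) auto
  moreover have "\<forall>\<^sub>F k in sequentially. measure (P k) (space (P k)) < m"
    using mass by (rule order_tendstoD) (simp add: m_def)
  ultimately have "\<forall>\<^sub>F k in sequentially. norm ((\<integral>x. g (exp (- x)) \<partial>P k) - (\<integral>x. g (exp (- x)) \<partial>Q)) < r"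
  proof eventually_elim
    case (elim k)
    have "\<bar>(\<integral>x. g (exp (- x)) \<partial>P k) - ?S (P k)\<bar> \<le> e * measure (P k) (space (P k))"
      by (rule integral_exp_approx[OF P g _ _ meas, of p]) (use close p in \<open>auto intro: less_imp_le\<close>)
    moreover have "e * measure (P k) (space (P k)) \<le> e * m" using elim e by (intro mult_left_mono) auto
    moreover have "\<bar>(\<integral>x. g (exp (- x)) \<partial>Q) - ?S Q\<bar> \<le> e * measure Q (space Q)"
      by (rule integral_exp_approx[OF Q g _ _ meas, of p]) (use close p in \<open>auto intro: less_imp_le\<close>)
    moreover have "e * measure Q (space Q) \<le> e * m" using e by (intro mult_left_mono) (auto simp: m_def)
    moreover have "e * m = r / 4" using m by (simp add: e_def)
    ultimately show ?case using elim(1) r by (auto simp: dist_real_def)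
  qed
  then show "\<exists>no. \<forall>n\<ge>no. norm ((\<integral>x. g (exp (- x)) \<partial>P n) - (\<integral>x. g (exp (- x)) \<partial>Q)) < r"
    by (simp add: eventually_sequentially)
qed

lemma integral_eq_of_laplace:
  fixes P Q :: "real measure"
  assumes P: "finite_measure P" "sets P = sets borel" "AE x in P. x \<ge> 0"
    and Q: "finite_measure Q" "sets Q = sets borel" "AE x in Q. x \<ge> 0"
    and eq: "\<And>i. (\<integral>x. exp (- (real i * x)) \<partial>P) = (\<integral>x. exp (- (real i * x)) \<partial>Q)"
    and g: "continuous_on {0..1} (g :: real \<Rightarrow> real)" and meas: "(\<lambda>x. g (exp (- x))) \<in> borel_measurable borel"
  shows "(\<integral>x. g (exp (- x)) \<partial>P) = (\<integral>x. g (exp (- x)) \<partial>Q)"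
  using tendsto_integral_of_laplace[of "\<lambda>_. P" Q g, OF P Q _ g meas] eq by (simp add: LIMSEQ_const_iff)

text \<open>Transforms at natural numbers suffice: they are the moments of \<open>exp (- x)\<close>,
  which takes values in the compact interval \<open>{0..1}\<close>. Half-lines then determine a
  finite measure.\<close>

lemma measure_eqI_laplace:
  fixes P Q :: "real measure"
  assumes P: "finite_measure P" "sets P = sets borel" "AE x in P. x \<ge> 0"
    and Q: "finite_measure Q" "sets Q = sets borel" "AE x in Q. x \<ge> 0"
    and eq: "\<And>i. (\<integral>x. exp (- (real i * x)) \<partial>P) = (\<integral>x. exp (- (real i * x)) \<partial>Q)"
  shows "P = Q"
proof -
  interpret P: finite_measure P by fact
  interpret Q: finite_measure Q by fact
  have meas: "measure P {b<..} = measure Q {b<..}" for b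
  proof -
    \<comment> \<open>As a function of \<open>u = exp (- x)\<close>, a ramp that is 0 from
      \<open>exp (- b)\<close> on and steepens with \<open>k\<close>. It converges to the indicator
      of \<open>x > b\<close>, without a jump at any finite stage.\<close>
    define g where "g k u = min 1 (max 0 (real k * (exp (- b) - u)))" for k :: nat and u :: real
    have bd: "\<bar>g k u\<bar> \<le> 1" for k u by (auto simp: g_def)
    have [measurable]: "g k \<in> borel_measurable borel" for k unfolding g_def by simp
    have lim: "(\<lambda>k. g k (exp (- x))) \<longlonglongrightarrow> indicator {b<..} x" for x
    proof (cases "b < x")
      case True
      then have pos: "exp (- b) - exp (- x) > 0" by simp
      obtain K where K: "1 / real (Suc K) < exp (- b) - exp (- x)" using nat_approx_posE[OF pos] by auto
      have "\<forall>\<^sub>F k in sequentially. g k (exp (- x)) = 1"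
        using eventually_ge_at_top[of "Suc K"]
      proof eventually_elim
        case (elim k)
        have "1 < real (Suc K) * (exp (- b) - exp (- x))" using K by (simp add: pos_divide_less_eq mult.commute)
        also have "\<dots> \<le> real k * (exp (- b) - exp (- x))" using elim pos by (intro mult_right_mono) auto
        finally show ?case by (simp add: g_def)
      qed
      then show ?thesis using True by (simp add: tendsto_eventually)
    next
      case False
      then have "g k (exp (- x)) = 0" for k by (auto simp: g_def mult_nonneg_nonpos)
      then show ?thesis using False by simp
    qed
    have conv: "(\<lambda>k. \<integral>x. g k (exp (- x)) \<partial>R) \<longlonglongrightarrow> measure R {b<..}"
      if R: "finite_measure R" "sets R = sets borel" for R
    proof -
      interpret finite_measure R by (rule R)
      note [measurable_cong] = R(2)
      have "(\<lambda>k. \<integral>x. g k (exp (- x)) \<partial>R) \<longlonglongrightarrow> (\<integral>x. indicator {b<..} x \<partial>R)"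
        by (rule integral_dominated_convergence[where w="\<lambda>_. 1"]) (use lim bd in auto)
      moreover have "space R = UNIV" using sets_eq_imp_space_eq[OF R(2)] by simp
      ultimately show ?thesis by simp
    qed
    have same: "(\<integral>x. g k (exp (- x)) \<partial>P) = (\<integral>x. g k (exp (- x)) \<partial>Q)" for k
      by (rule integral_eq_of_laplace[OF P Q eq]) (auto simp: g_def intro!: continuous_intros)
    show ?thesis
      using LIMSEQ_unique[OF conv[OF P(1,2)]] conv[OF Q(1,2)] same by simp
  qed
  have space: "space P = UNIV" "space Q = UNIV"
    using sets_eq_imp_space_eq[OF P(2)] sets_eq_imp_space_eq[OF Q(2)] by auto
  show ?thesis
    by (rule measure_eqI_lessThan)
      (use P Q meas in \<open>auto simp: less_top[symmetric] P.emeasure_eq_measure Q.emeasure_eq_measure\<close>)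
qed

text \<open>Exponentials are exchanged for indicators one coordinate at a time. With all other
  factors frozen into a weight \<open>K\<close>, the law of one coordinate under the weighted
  measure has a known one-dimensional transform, to which \<open>measure_eqI_laplace\<close>
  applies.\<close>

lemma PiM_eqI_laplace:
  fixes \<Lambda> :: "('i \<Rightarrow> real) measure" and m :: "'i \<Rightarrow> real measure"
  assumes I: "finite I"
    and m: "\<And>i. finite_measure (m i)" "\<And>i. sets (m i) = sets borel" "\<And>i. AE x in m i. x \<ge> 0"
    and \<Lambda>: "finite_measure \<Lambda>" "sets \<Lambda> = sets (\<Pi>\<^sub>M i\<in>I. borel)" "\<And>i. i \<in> I \<Longrightarrow> AE x in \<Lambda>. x i \<ge> 0"
    and eq: "\<And>l :: 'i \<Rightarrow> nat. (\<integral>x. (\<Prod>i\<in>I. exp (- (real (l i) * x i))) \<partial>\<Lambda>)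
      = (\<Prod>i\<in>I. \<integral>x. exp (- (real (l i) * x)) \<partial>m i)"
  shows "\<Lambda> = PiM I m"
proof -
  interpret \<Lambda>: finite_measure \<Lambda> by fact
  note [measurable_cong] = \<Lambda>(2) m(2)
  have mixed: "(\<integral>x. (\<Prod>i\<in>J. indicator (B i) (x i)) * (\<Prod>i\<in>I - J. exp (- (real (l i) * x i))) \<partial>\<Lambda>)
      = (\<Prod>i\<in>J. measure (m i) (B i)) * (\<Prod>i\<in>I - J. \<integral>x. exp (- (real (l i) * x)) \<partial>m i)"
    if "J \<subseteq> I" and B: "\<And>i. B i \<in> sets borel" for J and B and l :: "'i \<Rightarrow> nat"
    using finite_subset[OF \<open>J \<subseteq> I\<close> I] that(1)
  proof (induction J arbitrary: l rule: finite_induct)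
    case empty
    then show ?case using eq by simp
  next
    case (insert i J)
    then have iI: "i \<in> I" "J \<subseteq> I" by auto
    note [measurable] = B
    let ?E = "\<lambda>x. \<Prod>j\<in>I - insert i J. exp (- (real (l j) * x j))"
    define K where "K x = (\<Prod>j\<in>J. indicator (B j) (x j)) * ?E x" for x
    define c where "c = (\<Prod>i\<in>J. measure (m i) (B i)) * (\<Prod>j\<in>I - insert i J. \<integral>x. exp (- (real (l j) * x)) \<partial>m j)"
    have c0: "c \<ge> 0" unfolding c_def by (intro mult_nonneg_nonneg prod_nonneg) (auto intro!: Bochner_Integration.integral_nonneg)
    have Ii: "I - J = insert i (I - insert i J)" using insert iI by auto
    have fin: "finite (I - insert i J)" using I by auto
    have Im: "j \<in> I" if "j \<in> J" for j using iI that by auto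
    have [measurable]: "(\<lambda>x. x j) \<in> borel_measurable (\<Pi>\<^sub>M i\<in>I. borel)" if "j \<in> I" for j
      using that by measurable
    have [measurable]: "K \<in> borel_measurable \<Lambda>"
    proof -
      have "K \<in> borel_measurable (\<Pi>\<^sub>M i\<in>I. borel)" unfolding K_def
        by (intro borel_measurable_times borel_measurable_prod borel_measurable_indicator')
         (use Im iI B in \<open>auto intro!: borel_measurable_exp borel_measurable_uminus borel_measurable_times\<close>)
      then show ?thesis by simp
    qed
    have [measurable]: "(\<lambda>x. x i) \<in> borel_measurable \<Lambda>" using iI by simp
    have K0: "K x \<ge> 0" for x unfolding K_def by (intro mult_nonneg_nonneg prod_nonneg) auto
    have K1: "AE x in \<Lambda>. K x \<le> 1"
    proof -
      have "AE x in \<Lambda>. \<forall>i\<in>I. x i \<ge> 0" using \<Lambda>(3) I by (simp add: AE_finite_all)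
      then show ?thesis
      proof eventually_elim
        case (elim x)
        have "(\<Prod>j\<in>J. indicator (B j) (x j)) \<le> (1 :: real)" by (intro prod_le_1) (auto simp: indicator_def)
        moreover have "?E x \<le> 1" by (intro prod_le_1) (use elim in auto)
        moreover have "?E x \<ge> 0" by (intro prod_nonneg) auto
        ultimately show "K x \<le> 1" unfolding K_def
          by (intro mult_le_one) auto
      qed
    qed
    \<comment> \<open>\<open>n\<close> is the law of coordinate \<open>i\<close> under the weight
      \<open>K\<close>, and \<open>n'\<close> is what independence predicts for it, a multiple of
      \<open>m i\<close>. Varying the entry \<open>l i\<close> gives their transforms.\<close>
    define n where "n = distr (density \<Lambda> (\<lambda>x. ennreal (K x))) borel (\<lambda>x. x i)"
    define n' where "n' = density (m i) (\<lambda>_. ennreal c)"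
    have lap: "(\<integral>x. exp (- (real k * x)) \<partial>n) = c * (\<integral>x. exp (- (real k * x)) \<partial>m i)" for k
    proof -
      have "(\<integral>x. exp (- (real k * x)) \<partial>n) = (\<integral>x. K x * exp (- (real k * x i)) \<partial>\<Lambda>)"
        unfolding n_def by (subst integral_distr) (auto simp: integral_density K0)
      also have "\<dots> = (\<integral>x. (\<Prod>i\<in>J. indicator (B i) (x i)) * (\<Prod>j\<in>I - J. exp (- (real ((l(i := k)) j) * x j))) \<partial>\<Lambda>)"
      proof (intro Bochner_Integration.integral_cong refl)
        fix x
        have "(\<Prod>j\<in>I - insert i J. exp (- (real ((l(i := k)) j) * x j))) = ?E x"
          by (intro prod.cong) auto
        then show "K x * exp (- (real k * x i)) = (\<Prod>i\<in>J. indicator (B i) (x i)) * (\<Prod>j\<in>I - J. exp (- (real ((l(i := k)) j) * x j)))"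
          unfolding Ii K_def by (subst prod.insert[OF fin]) (auto simp: mult_ac)
      qed
      also have "\<dots> = (\<Prod>i\<in>J. measure (m i) (B i)) * (\<Prod>j\<in>I - J. \<integral>x. exp (- (real ((l(i := k)) j) * x)) \<partial>m j)"
        by (rule insert.IH[OF iI(2)])
      also have "\<dots> = c * (\<integral>x. exp (- (real k * x)) \<partial>m i)"
      proof -
        have "(\<Prod>j\<in>I - insert i J. \<integral>x. exp (- (real ((l(i := k)) j) * x)) \<partial>m j) = (\<Prod>j\<in>I - insert i J. \<integral>x. exp (- (real (l j) * x)) \<partial>m j)"
          by (intro prod.cong) auto
        then show ?thesis unfolding Ii c_def by (subst prod.insert[OF fin]) (auto simp: mult_ac)
      qed
      finally show ?thesis .
    qed
    have finK: "finite_measure (density \<Lambda> (\<lambda>x. ennreal (K x)))"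
    proof
      have "(\<integral>\<^sup>+x. ennreal (K x) \<partial>\<Lambda>) \<le> (\<integral>\<^sup>+x. 1 \<partial>\<Lambda>)"
        by (intro nn_integral_mono_AE) (use K1 in auto)
      then show "emeasure (density \<Lambda> (\<lambda>x. ennreal (K x))) (space (density \<Lambda> (\<lambda>x. ennreal (K x)))) \<noteq> \<infinity>"
        by (auto simp: emeasure_density cong: nn_integral_cong simp: \<Lambda>.emeasure_eq_measure top_unique nn_integral_indicator')
    qed
    have nn: "n = n'"
    proof (rule measure_eqI_laplace)
      show "finite_measure n" unfolding n_def by (intro finite_measure.finite_measure_distr finK) simp
      show "AE x in n. x \<ge> 0" unfolding n_def
        using \<Lambda>(3)[OF iI(1)] by (subst AE_distr_iff) (auto simp: AE_density)
      show "finite_measure n'" unfolding n'_def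
      proof
        interpret mi: finite_measure "m i" by (rule m)
        show "emeasure (density (m i) (\<lambda>_. ennreal c)) (space (density (m i) (\<lambda>_. ennreal c))) \<noteq> \<infinity>"
          by (simp add: emeasure_density_const mi.emeasure_eq_measure ennreal_mult_eq_top_iff)
      qed
      show "AE x in n'. x \<ge> 0" unfolding n'_def using m(3)[of i] by (auto simp: AE_density)
      show "(\<integral>x. exp (- (real k * x)) \<partial>n) = (\<integral>x. exp (- (real k * x)) \<partial>n')" for k
      proof -
        have "(\<lambda>x. exp (- (real k * x))) \<in> borel_measurable (m i)"
          unfolding measurable_cong_sets[OF m(2) refl] by measurable
        then show ?thesis unfolding lap n'_def using c0 by (subst integral_density) auto
      qed
    qed (auto simp: n_def n'_def m(2))
    have "(\<integral>x. (\<Prod>i\<in>insert i J. indicator (B i) (x i)) * ?E x \<partial>\<Lambda>) = (\<integral>x. K x * indicator (B i) (x i) \<partial>\<Lambda>)"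
      using insert.hyps by (intro Bochner_Integration.integral_cong) (auto simp: K_def mult_ac)
    also have "\<dots> = (\<integral>x. indicator (B i) x \<partial>n)"
      unfolding n_def by (subst integral_distr) (auto simp: integral_density K0)
    also have "\<dots> = (\<integral>x. indicator (B i) x \<partial>n')" unfolding nn ..
    also have "\<dots> = (\<integral>x. c * indicator (B i) x \<partial>m i)"
    proof -
      have "indicat_real (B i) \<in> borel_measurable (m i)"
        unfolding measurable_cong_sets[OF m(2) refl] by measurable
      then show ?thesis unfolding n'_def using c0 by (subst integral_density) auto
    qed
    also have "\<dots> = c * measure (m i) (B i)" using sets_eq_imp_space_eq[OF m(2)[of i]] by simp
    finally show ?case using insert.hyps by (simp add: c_def mult_ac)
  qed
  interpret product_sigma_finite m
    unfolding product_sigma_finite_def using m(1) by (auto simp: finite_measure_def)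
  show ?thesis
  proof (rule PiM_eqI[OF I])
    show "sets \<Lambda> = sets (PiM I m)" using \<Lambda>(2) by (simp cong: sets_PiM_cong add: m(2))
    fix A assume A: "\<And>i. i \<in> I \<Longrightarrow> A i \<in> sets (m i)"
    define B where "B i = (if i \<in> I then A i else {})" for i
    have B: "B i \<in> sets borel" for i using A m(2) by (auto simp: B_def)
    have "measure \<Lambda> (Pi\<^sub>E I A) = (\<integral>x. indicator (Pi\<^sub>E I A) x \<partial>\<Lambda>)"
      using sets.sets_into_space[of "Pi\<^sub>E I A" \<Lambda>] sets_PiM_I_finite[OF I, of A "\<lambda>_. borel"] A m(2) \<Lambda>(2) by (simp add: Int_absorb2)
    also have "\<dots> = (\<integral>x. (\<Prod>i\<in>I. indicator (B i) (x i)) \<partial>\<Lambda>)"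
    proof (intro Bochner_Integration.integral_cong refl)
      fix x assume "x \<in> space \<Lambda>"
      then have "x \<in> extensional I" using sets_eq_imp_space_eq[OF \<Lambda>(2)] by (auto simp: space_PiM PiE_def)
      then show "indicator (Pi\<^sub>E I A) x = (\<Prod>i\<in>I. indicator (B i) (x i) :: real)"
        using I by (auto simp: indicator_def PiE_def B_def Pi_iff prod_zero_iff)
    qed
    also have "\<dots> = (\<Prod>i\<in>I. measure (m i) (B i))" using mixed[of I B] B by simp
    finally have "measure \<Lambda> (Pi\<^sub>E I A) = (\<Prod>i\<in>I. measure (m i) (A i))" by (simp add: B_def)
    then show "emeasure \<Lambda> (Pi\<^sub>E I A) = (\<Prod>i\<in>I. emeasure (m i) (A i))"
      by (simp add: \<Lambda>.emeasure_eq_measure finite_measure.emeasure_eq_measure[OF m(1)] prod_ennreal)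
  qed
qed

section \<open>The stable Levy measure\<close>

lemma nn_integral_Gamma:
  assumes p: "p > 0" and t: "t > 0"
  shows "(\<integral>\<^sup>+x. ennreal (indicator {0<..} x * x powr (p - 1) * exp (- (t * x))) \<partial>lborel)
    = ennreal (Gamma p * t powr (- p))"
proof -
  have "ennreal (Gamma p) = (\<integral>\<^sup>+x. ennreal (indicator {0..} x * x powr (p - 1) / exp x) \<partial>lborel)"
    using Gamma_conv_nn_integral_real[OF p] .
  also have "\<dots> = (\<integral>\<^sup>+x. ennreal (indicator {0<..} x * x powr (p - 1) * exp (- x)) \<partial>lborel)"
    by (intro nn_integral_cong) (auto simp: indicator_def exp_minus divide_inverse)
  also have "\<dots> = ennreal \<bar>t\<bar> * (\<integral>\<^sup>+x. ennreal (indicator {0<..} (0 + t * x) * (0 + t * x) powr (p - 1) * exp (- (0 + t * x))) \<partial>lborel)"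
    using t by (intro nn_integral_real_affine) auto
  also have "\<dots> = (\<integral>\<^sup>+x. ennreal (t powr p) * ennreal (indicator {0<..} x * x powr (p - 1) * exp (- (t * x))) \<partial>lborel)"
    using t by (subst nn_integral_cmult[symmetric], simp, intro nn_integral_cong)
      (auto simp: ennreal_mult'[symmetric] indicator_def zero_less_mult_iff powr_mult powr_diff)
  also have "\<dots> = ennreal (t powr p) * (\<integral>\<^sup>+x. ennreal (indicator {0<..} x * x powr (p - 1) * exp (- (t * x))) \<partial>lborel)"
    by (rule nn_integral_cmult) simp
  finally have "ennreal (t powr (- p)) * ennreal (Gamma p) = ennreal (t powr (- p)) * (ennreal (t powr p)
      * (\<integral>\<^sup>+x. ennreal (indicator {0<..} x * x powr (p - 1) * exp (- (t * x))) \<partial>lborel))" by simp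
  moreover have "ennreal (t powr (- p)) * ennreal (t powr p) = 1"
    using t by (simp add: ennreal_mult'[symmetric] powr_add[symmetric] del: ennreal_mult')
  ultimately have "ennreal (t powr (- p)) * ennreal (Gamma p)
      = (\<integral>\<^sup>+x. ennreal (indicator {0<..} x * x powr (p - 1) * exp (- (t * x))) \<partial>lborel)"
    by (simp only: mult.assoc[symmetric] mult_1)
  then show ?thesis using p by (simp add: ennreal_mult'[symmetric] mult.commute Gamma_real_pos)
qed

locale stable_index =
  fixes \<alpha> :: real
  assumes index: "0 < \<alpha>" "\<alpha> < 1"
begin

text \<open>The constant is chosen so that the Laplace exponent in \<open>levy_laplace\<close> is
  exactly \<open>s powr \<alpha>\<close>.\<close>

definition levy_density :: "real \<Rightarrow> real"
  where "levy_density x = indicator {0<..} x * (\<alpha> / Gamma (1 - \<alpha>)) * x powr (- 1 - \<alpha>)"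

definition levy :: "real measure"
  where "levy = density lborel (\<lambda>x. ennreal (levy_density x))"

lemma levy_density_measurable [measurable]: "levy_density \<in> borel_measurable borel"
  unfolding levy_density_def by measurable

lemma Gamma_pos: "Gamma (1 - \<alpha>) > 0" using index by (simp add: Gamma_real_pos)

lemma levy_density_nonneg: "levy_density x \<ge> 0"
  unfolding levy_density_def using index Gamma_pos by simp

lemma sets_levy [simp, measurable_cong]: "sets levy = sets borel"
  by (simp add: levy_def)

lemma measurable_levy [simp]: "measurable levy N = measurable borel N"
  by (rule measurable_cong_sets) auto

lemma space_levy [simp]: "space levy = UNIV"
  by (simp add: levy_def)

lemma nn_integral_levy:
  assumes [measurable]: "F \<in> borel_measurable borel"
  shows "(\<integral>\<^sup>+x. F x \<partial>levy) = (\<integral>\<^sup>+x. ennreal (levy_density x) * F x \<partial>lborel)"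
  unfolding levy_def by (rule nn_integral_density) auto

lemma AE_levy: "AE x in levy. x > 0"
  unfolding levy_def by (subst AE_density) (auto simp: levy_density_def indicator_def)

lemma sigma_finite_levy: "sigma_finite_measure levy"
  unfolding levy_def by (subst sigma_finite_measure.sigma_finite_iff_density_finite'[OF sigma_finite_lborel]) auto

lemma levy_scale:
  assumes r: "r > 0" and [measurable]: "F \<in> borel_measurable borel"
  shows "(\<integral>\<^sup>+x. F x \<partial>levy) = ennreal (r powr (- \<alpha>)) * (\<integral>\<^sup>+x. F (r * x) \<partial>levy)"
proof -
  have dens: "r * levy_density (r * x) = r powr (- \<alpha>) * levy_density x" for x
  proof (cases "x > 0")
    case True
    then have "r * (r powr (- 1 - \<alpha>)) = r powr (- \<alpha>)"
      using r powr_mult_base[of r "- 1 - \<alpha>"] by simp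
    then show ?thesis using True r
      by (simp add: levy_density_def powr_mult mult.commute mult.left_commute)
  next
    case False
    then show ?thesis using r by (simp add: levy_density_def indicator_def zero_less_mult_iff)
  qed
  have "(\<integral>\<^sup>+x. F x \<partial>levy) = (\<integral>\<^sup>+x. ennreal (levy_density x) * F x \<partial>lborel)"
    by (rule nn_integral_levy) simp
  also have "\<dots> = ennreal \<bar>r\<bar> * (\<integral>\<^sup>+x. ennreal (levy_density (0 + r * x)) * F (0 + r * x) \<partial>lborel)"
    using r by (intro nn_integral_real_affine) auto
  also have "\<dots> = (\<integral>\<^sup>+x. ennreal (r * levy_density (r * x)) * F (r * x) \<partial>lborel)"
    using r by (subst nn_integral_cmult[symmetric]) (auto simp: ennreal_mult' mult.assoc)
  also have "\<dots> = (\<integral>\<^sup>+x. ennreal (r powr (- \<alpha>)) * (ennreal (levy_density x) * F (r * x)) \<partial>lborel)"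
    unfolding dens using levy_density_nonneg by (simp add: ennreal_mult' mult.assoc)
  also have "\<dots> = ennreal (r powr (- \<alpha>)) * (\<integral>\<^sup>+x. F (r * x) \<partial>levy)"
    by (subst nn_integral_cmult) (auto simp: nn_integral_levy)
  finally show ?thesis .
qed

lemma levy_powr_exp:
  assumes p: "p > \<alpha>" and s: "s > 0"
  shows "(\<integral>\<^sup>+x. ennreal (x powr p * exp (- (s * x))) \<partial>levy)
    = ennreal (\<alpha> * Gamma (p - \<alpha>) / Gamma (1 - \<alpha>) * s powr (\<alpha> - p))"
proof -
  have "(\<integral>\<^sup>+x. ennreal (x powr p * exp (- (s * x))) \<partial>levy) =
    (\<integral>\<^sup>+x. ennreal (\<alpha> / Gamma (1 - \<alpha>)) * ennreal (indicator {0<..} x * x powr (p - \<alpha> - 1) * exp (- (s * x))) \<partial>lborel)"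
    by (subst nn_integral_levy, simp, intro nn_integral_cong)
      (use index Gamma_pos in \<open>auto simp: levy_density_def indicator_def ennreal_mult'[symmetric] powr_add[symmetric] algebra_simps\<close>)
  also have "\<dots> = ennreal (\<alpha> / Gamma (1 - \<alpha>)) * ennreal (Gamma (p - \<alpha>) * s powr (- (p - \<alpha>)))"
    by (subst nn_integral_cmult) (use nn_integral_Gamma[of "p - \<alpha>" s] p s in auto)
  finally show ?thesis using index Gamma_pos by (simp add: ennreal_mult'[symmetric] mult.assoc)
qed

lemma levy_exp1:
  assumes "s > 0"
  shows "(\<integral>\<^sup>+x. ennreal (x * exp (- (s * x))) \<partial>levy) = ennreal (\<alpha> * s powr (\<alpha> - 1))"
proof -
  have "(\<integral>\<^sup>+x. ennreal (x * exp (- (s * x))) \<partial>levy) = (\<integral>\<^sup>+x. ennreal (x powr 1 * exp (- (s * x))) \<partial>levy)"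
    by (intro nn_integral_cong_AE) (use AE_levy in \<open>auto elim!: eventually_mono\<close>)
  then show ?thesis using levy_powr_exp[of 1 s] assms index Gamma_pos by simp
qed

lemma levy_exp2:
  assumes "s > 0"
  shows "(\<integral>\<^sup>+x. ennreal (x\<^sup>2 * exp (- (s * x))) \<partial>levy) = ennreal (\<alpha> * (1 - \<alpha>) * s powr (\<alpha> - 2))"
proof -
  have "(\<integral>\<^sup>+x. ennreal (x\<^sup>2 * exp (- (s * x))) \<partial>levy) = (\<integral>\<^sup>+x. ennreal (x powr 2 * exp (- (s * x))) \<partial>levy)"
    by (intro nn_integral_cong_AE) (use AE_levy in \<open>auto elim!: eventually_mono\<close>)
  moreover have "Gamma (2 - \<alpha>) = (1 - \<alpha>) * Gamma (1 - \<alpha>)"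
    using Gamma_plus1[of "1 - \<alpha>"] index nonpos_Ints_nonpos[of "1 - \<alpha>"] by (auto simp: add.commute)
  ultimately show ?thesis using levy_powr_exp[of 2 s] assms index Gamma_pos by simp
qed

text \<open>Write \<open>1 - exp (- (s * x))\<close> as the integral of
  \<open>x * exp (- (u * x))\<close> over \<open>u\<close> from 0 to \<open>s\<close>. After
  exchanging the integrals the inner one is a Gamma integral,
  \<open>\<alpha> * u powr (\<alpha> - 1)\<close>, and no integration by parts against the singular
  density is required.\<close>

lemma levy_laplace:
  assumes s: "s \<ge> 0"
  shows "(\<integral>\<^sup>+x. ennreal (1 - exp (- (s * x))) \<partial>levy) = ennreal (s powr \<alpha>)"
proof -
  interpret levy: sigma_finite_measure levy by (rule sigma_finite_levy)
  interpret pair_sigma_finite levy lborel ..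
  have inner: "(\<integral>\<^sup>+u. ennreal (x * exp (- (u * x))) * indicator {0..s} u \<partial>lborel) = ennreal (1 - exp (- (s * x)))"
    if "x > 0" for x
  proof -
    have "((\<lambda>u. x * exp (- (u * x))) has_integral (- exp (- (s * x)) - (- exp (- (0 * x))))) {0..s}"
      using s by (intro fundamental_theorem_of_calculus)
        (auto intro!: derivative_eq_intros simp flip: has_real_derivative_iff_has_vector_derivative)
    then show ?thesis using that by (subst nn_integral_has_integral_lebesgue') auto
  qed
  have "(\<integral>\<^sup>+x. ennreal (1 - exp (- (s * x))) \<partial>levy)
    = (\<integral>\<^sup>+x. \<integral>\<^sup>+u. ennreal (x * exp (- (u * x))) * indicator {0..s} u \<partial>lborel \<partial>levy)"
    by (intro nn_integral_cong_AE) (use AE_levy inner in \<open>auto elim!: eventually_mono\<close>)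
  also have "\<dots> = (\<integral>\<^sup>+u. \<integral>\<^sup>+x. ennreal (x * exp (- (u * x))) * indicator {0..s} u \<partial>levy \<partial>lborel)"
    by (rule Fubini'[symmetric]) measurable
  also have "\<dots> = (\<integral>\<^sup>+u. ennreal (\<alpha> * u powr (\<alpha> - 1)) * indicator {0..s} u \<partial>lborel)"
  proof (intro nn_integral_cong_AE)
    have "AE u in lborel. u \<noteq> (0 :: real)" by (rule AE_lborel_singleton)
    then show "AE u in lborel. (\<integral>\<^sup>+x. ennreal (x * exp (- (u * x))) * indicator {0..s} u \<partial>levy)
      = ennreal (\<alpha> * u powr (\<alpha> - 1)) * indicator {0..s} u"
    proof eventually_elim
      case (elim u)
      then show ?case
        by (cases "u > 0") (auto simp: nn_integral_multc levy_exp1 indicator_def)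
    qed
  qed
  also have "\<dots> = ennreal (s powr \<alpha>)"
  proof -
    have "((\<lambda>u. \<alpha> * u powr (\<alpha> - 1)) has_integral \<alpha> * (s powr (\<alpha> - 1 + 1) / (\<alpha> - 1 + 1))) {0..s}"
      using has_integral_mult_right[OF has_integral_powr_from_0[of "\<alpha> - 1" s], of \<alpha>] index s by simp
    then show ?thesis using index by (subst nn_integral_has_integral_lebesgue') auto
  qed
  finally show ?thesis .
qed

lemma levy_exp_diff:
  assumes "0 \<le> s" "s \<le> t"
  shows "(\<integral>\<^sup>+x. ennreal (exp (- (s * x)) - exp (- (t * x))) \<partial>levy) = ennreal (t powr \<alpha> - s powr \<alpha>)"
proof -
  have "(\<integral>\<^sup>+x. ennreal (exp (- (s * x)) - exp (- (t * x))) \<partial>levy) + (\<integral>\<^sup>+x. ennreal (1 - exp (- (s * x))) \<partial>levy)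
     = (\<integral>\<^sup>+x. ennreal (1 - exp (- (t * x))) \<partial>levy)"
    by (subst nn_integral_add[symmetric], simp, simp, intro nn_integral_cong_AE)
      (use AE_levy assms in \<open>auto elim!: eventually_mono simp: ennreal_plus[symmetric] mult_right_mono simp del: ennreal_plus\<close>)
  then have "(\<integral>\<^sup>+x. ennreal (exp (- (s * x)) - exp (- (t * x))) \<partial>levy) + ennreal (s powr \<alpha>) = ennreal (t powr \<alpha>)"
    using levy_laplace assms by simp
  also have "\<dots> = ennreal (t powr \<alpha> - s powr \<alpha>) + ennreal (s powr \<alpha>)"
    using assms index by (subst ennreal_plus[symmetric]) (auto intro: powr_mono2)
  finally show ?thesis by simp
qed

text \<open>With the Levy density the integrand is of order \<open>x powr (- \<alpha>)\<close> at 0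
  and \<open>x powr (g - 2)\<close> at infinity, integrable because \<alpha> < 1 and
  \<open>g < 1\<close>. This is the factor of the dislocation integral that depends on the sampled
  jump.\<close>

lemma levy_tail_finite:
  assumes g: "g < \<alpha>"
  shows "(\<integral>\<^sup>+x. ennreal (x * (1 + x) powr (\<alpha> + g - 2)) \<partial>levy) < \<infinity>"
proof -
  let ?c = "\<alpha> / Gamma (1 - \<alpha>)"
  have "(\<integral>\<^sup>+x. ennreal (x * (1 + x) powr (\<alpha> + g - 2)) \<partial>levy)
    \<le> (\<integral>\<^sup>+x. ennreal ?c * (ennreal (x powr (- \<alpha>)) * indicator {0..1} x + ennreal (x powr (g - 2)) * indicator {1..} x) \<partial>lborel)"
  proof (subst nn_integral_levy, simp, intro nn_integral_mono)
    fix x :: real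
    have "ennreal (levy_density x) * ennreal (x * (1 + x) powr (\<alpha> + g - 2))
      = ennreal ?c * ennreal (indicator {0<..} x * x powr (- \<alpha>) * (1 + x) powr (\<alpha> + g - 2))"
    proof -
      have "x * x powr (- 1 - \<alpha>) = x powr (- \<alpha>)" if "x > 0"
        using powr_mult_base[of x "- 1 - \<alpha>"] that by simp
      then have "levy_density x * (x * (1 + x) powr (\<alpha> + g - 2))
        = ?c * (indicator {0<..} x * x powr (- \<alpha>) * (1 + x) powr (\<alpha> + g - 2))"
        unfolding levy_density_def by (auto simp: indicator_def mult.assoc mult.left_commute)
      then show ?thesis using index Gamma_pos levy_density_nonneg by (simp add: ennreal_mult'[symmetric])
    qed
    also have "\<dots> \<le> ennreal ?c * (ennreal (x powr (- \<alpha>)) * indicator {0..1} x + ennreal (x powr (g - 2)) * indicator {1..} x)"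
    proof (intro mult_left_mono)
      consider "x \<le> 0" | "0 < x" "x < 1" | "x \<ge> 1" by linarith
      then show "ennreal (indicator {0<..} x * x powr (- \<alpha>) * (1 + x) powr (\<alpha> + g - 2))
        \<le> ennreal (x powr (- \<alpha>)) * indicator {0..1} x + ennreal (x powr (g - 2)) * indicator {1..} x"
      proof cases
        case 2
        have "(1 + x) powr (\<alpha> + g - 2) \<le> 1 powr (\<alpha> + g - 2)"
          using 2 g index by (intro powr_mono2') auto
        then show ?thesis using 2 by (auto intro!: ennreal_leI mult_left_le)
      next
        case 3
        have "(1 + x) powr (\<alpha> + g - 2) \<le> x powr (\<alpha> + g - 2)"
          using 3 g index by (intro powr_mono2') auto
        then have "x powr (- \<alpha>) * (1 + x) powr (\<alpha> + g - 2) \<le> x powr (- \<alpha>) * x powr (\<alpha> + g - 2)"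
          by (intro mult_left_mono) auto
        also have "\<dots> = x powr (g - 2)" using 3 by (simp add: powr_add[symmetric])
        finally have "ennreal (indicator {0<..} x * x powr (- \<alpha>) * (1 + x) powr (\<alpha> + g - 2))
            \<le> ennreal (x powr (g - 2)) * indicator {1..} x"
          using 3 by (auto intro!: ennreal_leI)
        also have "\<dots> \<le> ennreal (x powr (- \<alpha>)) * indicator {0..1} x + \<dots>" by simp
        finally show ?thesis .
      qed auto
    qed simp
    finally show "ennreal (levy_density x) * ennreal (x * (1 + x) powr (\<alpha> + g - 2)) \<le> \<dots>" .
  qed
  also have "\<dots> = ennreal ?c * ((\<integral>\<^sup>+x. ennreal (x powr (- \<alpha>)) * indicator {0..1} x \<partial>lborel) + (\<integral>\<^sup>+x. ennreal (x powr (g - 2)) * indicator {1..} x \<partial>lborel))"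
    by (subst nn_integral_cmult, simp, subst nn_integral_add) auto
  also have "(\<integral>\<^sup>+x. ennreal (x powr (- \<alpha>)) * indicator {0..1} x \<partial>lborel) = ennreal (1 powr (- \<alpha> + 1) / (- \<alpha> + 1))"
    using index by (intro nn_integral_has_integral_lebesgue' has_integral_powr_from_0) auto
  also have "(\<integral>\<^sup>+x. ennreal (x powr (g - 2)) * indicator {1..} x \<partial>lborel) = ennreal (- (1 powr (g - 2 + 1)) / (g - 2 + 1))"
    using index g by (intro nn_integral_has_integral_lebesgue' has_integral_powr_to_inf) auto
  finally show ?thesis by (simp add: ennreal_mult_less_top le_less_trans)
qed

end

section \<open>Increments of a stable subordinator\<close>

locale stable_jumps = stable_subordinator M \<sigma> \<alpha> + stable_index \<alpha>
  for M :: "'a measure" and \<sigma> \<alpha>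
begin

abbreviation sample :: "'a \<Rightarrow> real \<Rightarrow> real" where "sample \<omega> \<equiv> (\<lambda>t. \<sigma> t \<omega>)"
abbreviation X :: "nat \<Rightarrow> nat \<Rightarrow> 'a \<Rightarrow> real" where "X n c \<omega> \<equiv> increment (sample \<omega>) n c"
abbreviation Z :: "nat \<Rightarrow> 'a \<Rightarrow> real" where "Z i \<omega> \<equiv> jump_rank (sample \<omega>) i"
abbreviation T :: "'a \<Rightarrow> real" where "T \<equiv> \<sigma> 1"

lemma path: "\<omega> \<in> space M \<Longrightarrow> increasing_path (sample \<omega>)"
  using nondecreasing right_continuous start by unfold_locales auto

lemma T_measurable [measurable]: "T \<in> borel_measurable M"
  by (rule measurable) simp

lemma X_measurable [measurable]: "X n c \<in> borel_measurable M"
  unfolding increment_def by (intro borel_measurable_diff measurable) auto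

lemma X_nonneg: "\<omega> \<in> space M \<Longrightarrow> 0 \<le> X n c \<omega>"
  by (rule increasing_path.incr_nonneg[OF path])

lemma sum_X: "\<omega> \<in> space M \<Longrightarrow> n > 0 \<Longrightarrow> (\<Sum>c<n. X n c \<omega>) = T \<omega>"
  by (rule increasing_path.sum_incr[OF path])

lemma T_nonneg: "\<omega> \<in> space M \<Longrightarrow> 0 \<le> T \<omega>"
  using increasing_path.le[OF path, of \<omega> 0 1] start by simp

lemma X_indep: "n > 0 \<Longrightarrow> indep_vars (\<lambda>_. borel) (X n) {..<n}"
  using independent_increments[of "\<lambda>i. real i / real n" n]
  by (auto simp: increment_def[abs_def] mono_def divide_right_mono)

lemma X_distr: "n > 0 \<Longrightarrow> distr M borel (X n c) = distr M borel (\<sigma> (1 / real n))"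
  using stationary_increments[of "real c / real n" "1 / real n"]
  by (simp add: increment_def[abs_def] add_divide_distrib add.commute)

lemma small_measurable [measurable]: "\<sigma> (1 / real n) \<in> borel_measurable M"
  by (rule measurable) simp

lemma expectation_X:
  fixes h :: "real \<Rightarrow> real"
  assumes "n > 0" and [measurable]: "h \<in> borel_measurable borel"
  shows "expectation (\<lambda>\<omega>. h (X n c \<omega>)) = expectation (\<lambda>\<omega>. h (\<sigma> (1 / real n) \<omega>))"
proof -
  have "expectation (\<lambda>\<omega>. h (X n c \<omega>)) = integral\<^sup>L (distr M borel (X n c)) h"
    by (rule integral_distr[symmetric]) auto
  also have "\<dots> = expectation (\<lambda>\<omega>. h (\<sigma> (1 / real n) \<omega>))"
    unfolding X_distr[OF assms(1)] by (rule integral_distr) auto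
  finally show ?thesis .
qed

lemma expectation_prod_X:
  fixes g :: "nat \<Rightarrow> real \<Rightarrow> real"
  assumes n: "n > 0" and g: "\<And>c. g c \<in> borel_measurable borel"
    and bd: "\<And>c x. 0 \<le> x \<Longrightarrow> \<bar>g c x\<bar> \<le> B c"
  shows "expectation (\<lambda>\<omega>. \<Prod>c<n. g c (X n c \<omega>)) = (\<Prod>c<n. expectation (\<lambda>\<omega>. g c (\<sigma> (1 / real n) \<omega>)))"
proof -
  have "indep_vars (\<lambda>_. borel) (\<lambda>c \<omega>. g c (X n c \<omega>)) {..<n}"
    using indep_vars_compose2[OF X_indep[OF n], of g "\<lambda>_. borel"] g by auto
  then have "expectation (\<lambda>\<omega>. \<Prod>c<n. g c (X n c \<omega>)) = (\<Prod>c<n. expectation (\<lambda>\<omega>. g c (X n c \<omega>)))"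
  proof (intro indep_vars_lebesgue_integral)
    fix c
    have [measurable]: "g c \<in> borel_measurable borel" by (rule g)
    show "integrable M (\<lambda>\<omega>. g c (X n c \<omega>))"
      by (rule integrable_const_bound[where B="B c"]) (use bd X_nonneg in auto)
  qed auto
  also have "\<dots> = (\<Prod>c<n. expectation (\<lambda>\<omega>. g c (\<sigma> (1 / real n) \<omega>)))"
    using n g by (intro prod.cong expectation_X) auto
  finally show ?thesis .
qed

lemma small_nonneg: "\<omega> \<in> space M \<Longrightarrow> 0 \<le> \<sigma> (1 / real n) \<omega>"
  using increasing_path.le[OF path, of \<omega> 0 "1 / real n"] start by simp

text \<open>\<open>T\<close> is a sum of \<open>n\<close> independent copies of the small increment,
  so the \<open>n\<close>-th powers of both sides agree; nonnegativity allows the root.\<close>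

lemma laplace_small:
  assumes n: "n > 0" and l: "l \<ge> 0"
  shows "expectation (\<lambda>\<omega>. exp (- l * \<sigma> (1 / real n) \<omega>)) = exp (- (l powr \<alpha>) / real n)"
proof -
  let ?a = "expectation (\<lambda>\<omega>. exp (- l * \<sigma> (1 / real n) \<omega>))"
  have "?a ^ n = (\<Prod>c<n. ?a)" by simp
  also have "\<dots> = expectation (\<lambda>\<omega>. \<Prod>c<n. exp (- l * X n c \<omega>))"
    using l by (intro expectation_prod_X[symmetric, where B="\<lambda>_. 1", OF n]) auto
  also have "\<dots> = expectation (\<lambda>\<omega>. exp (- l * T \<omega>))"
    using n by (intro Bochner_Integration.integral_cong) (auto simp: exp_sum[symmetric] sum_distrib_left[symmetric] sum_X sum_negf)
  also have "\<dots> = exp (- (l powr \<alpha>))" by (rule laplace[OF l])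
  also have "\<dots> = exp (- (l powr \<alpha>) / real n) ^ n" using n by (simp add: exp_of_nat_mult[symmetric])
  finally have eq: "?a ^ n = exp (- (l powr \<alpha>) / real n) ^ n" .
  have "?a \<ge> 0" by (intro Bochner_Integration.integral_nonneg) auto
  then show ?thesis using eq n by (simp add: power_eq_iff_eq_base)
qed

text \<open>The rescaled laws of the small increments converge vaguely to the Levy measure; the factor
  \<open>1 - exp (- x)\<close> makes both sides finite and turns their Laplace transforms into differences of
  the transforms of the increments.\<close>

lemma vague_convergence:
  assumes a: "0 < a" and h: "continuous_on UNIV h"
    and supp: "\<And>x. x < a \<Longrightarrow> h x = 0" "\<And>x. x > b \<Longrightarrow> h x = (0::real)"
  shows "(\<lambda>n. real n * expectation (\<lambda>\<omega>. h (\<sigma> (1 / real n) \<omega>))) \<longlonglongrightarrow> (\<integral>x. h x \<partial>levy)"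
proof -
  have [measurable]: "h \<in> borel_measurable borel" using h by (rule borel_measurable_continuous_onI)
  \<comment> \<open>The absolute value only keeps the density nonnegative on the whole line. Both
    laws live on the nonnegative half-line.\<close>
  define P where "P n = density (distr M borel (\<sigma> (1 / real n))) (\<lambda>x. ennreal (real n * (1 - exp (- \<bar>x\<bar>))))" for n
  define Q where "Q = density levy (\<lambda>x. ennreal (1 - exp (- \<bar>x\<bar>)))"
  \<comment> \<open>\<open>g (exp (- x))\<close> is to be \<open>h x / (1 - exp (- x))\<close>. The
    maximum with \<open>exp (- b')\<close> keeps the logarithm defined at \<open>u = 0\<close>, and
    the minimum with \<open>exp (- (a / 2))\<close> keeps the denominator away from 0. Both clamps
    act only where \<open>h\<close> vanishes, \<open>b'\<close> being beyond \<open>b\<close>, and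
    they make \<open>g\<close> continuous on \<open>{0..1}\<close>.\<close>
  define b' where "b' = max b a + 1"
  define g where "g u = h (- ln (max u (exp (- b')))) / (1 - min u (exp (- (a / 2))))" for u
  have gc: "continuous_on S g" for S
  proof -
    have "1 - min u (exp (- (a / 2))) \<noteq> 0" for u using a by (auto simp: min_def)
    moreover have "0 < max u (exp (- b'))" for u
      by (rule less_le_trans[OF exp_gt_zero max.cobounded2])
    ultimately show ?thesis unfolding g_def
      by (intro continuous_intros continuous_on_compose2[OF h]) (auto simp: max_def split: if_splits)
  qed
  have [measurable]: "g \<in> borel_measurable borel" by (rule borel_measurable_continuous_onI[OF gc])
  have gh: "g (exp (- x)) * (1 - exp (- \<bar>x\<bar>)) = h x" if "x \<ge> 0" for x
  proof -
    consider "x < a / 2" | "a / 2 \<le> x" "x \<le> b'" | "x > b'" by linarith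
    then show ?thesis
    proof cases
      case 1
      have "max (exp (- x)) (exp (- b')) = exp (- x)" using 1 a by (auto simp: b'_def max_def)
      then show ?thesis using 1 a supp(1)[of x] by (simp add: g_def)
    next
      case 2
      have "max (exp (- x)) (exp (- b')) = exp (- x)" "min (exp (- x)) (exp (- (a / 2))) = exp (- x)"
        using 2 by (auto simp: max_def min_def)
      moreover have "exp (- x) \<noteq> 1" using 2 a by auto
      ultimately show ?thesis using 2 a by (simp add: g_def)
    next
      case 3
      have "max (exp (- x)) (exp (- b')) = exp (- b')" using 3 by (auto simp: max_def)
      moreover have "h b' = 0" "h x = 0" using 3 by (auto intro!: supp(2) simp: b'_def)
      ultimately show ?thesis by (simp add: g_def)
    qed
  qed
  have gh': "g (exp (- x)) * (1 - exp (- x)) = h x" if "x \<ge> 0" for x using gh[OF that] that by simp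
  have finP: "finite_measure (P n)" for n
  proof
    have "emeasure (P n) (space (P n)) = (\<integral>\<^sup>+x. ennreal (real n * (1 - exp (- \<bar>x\<bar>))) \<partial>distr M borel (\<sigma> (1 / real n)))"
      unfolding P_def by (simp add: emeasure_density)
    also have "\<dots> \<le> (\<integral>\<^sup>+x. ennreal (real n) \<partial>distr M borel (\<sigma> (1 / real n)))"
      by (intro nn_integral_mono ennreal_leI mult_left_le) auto
    also have "\<dots> = ennreal (real n)" by (subst nn_integral_distr) (auto simp: emeasure_space_1)
    finally show "emeasure (P n) (space (P n)) \<noteq> \<infinity>" by (auto simp: top_unique)
  qed
  have posP: "AE x in P n. x \<ge> 0" for n
    unfolding P_def by (subst AE_density, simp, subst AE_distr_iff) (auto simp: small_nonneg)
  have finQ: "finite_measure Q"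
  proof
    have "emeasure Q (space Q) = (\<integral>\<^sup>+x. ennreal (1 - exp (- \<bar>x\<bar>)) \<partial>levy)"
      unfolding Q_def by (subst emeasure_density) (auto simp: levy_def)
    also have "\<dots> = (\<integral>\<^sup>+x. ennreal (1 - exp (- (1 * x))) \<partial>levy)"
      by (intro nn_integral_cong_AE) (use AE_levy in \<open>auto elim!: eventually_mono\<close>)
    finally show "emeasure Q (space Q) \<noteq> \<infinity>" using levy_laplace[of 1] by simp
  qed
  have posQ: "AE x in Q. x \<ge> 0"
    unfolding Q_def using AE_levy by (subst AE_density) (auto elim!: eventually_mono)
  have intP: "(\<integral>x. k x \<partial>P n) = real n * expectation (\<lambda>\<omega>. k (\<sigma> (1 / real n) \<omega>) * (1 - exp (- \<bar>\<sigma> (1 / real n) \<omega>\<bar>)))"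
    if [measurable]: "k \<in> borel_measurable borel" for k :: "real \<Rightarrow> real" and n
    unfolding P_def by (subst integral_density) (auto simp: integral_distr mult_ac)
  have intQ: "(\<integral>x. k x \<partial>Q) = (\<integral>x. k x * (1 - exp (- \<bar>x\<bar>)) \<partial>levy)"
    if [measurable]: "k \<in> borel_measurable borel" for k :: "real \<Rightarrow> real"
    unfolding Q_def by (subst integral_density) (auto simp: mult_ac)
  have lapP: "(\<integral>x. exp (- (real i * x)) \<partial>P n) = real n * (exp (- (real i powr \<alpha>) / real n) - exp (- (real (Suc i) powr \<alpha>) / real n))"
    if n: "n > 0" for i n
  proof -
    have int: "integrable M (\<lambda>\<omega>. exp (- l * \<sigma> (1 / real n) \<omega>))" if "l \<ge> 0" for l
      by (rule integrable_const_bound[where B=1]) (use that small_nonneg in auto)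
    have "(\<integral>x. exp (- (real i * x)) \<partial>P n) = real n * expectation (\<lambda>\<omega>. exp (- real i * \<sigma> (1 / real n) \<omega>) - exp (- real (Suc i) * \<sigma> (1 / real n) \<omega>))"
      by (subst intP) (auto intro!: Bochner_Integration.integral_cong
        simp: small_nonneg algebra_simps exp_add[symmetric])
    also have "\<dots> = real n * (exp (- (real i powr \<alpha>) / real n) - exp (- (real (Suc i) powr \<alpha>) / real n))"
      using laplace_small[OF n, of "real i"] laplace_small[OF n, of "real (Suc i)"]
        int[of "real i"] int[of "real (Suc i)"] by simp
    finally show ?thesis .
  qed
  have lapQ: "(\<integral>x. exp (- (real i * x)) \<partial>Q) = real (Suc i) powr \<alpha> - real i powr \<alpha>" for i
  proof -
    have "(\<integral>x. exp (- (real i * x)) \<partial>Q) = (\<integral>x. exp (- (real i * x)) - exp (- (real (Suc i) * x)) \<partial>levy)"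
      unfolding intQ[of "\<lambda>x. exp (- (real i * x))", simplified]
      by (intro integral_cong_AE) (use AE_levy in \<open>auto elim!: eventually_mono simp: algebra_simps exp_add[symmetric]\<close>)
    also have "\<dots> = real (Suc i) powr \<alpha> - real i powr \<alpha>"
    proof (subst integral_eq_nn_integral)
      show "AE x in levy. 0 \<le> exp (- (real i * x)) - exp (- (real (Suc i) * x))"
        using AE_levy by eventually_elim (simp add: mult_right_mono)
      have "real i powr \<alpha> \<le> real (Suc i) powr \<alpha>" using index by (intro powr_mono2) auto
      then show "enn2real (\<integral>\<^sup>+x. ennreal (exp (- (real i * x)) - exp (- (real (Suc i) * x))) \<partial>levy) = real (Suc i) powr \<alpha> - real i powr \<alpha>"
        by (subst levy_exp_diff) auto
    qed simp
    finally show ?thesis .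
  qed
  have "(\<lambda>n. \<integral>x. g (exp (- x)) \<partial>P n) \<longlonglongrightarrow> (\<integral>x. g (exp (- x)) \<partial>Q)"
  proof (rule tendsto_integral_of_laplace[OF finP _ posP finQ _ posQ])
    fix i
    have lim: "(\<lambda>n. real n * (exp (- c / real n) - exp (- d / real n))) \<longlonglongrightarrow> d - c" for c d :: real
      by real_asymp
    show "(\<lambda>n. \<integral>x. exp (- (real i * x)) \<partial>P n) \<longlonglongrightarrow> (\<integral>x. exp (- (real i * x)) \<partial>Q)"
      unfolding lapQ
      by (rule Lim_transform_eventually[OF lim]) (use eventually_gt_at_top[of 0] in eventually_elim, simp add: lapP)
  qed (auto simp: P_def Q_def intro: gc)
  moreover have "(\<integral>x. g (exp (- x)) \<partial>P n) = real n * expectation (\<lambda>\<omega>. h (\<sigma> (1 / real n) \<omega>))" for n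
    by (subst intP) (auto intro!: Bochner_Integration.integral_cong simp: gh' small_nonneg)
  moreover have "(\<integral>x. g (exp (- x)) \<partial>Q) = (\<integral>x. h x \<partial>levy)"
    by (subst intQ, simp, intro integral_cong_AE) (use AE_levy gh' in \<open>auto elim!: eventually_mono\<close>)
  ultimately show ?thesis by simp
qed

section \<open>Limits of tuple sums over increments\<close>

lemma card_distinct_lists_ratio:
  "(\<lambda>n. real (card (distinct_lists k {..<n})) / real n ^ k) \<longlonglongrightarrow> 1"
proof -
  have "(\<lambda>n. \<Prod>i<k. (real n - real i) / real n) \<longlonglongrightarrow> (\<Prod>i<k. 1)"
    by (intro tendsto_prod) real_asymp
  moreover have "\<forall>\<^sub>F n in sequentially. (\<Prod>i<k. (real n - real i) / real n) = real (card (distinct_lists k {..<n})) / real n ^ k"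
    using eventually_ge_at_top[of k]
  proof eventually_elim
    case (elim n)
    have "card (distinct_lists k {..<n}) = \<Prod>{n - k + 1..n}"
      using card_lists_distinct_length_eq[of "{..<n}" k] elim by (simp add: distinct_lists_def)
    also have "\<dots> = (\<Prod>i<k. n - i)"
      by (rule prod.reindex_bij_witness[of _ "\<lambda>i. n - i" "\<lambda>i. n - i"]) (use elim in auto)
    finally show ?case using elim by (simp add: prod_dividef of_nat_prod of_nat_diff)
  qed
  ultimately show ?thesis using Lim_transform_eventually by force
qed

text \<open>The factors \<open>exp (l * X)\<close> cancel the chosen cells out of
  \<open>exp (- l * T)\<close>. The product then splits into \<open>h j\<close> on the
  \<open>k\<close> chosen cells and a Laplace factor on each of the other \<open>n - k\<close>, and
  the cells are independent.\<close>

lemma expectation_list_product: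
  assumes n: "n > 0" and cs: "cs \<in> distinct_lists k {..<n}" and l: "l \<ge> 0"
    and h: "\<And>j. h j \<in> borel_measurable borel" and bd: "\<And>j x. \<bar>h j x\<bar> \<le> 1"
  shows "expectation (\<lambda>\<omega>. (\<Prod>j<k. h j (X n (cs ! j) \<omega>) * exp (l * X n (cs ! j) \<omega>)) * exp (- l * T \<omega>))
    = (\<Prod>j<k. expectation (\<lambda>\<omega>. h j (\<sigma> (1 / real n) \<omega>))) * exp (- (l powr \<alpha>) / real n) ^ (n - k)"
proof -
  have cs': "length cs = k" "distinct cs" "set cs \<subseteq> {..<n}" using cs by (auto simp: distinct_lists_def)
  have bij: "bij_betw (nth cs) {..<k} (set cs)" using cs' by (intro bij_betw_nth) auto
  define p where "p = inv_into {..<k} (nth cs)"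
  have p: "p (cs ! j) = j" if "j < k" for j
    unfolding p_def using bij that by (auto simp: bij_betw_def inv_into_f_f)
  define g where "g c = (if c \<in> set cs then h (p c) else (\<lambda>x. exp (- l * x)))" for c
  have split: "(\<Prod>c<n. f c) = (\<Prod>j<k. f (cs ! j)) * (\<Prod>c\<in>{..<n} - set cs. f c)" for f :: "nat \<Rightarrow> real"
    using prod.subset_diff[OF cs'(3), of f] prod.reindex_bij_betw[OF bij, of f] by (simp add: mult.commute)
  have "(\<Prod>j<k. h j (X n (cs ! j) \<omega>) * exp (l * X n (cs ! j) \<omega>)) * exp (- l * T \<omega>) = (\<Prod>c<n. g c (X n c \<omega>))"
    if \<omega>: "\<omega> \<in> space M" for \<omega>
  proof -
    have "exp (- l * T \<omega>) = (\<Prod>c<n. exp (- l * X n c \<omega>))"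
      using sum_X[OF \<omega> n] by (simp add: exp_sum[symmetric] sum_distrib_left[symmetric] sum_negf)
    also have "\<dots> = (\<Prod>j<k. exp (- l * X n (cs ! j) \<omega>)) * (\<Prod>c\<in>{..<n} - set cs. exp (- l * X n c \<omega>))" by (rule split)
    finally have "(\<Prod>j<k. h j (X n (cs ! j) \<omega>) * exp (l * X n (cs ! j) \<omega>)) * exp (- l * T \<omega>)
      = (\<Prod>j<k. h j (X n (cs ! j) \<omega>) * exp (l * X n (cs ! j) \<omega>) * exp (- l * X n (cs ! j) \<omega>)) * (\<Prod>c\<in>{..<n} - set cs. exp (- l * X n c \<omega>))"
      by (simp add: prod.distrib mult.assoc)
    also have "\<dots> = (\<Prod>j<k. g (cs ! j) (X n (cs ! j) \<omega>)) * (\<Prod>c\<in>{..<n} - set cs. g c (X n c \<omega>))"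
      using cs' by (intro arg_cong2[where f="(*)"] prod.cong) (auto simp: g_def p mult.assoc exp_add[symmetric])
    finally show ?thesis by (simp only: split[of "\<lambda>c. g c (X n c \<omega>)"])
  qed
  then have "expectation (\<lambda>\<omega>. (\<Prod>j<k. h j (X n (cs ! j) \<omega>) * exp (l * X n (cs ! j) \<omega>)) * exp (- l * T \<omega>))
    = expectation (\<lambda>\<omega>. \<Prod>c<n. g c (X n c \<omega>))"
    by (intro Bochner_Integration.integral_cong) auto
  also have "\<dots> = (\<Prod>c<n. expectation (\<lambda>\<omega>. g c (\<sigma> (1 / real n) \<omega>)))"
    using h bd l by (intro expectation_prod_X[OF n, where B="\<lambda>_. 1"]) (auto simp: g_def)
  also have "\<dots> = (\<Prod>j<k. expectation (\<lambda>\<omega>. g (cs ! j) (\<sigma> (1 / real n) \<omega>))) * (\<Prod>c\<in>{..<n} - set cs. expectation (\<lambda>\<omega>. g c (\<sigma> (1 / real n) \<omega>)))"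
    by (rule split)
  also have "\<dots> = (\<Prod>j<k. expectation (\<lambda>\<omega>. h j (\<sigma> (1 / real n) \<omega>))) * (\<Prod>c\<in>{..<n} - set cs. exp (- (l powr \<alpha>) / real n))"
  proof (intro arg_cong2[where f="(*)"] prod.cong refl)
    fix j assume "j \<in> {..<k}"
    then show "expectation (\<lambda>\<omega>. g (cs ! j) (\<sigma> (1 / real n) \<omega>)) = expectation (\<lambda>\<omega>. h j (\<sigma> (1 / real n) \<omega>))"
      using cs' by (simp add: g_def p)
  next
    fix c assume "c \<in> {..<n} - set cs"
    then show "expectation (\<lambda>\<omega>. g c (\<sigma> (1 / real n) \<omega>)) = exp (- (l powr \<alpha>) / real n)"
      using laplace_small[OF n l] by (simp add: g_def)
  qed
  also have "(\<Prod>c\<in>{..<n} - set cs. exp (- (l powr \<alpha>) / real n)) = exp (- (l powr \<alpha>) / real n) ^ (n - k)"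
    using cs' by (simp add: card_Diff_subset distinct_card)
  finally show ?thesis .
qed

text \<open>At most \<open>T \<omega> / a\<close> increments can reach \<open>a\<close>. The bound
  does not depend on \<open>n\<close>, which makes dominated convergence possible.\<close>

lemma card_lists_big_increments:
  assumes a: "a > 0" and \<omega>: "\<omega> \<in> space M" and n: "n > 0"
  shows "real (card {cs \<in> distinct_lists k {..<n}. \<forall>j<k. a \<le> X n (cs ! j) \<omega>}) \<le> (T \<omega> / a) ^ k"
proof -
  let ?C = "{c \<in> {..<n}. a \<le> X n c \<omega>}"
  have sub: "{cs \<in> distinct_lists k {..<n}. \<forall>j<k. a \<le> X n (cs ! j) \<omega>} \<subseteq> {xs. set xs \<subseteq> ?C \<and> length xs = k}"
    by (auto simp: distinct_lists_def in_set_conv_nth)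
  have "card {cs \<in> distinct_lists k {..<n}. \<forall>j<k. a \<le> X n (cs ! j) \<omega>} \<le> card ?C ^ k"
    using card_mono[OF finite_lists_length_eq sub] card_lists_length_eq[of ?C k] by simp
  then have "real (card {cs \<in> distinct_lists k {..<n}. \<forall>j<k. a \<le> X n (cs ! j) \<omega>}) \<le> real (card ?C) ^ k"
    unfolding of_nat_power[symmetric] by (rule of_nat_mono)
  moreover have "real (card ?C) \<le> T \<omega> / a"
  proof -
    have "real (card ?C) * a \<le> (\<Sum>c\<in>?C. X n c \<omega>)"
      using sum_mono[of ?C "\<lambda>_. a" "\<lambda>c. X n c \<omega>"] by simp
    also have "\<dots> \<le> (\<Sum>c<n. X n c \<omega>)" using X_nonneg[OF \<omega>] by (intro sum_mono2) auto
    finally show ?thesis using sum_X[OF \<omega> n] a by (simp add: pos_le_divide_eq)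
  qed
  then have "real (card ?C) ^ k \<le> (T \<omega> / a) ^ k" by (rule power_mono) simp
  ultimately show ?thesis by (rule order_trans)
qed

lemma Z_measurable [measurable]: "Z i \<in> borel_measurable M"
proof (rule borel_measurable_iff_greater[THEN iffD2], rule allI)
  fix a
  show "{\<omega> \<in> space M. a < Z i \<omega>} \<in> sets M"
  proof (cases "a \<ge> 0")
    case True
    have "{\<omega> \<in> space M. a < Z i \<omega>} = {\<omega> \<in> space M. \<exists>q. \<exists>N. \<forall>n\<ge>N.
      real i < (\<Sum>c<n. indicator {a + 1 / real (Suc q)..} (X n c \<omega>))}"
    proof (intro Collect_cong conj_cong refl)
      fix \<omega> assume \<omega>: "\<omega> \<in> space M"
      have card: "real (card {c \<in> {..<n}. y \<le> X n c \<omega>}) = (\<Sum>c<n. indicator {y..} (X n c \<omega>))" for n y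
        by (simp add: indicator_def sum.If_cases Int_def)
      have "i < card {c \<in> {..<n}. y \<le> X n c \<omega>} \<longleftrightarrow> real i < (\<Sum>c<n. indicator {y..} (X n c \<omega>))" for n y
        unfolding card[symmetric] of_nat_less_iff ..
      then show "a < Z i \<omega> \<longleftrightarrow> (\<exists>q. \<exists>N. \<forall>n\<ge>N. real i < (\<Sum>c<n. indicator {a + 1 / real (Suc q)..} (X n c \<omega>)))"
        by (simp only: increasing_path.less_rank_iff[OF path[OF \<omega>] True] eventually_sequentially)
    qed
    also have "\<dots> \<in> sets M" by measurable
    finally show ?thesis .
  next
    case False
    then have "{\<omega> \<in> space M. a < Z i \<omega>} = space M"
      using increasing_path.rank_nonneg[OF path] by (auto intro: less_le_trans[of a 0])
    then show ?thesis by simp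
  qed
qed

lemma Z_nonneg: "\<omega> \<in> space M \<Longrightarrow> 0 \<le> Z i \<omega>"
  by (rule increasing_path.rank_nonneg[OF path])

lemma sum_Z_le:
  assumes "\<omega> \<in> space M" "is \<in> distinct_lists k UNIV"
  shows "(\<Sum>j<k. Z (is ! j) \<omega>) \<le> T \<omega>"
proof -
  have "bij_betw (nth is) {..<k} (set is)" using assms by (intro bij_betw_nth) (auto simp: distinct_lists_def)
  then have "(\<Sum>j<k. Z (is ! j) \<omega>) = (\<Sum>i\<in>set is. Z i \<omega>)" by (rule sum.reindex_bij_betw)
  then show ?thesis using increasing_path.sum_rank_le[OF path[OF assms(1)]] by simp
qed

text \<open>A single term of the exponential series of \<open>l * x\<close> is at most the whole
  series.\<close>

lemma power_exp_bounded:
  assumes "l > 0" "(x::real) \<ge> 0"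
  shows "x ^ k * exp (- l * x) \<le> fact k / l ^ k"
proof -
  have "(l * x) ^ k / fact k \<le> exp (l * x)"
  proof -
    have "(\<Sum>i\<in>{k}. (l * x) ^ i /\<^sub>R fact i) \<le> (\<Sum>i. (l * x) ^ i /\<^sub>R fact i)"
      using assms summable_exp_generic[of "l * x"] by (intro sum_le_suminf) auto
    then show ?thesis by (simp add: exp_def divide_inverse mult.commute)
  qed
  then have "x ^ k * l ^ k \<le> fact k * exp (l * x)"
    by (simp add: pos_divide_le_eq power_mult_distrib mult.commute)
  then have "x ^ k * l ^ k * exp (- l * x) \<le> fact k * exp (l * x) * exp (- l * x)" by (intro mult_right_mono) auto
  then show ?thesis using assms by (simp add: pos_le_divide_eq mult_ac exp_add[symmetric])
qed

text \<open>The Mecke formula for compactly supported test functions of the jumps and an exponential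
  of the rest. It is the limit of the same identity for the increments: the \<open>k\<close> sampled
  cells turn into Levy integrals, and the other \<open>n - k\<close> cells rebuild the full
  transform of \<open>T\<close>. This is why the rest on the right-hand side has the law of
  \<open>T\<close> itself.\<close>

lemma jump_lists_laplace:
  assumes a: "0 < a" and l: "l > 0"
    and h: "\<And>j. continuous_on UNIV (h j)" "\<And>j x. 0 \<le> h j x" "\<And>j x. h j x \<le> 1"
    and supp: "\<And>j x. x < a \<Longrightarrow> h j x = 0" "\<And>j x. x > b \<Longrightarrow> h j x = (0::real)"
  shows "(\<integral>\<^sup>+\<omega>. \<integral>\<^sup>+is. ennreal ((\<Prod>j<k. h j (Z (is ! j) \<omega>)) * exp (- l * (T \<omega> - (\<Sum>j<k. Z (is ! j) \<omega>))))
       \<partial>count_space (distinct_lists k UNIV) \<partial>M)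
    = ennreal ((\<Prod>j<k. \<integral>x. h j x \<partial>levy) * exp (- (l powr \<alpha>)))"
proof -
  have [measurable]: "h j \<in> borel_measurable borel" for j using h(1) by (rule borel_measurable_continuous_onI)
  define H where "H j x = h j x * exp (l * x)" for j x
  have [measurable]: "H j \<in> borel_measurable borel" for j unfolding H_def by measurable
  have H0: "H j x \<ge> 0" for j x using h(2) by (simp add: H_def)
  have HB: "H j x \<le> exp (l * \<bar>b\<bar>)" for j x
  proof (cases "x > b")
    case True then show ?thesis using supp(2)[of x j] by (simp add: H_def)
  next
    case False
    then have "exp (l * x) \<le> exp (l * \<bar>b\<bar>)" using l by auto
    then show ?thesis using h(2,3)[of j x] mult_mono[of "h j x" 1 "exp (l * x)" "exp (l * \<bar>b\<bar>)"] by (simp add: H_def)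
  qed
  define S where "S n \<omega> = (\<Sum>cs\<in>distinct_lists k {..<n}. \<Prod>j<k. H j (X n (cs ! j) \<omega>)) * exp (- l * T \<omega>)" for n \<omega>
  \<comment> \<open>The threshold has to lie strictly below \<open>a\<close>, the edge of the
    supports, for \<open>sum_incr_lists_tendsto\<close>.\<close>
  define I where "I \<omega> = distinct_lists k {i. a / 2 \<le> Z i \<omega>}" for \<omega>
  define S' where "S' \<omega> = (\<Sum>is\<in>I \<omega>. \<Prod>j<k. H j (Z (is ! j) \<omega>)) * exp (- l * T \<omega>)" for \<omega>
  have finI: "finite (I \<omega>)" if "\<omega> \<in> space M" for \<omega>
    using increasing_path.big_rank_eq[OF path[OF that], of "a / 2"] a by (simp add: I_def finite_distinct_lists)
  have lim: "(\<lambda>n. S n \<omega>) \<longlonglongrightarrow> S' \<omega>" if "\<omega> \<in> space M" for \<omega>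
    unfolding S_def S'_def I_def
    by (intro tendsto_mult increasing_path.sum_incr_lists_tendsto[OF path[OF that], of "a / 2" a] tendsto_const)
      (use a h(1) supp in \<open>auto simp: H_def intro!: continuous_intros\<close>)
  \<comment> \<open>At most \<open>(T / a) ^ k\<close> lists contribute, each with at most
    \<open>exp (l * \<bar>b\<bar>) ^ k\<close>, and \<open>T ^ k * exp (- l * T)\<close> is at most
    \<open>fact k / l ^ k\<close>. Here \<open>l > 0\<close> enters.\<close>
  define K where "K = exp (l * \<bar>b\<bar>) ^ k * (1 / a ^ k) * (fact k / l ^ k)"
  have bound: "\<bar>S n \<omega>\<bar> \<le> K" if \<omega>: "\<omega> \<in> space M" and n: "n > 0" for n \<omega>
  proof -
    let ?L = "{cs \<in> distinct_lists k {..<n}. \<forall>j<k. a \<le> X n (cs ! j) \<omega>}"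
    have "(\<Sum>cs\<in>distinct_lists k {..<n}. \<Prod>j<k. H j (X n (cs ! j) \<omega>)) = (\<Sum>cs\<in>?L. \<Prod>j<k. H j (X n (cs ! j) \<omega>))"
    proof (rule sum.mono_neutral_right)
      show "\<forall>cs\<in>distinct_lists k {..<n} - ?L. (\<Prod>j<k. H j (X n (cs ! j) \<omega>)) = 0"
      proof
        fix cs assume "cs \<in> distinct_lists k {..<n} - ?L"
        then obtain j where "j < k" "X n (cs ! j) \<omega> < a" by (auto simp: not_le)
        then show "(\<Prod>j<k. H j (X n (cs ! j) \<omega>)) = 0" using supp(1) by (intro prod_zero) (auto simp: H_def)
      qed
    qed auto
    also have "\<dots> \<le> (\<Sum>cs\<in>?L. exp (l * \<bar>b\<bar>) ^ k)"
    proof (rule sum_mono)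
      fix cs
      have "(\<Prod>j<k. H j (X n (cs ! j) \<omega>)) \<le> (\<Prod>j<k. exp (l * \<bar>b\<bar>))"
        using H0 HB by (intro prod_mono) auto
      then show "(\<Prod>j<k. H j (X n (cs ! j) \<omega>)) \<le> exp (l * \<bar>b\<bar>) ^ k" by simp
    qed
    also have "\<dots> = real (card ?L) * exp (l * \<bar>b\<bar>) ^ k" by simp
    also have "\<dots> \<le> (T \<omega> / a) ^ k * exp (l * \<bar>b\<bar>) ^ k"
      using card_lists_big_increments[OF a \<omega> n, of k] by (intro mult_right_mono) auto
    finally have "S n \<omega> \<le> (T \<omega> / a) ^ k * exp (l * \<bar>b\<bar>) ^ k * exp (- l * T \<omega>)"
      unfolding S_def by (intro mult_right_mono) auto
    also have "\<dots> = exp (l * \<bar>b\<bar>) ^ k * (1 / a ^ k) * (T \<omega> ^ k * exp (- l * T \<omega>))" by (simp add: power_divide)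
    also have "\<dots> \<le> K" unfolding K_def
      using power_exp_bounded[OF l T_nonneg[OF \<omega>], of k] a by (intro mult_left_mono) auto
    finally have "S n \<omega> \<le> K" .
    moreover have "S n \<omega> \<ge> 0" unfolding S_def using H0 by (intro mult_nonneg_nonneg sum_nonneg prod_nonneg) auto
    ultimately show ?thesis by simp
  qed
  have [measurable]: "S n \<in> borel_measurable M" for n unfolding S_def by measurable
  have S'm: "S' \<in> borel_measurable M" by (rule borel_measurable_LIMSEQ_real[OF lim]) auto
  have conv: "(\<lambda>n. expectation (S (Suc n))) \<longlonglongrightarrow> expectation S'"
    by (rule integral_dominated_convergence[where w="\<lambda>_. K"])
      (use S'm bound LIMSEQ_Suc[OF lim] in auto)
  have bd': "\<bar>H j x\<bar> \<le> exp (l * \<bar>b\<bar>)" for j x using H0[of j x] HB[of j x] by simp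
  \<comment> \<open>The number of lists is of order \<open>n ^ k\<close>. Dividing it by
    \<open>n ^ k\<close> frees one factor \<open>n\<close> for each expectation, the scaling
    required by \<open>vague_convergence\<close>.\<close>
  have ES: "expectation (S n) = real (card (distinct_lists k {..<n})) / real n ^ k * (\<Prod>j<k. real n * expectation (\<lambda>\<omega>. h j (\<sigma> (1 / real n) \<omega>)))
      * exp (- (l powr \<alpha>) * (real n - real k) / real n)" if n: "n > 0" "n \<ge> k" for n
  proof -
    have "expectation (S n) = expectation (\<lambda>\<omega>. \<Sum>cs\<in>distinct_lists k {..<n}. (\<Prod>j<k. h j (X n (cs ! j) \<omega>) * exp (l * X n (cs ! j) \<omega>)) * exp (- l * T \<omega>))"
      unfolding S_def by (intro Bochner_Integration.integral_cong) (auto simp: sum_distrib_right H_def)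
    also have "\<dots> = (\<Sum>cs\<in>distinct_lists k {..<n}. expectation (\<lambda>\<omega>. (\<Prod>j<k. h j (X n (cs ! j) \<omega>) * exp (l * X n (cs ! j) \<omega>)) * exp (- l * T \<omega>)))"
    proof (rule Bochner_Integration.integral_sum)
      fix cs
      have "\<bar>(\<Prod>j<k. H j (X n (cs ! j) \<omega>)) * exp (- l * T \<omega>)\<bar> \<le> exp (l * \<bar>b\<bar>) ^ k * 1" if "\<omega> \<in> space M" for \<omega>
      proof -
        have "\<bar>\<Prod>j<k. H j (X n (cs ! j) \<omega>)\<bar> \<le> (\<Prod>j<k. exp (l * \<bar>b\<bar>))"
          unfolding abs_prod using bd' by (intro prod_mono) auto
        then show ?thesis unfolding abs_mult using T_nonneg[OF that] l by (intro mult_mono) auto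
      qed
      then show "integrable M (\<lambda>\<omega>. (\<Prod>j<k. h j (X n (cs ! j) \<omega>) * exp (l * X n (cs ! j) \<omega>)) * exp (- l * T \<omega>))"
        unfolding H_def[symmetric] by (intro integrable_const_bound[where B="exp (l * \<bar>b\<bar>) ^ k * 1"]) auto
    qed
    also have "\<dots> = (\<Sum>cs\<in>distinct_lists k {..<n}. (\<Prod>j<k. expectation (\<lambda>\<omega>. h j (\<sigma> (1 / real n) \<omega>))) * exp (- (l powr \<alpha>) / real n) ^ (n - k))"
      by (intro sum.cong refl expectation_list_product) (use n l h in auto)
    also have "exp (- (l powr \<alpha>) / real n) ^ (n - k) = exp (- (l powr \<alpha>) * (real n - real k) / real n)"
      using n by (simp add: exp_of_nat_mult[symmetric] of_nat_diff mult.commute)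
    finally show ?thesis using n by (simp add: prod.distrib)
  qed
  have "(\<lambda>n. real (card (distinct_lists k {..<n})) / real n ^ k * (\<Prod>j<k. real n * expectation (\<lambda>\<omega>. h j (\<sigma> (1 / real n) \<omega>)))
      * exp (- (l powr \<alpha>) * (real n - real k) / real n)) \<longlonglongrightarrow> 1 * (\<Prod>j<k. \<integral>x. h j x \<partial>levy) * exp (- (l powr \<alpha>) * 1)"
  proof (intro tendsto_mult tendsto_prod card_distinct_lists_ratio tendsto_exp)
    show "(\<lambda>n. real n * expectation (\<lambda>\<omega>. h j (\<sigma> (1 / real n) \<omega>))) \<longlonglongrightarrow> (\<integral>x. h j x \<partial>levy)" for j
      by (rule vague_convergence[OF a h(1) supp])
    show "(\<lambda>n. - (l powr \<alpha>) * (real n - real k) / real n) \<longlonglongrightarrow> - (l powr \<alpha>) * 1"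
      by real_asymp
  qed
  moreover have "\<forall>\<^sub>F n in sequentially. real (card (distinct_lists k {..<n})) / real n ^ k * (\<Prod>j<k. real n * expectation (\<lambda>\<omega>. h j (\<sigma> (1 / real n) \<omega>)))
      * exp (- (l powr \<alpha>) * (real n - real k) / real n) = expectation (S n)"
    using eventually_gt_at_top[of k] by eventually_elim (simp add: ES)
  ultimately have "(\<lambda>n. expectation (S n)) \<longlonglongrightarrow> 1 * (\<Prod>j<k. \<integral>x. h j x \<partial>levy) * exp (- (l powr \<alpha>) * 1)"
    by (rule Lim_transform_eventually)
  then have "(\<lambda>n. expectation (S n)) \<longlonglongrightarrow> (\<Prod>j<k. \<integral>x. h j x \<partial>levy) * exp (- (l powr \<alpha>))" by simp
  then have ES': "expectation S' = (\<Prod>j<k. \<integral>x. h j x \<partial>levy) * exp (- (l powr \<alpha>))"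
    using LIMSEQ_unique[OF conv] LIMSEQ_Suc by blast
  have S'0: "S' \<omega> \<ge> 0" for \<omega> unfolding S'_def using H0 by (intro mult_nonneg_nonneg sum_nonneg prod_nonneg) auto
  have S'K: "\<bar>S' \<omega>\<bar> \<le> K" if "\<omega> \<in> space M" for \<omega>
  proof -
    have "(\<lambda>n. \<bar>S (Suc n) \<omega>\<bar>) \<longlonglongrightarrow> \<bar>S' \<omega>\<bar>" using LIMSEQ_Suc[OF lim[OF that]] by (rule tendsto_rabs)
    then show ?thesis by (rule LIMSEQ_le_const2) (use bound[OF that] in auto)
  qed
  have int: "integrable M S'" by (rule integrable_const_bound[where B=K]) (use S'm S'K in auto)
  have "(\<integral>\<^sup>+\<omega>. \<integral>\<^sup>+is. ennreal ((\<Prod>j<k. h j (Z (is ! j) \<omega>)) * exp (- l * (T \<omega> - (\<Sum>j<k. Z (is ! j) \<omega>))))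
       \<partial>count_space (distinct_lists k UNIV) \<partial>M) = (\<integral>\<^sup>+\<omega>. ennreal (S' \<omega>) \<partial>M)"
  proof (intro nn_integral_cong)
    fix \<omega> assume \<omega>: "\<omega> \<in> space M"
    have factor: "(\<Prod>j<k. h j (Z (is ! j) \<omega>)) * exp (- l * (T \<omega> - (\<Sum>j<k. Z (is ! j) \<omega>))) = (\<Prod>j<k. H j (Z (is ! j) \<omega>)) * exp (- l * T \<omega>)" for "is"
    proof -
      have "exp (- l * (T \<omega> - (\<Sum>j<k. Z (is ! j) \<omega>))) = exp (\<Sum>j<k. l * Z (is ! j) \<omega>) * exp (- l * T \<omega>)"
        by (simp add: exp_add[symmetric] sum_distrib_left[symmetric] right_diff_distrib)
      then show ?thesis by (simp add: H_def prod.distrib exp_sum)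
    qed
    have "(\<integral>\<^sup>+is. ennreal ((\<Prod>j<k. H j (Z (is ! j) \<omega>)) * exp (- l * T \<omega>)) \<partial>count_space (distinct_lists k UNIV))
      = (\<Sum>is\<in>I \<omega>. ennreal ((\<Prod>j<k. H j (Z (is ! j) \<omega>)) * exp (- l * T \<omega>)))"
    proof (rule nn_integral_count_space'[OF finI[OF \<omega>]])
      fix "is" assume "is \<in> distinct_lists k UNIV" "is \<notin> I \<omega>"
      then obtain i where "i \<in> set is" "Z i \<omega> < a / 2" "length is = k" by (auto simp: I_def distinct_lists_def subset_iff not_le)
      then obtain j where "j < k" "Z (is ! j) \<omega> < a" using a by (auto simp: in_set_conv_nth)
      then have "(\<Prod>j<k. H j (Z (is ! j) \<omega>)) = 0" using supp(1) by (intro prod_zero) (auto simp: H_def)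
      then show "ennreal ((\<Prod>j<k. H j (Z (is ! j) \<omega>)) * exp (- l * T \<omega>)) = 0"
        by (simp only: mult_zero_left ennreal_0)
    qed (auto simp: I_def distinct_lists_def)
    also have "\<dots> = ennreal (S' \<omega>)"
      unfolding S'_def sum_distrib_right using H0 by (intro sum_ennreal) (auto intro!: mult_nonneg_nonneg prod_nonneg)
    finally show "(\<integral>\<^sup>+is. ennreal ((\<Prod>j<k. h j (Z (is ! j) \<omega>)) * exp (- l * (T \<omega> - (\<Sum>j<k. Z (is ! j) \<omega>))))
       \<partial>count_space (distinct_lists k UNIV)) = ennreal (S' \<omega>)" unfolding factor .
  qed
  also have "\<dots> = ennreal (expectation S')" using int S'0 by (intro nn_integral_eq_integral) auto
  finally show ?thesis unfolding ES' .
qed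

end

section \<open>The Mecke formula\<close>

lemma (in product_sigma_finite) PiM_density:
  assumes I: "finite I" and d: "\<And>i. i \<in> I \<Longrightarrow> d i \<in> borel_measurable (M i)"
    and fin: "\<And>i. sigma_finite_measure (density (M i) (d i))"
  shows "density (PiM I M) (\<lambda>x. \<Prod>i\<in>I. d i (x i)) = PiM I (\<lambda>i. density (M i) (d i))"
proof -
  interpret N: product_sigma_finite "\<lambda>i. density (M i) (d i)"
    by (rule product_sigma_finite.intro) (rule fin)
  have [measurable]: "(\<lambda>x. d i (x i)) \<in> borel_measurable (PiM I M)" if "i \<in> I" for i
    by (rule measurable_compose[OF measurable_component_singleton[OF that, where M=M] d[OF that]])
  show ?thesis
  proof (rule N.PiM_eqI[OF I])
    show "sets (density (PiM I M) (\<lambda>x. \<Prod>i\<in>I. d i (x i))) = sets (PiM I (\<lambda>i. density (M i) (d i)))"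
      by (simp cong: sets_PiM_cong)
    fix A assume "\<And>i. i \<in> I \<Longrightarrow> A i \<in> sets (density (M i) (d i))"
    then have A: "A i \<in> sets (M i)" if "i \<in> I" for i using that by simp
    have "emeasure (density (PiM I M) (\<lambda>x. \<Prod>i\<in>I. d i (x i))) (Pi\<^sub>E I A)
      = (\<integral>\<^sup>+x. (\<Prod>i\<in>I. d i (x i)) * indicator (Pi\<^sub>E I A) x \<partial>PiM I M)"
      by (rule emeasure_density) (use A I in \<open>auto intro!: borel_measurable_prod_ennreal sets_PiM_I_finite\<close>)
    also have "\<dots> = (\<integral>\<^sup>+x. (\<Prod>i\<in>I. d i (x i) * indicator (A i) (x i)) \<partial>PiM I M)"
    proof (intro nn_integral_cong)
      fix x assume "x \<in> space (PiM I M)"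
      then have "x \<in> extensional I" by (auto simp: space_PiM PiE_def)
      then have "indicator (Pi\<^sub>E I A) x = (\<Prod>i\<in>I. indicator (A i) (x i) :: ennreal)"
        using I by (auto simp: indicator_def PiE_def Pi_iff)
      then show "(\<Prod>i\<in>I. d i (x i)) * indicator (Pi\<^sub>E I A) x = (\<Prod>i\<in>I. d i (x i) * indicator (A i) (x i))"
        by (simp add: prod.distrib)
    qed
    also have "\<dots> = (\<Prod>i\<in>I. \<integral>\<^sup>+x. d i x * indicator (A i) x \<partial>M i)"
      using A d by (intro product_nn_integral_prod[OF I]) auto
    also have "\<dots> = (\<Prod>i\<in>I. emeasure (density (M i) (d i)) (A i))"
      using A d by (intro prod.cong refl emeasure_density[symmetric]) auto
    finally show "emeasure (density (PiM I M) (\<lambda>x. \<Prod>i\<in>I. d i (x i))) (Pi\<^sub>E I A)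
      = (\<Prod>i\<in>I. emeasure (density (M i) (d i)) (A i))" .
  qed
qed

context stable_jumps
begin

abbreviation "index_lists k \<equiv> count_space (distinct_lists k (UNIV :: nat set))"

text \<open>Coordinate \<open>k\<close> holds the rest of the path, so that jumps and rest can be
  treated as one random vector and compared with a product measure on \<open>k + 1\<close>
  coordinates.\<close>

definition jump_vector :: "nat \<Rightarrow> nat list \<Rightarrow> 'a \<Rightarrow> nat \<Rightarrow> real"
  where "jump_vector k is \<omega> = (\<lambda>j\<in>{..<Suc k}. if j < k then Z (is ! j) \<omega> else T \<omega> - (\<Sum>j<k. Z (is ! j) \<omega>))"

text \<open>As usual in a Mecke formula, what remains after removing sampled points has the law of
  the unreduced process, here that of \<open>T\<close>.\<close>

definition jump_law :: "nat \<Rightarrow> nat \<Rightarrow> real measure"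
  where "jump_law k j = (if j < k then levy else distr M borel T)"

lemma sets_jump_law [simp, measurable_cong]: "sets (jump_law k j) = sets borel"
  by (simp add: jump_law_def)

lemma measurable_jump_law [simp]: "measurable (jump_law k j) N = measurable borel N"
  by (rule measurable_cong_sets) auto

lemma sets_PiM_jump_law: "sets (PiM I (jump_law k)) = sets (\<Pi>\<^sub>M i\<in>I. borel)"
  by (intro sets_PiM_cong) auto

lemma product_sigma_finite_jump_law: "product_sigma_finite (jump_law k)"
proof -
  interpret T: prob_space "distr M borel T" by (rule prob_space_distr) simp
  show ?thesis
    by (rule product_sigma_finite.intro)
      (auto simp: jump_law_def sigma_finite_levy T.sigma_finite_measure_axioms)
qed

lemma jump_vector_measurable [measurable]:
  "(\<lambda>(is, \<omega>). jump_vector k is \<omega>) \<in> index_lists k \<Otimes>\<^sub>M M \<rightarrow>\<^sub>M (\<Pi>\<^sub>M j\<in>{..<Suc k}. borel)"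
proof (rule measurable_pair_measure_countable1)
  fix "is"
  show "(\<lambda>\<omega>. case (is, \<omega>) of (is, \<omega>) \<Rightarrow> jump_vector k is \<omega>) \<in> M \<rightarrow>\<^sub>M (\<Pi>\<^sub>M j\<in>{..<Suc k}. borel)"
    unfolding jump_vector_def prod.case by (intro measurable_restrict) simp
qed simp

lemma jump_vector_simps:
  "j < k \<Longrightarrow> jump_vector k is \<omega> j = Z (is ! j) \<omega>"
  "jump_vector k is \<omega> k = T \<omega> - (\<Sum>j<k. Z (is ! j) \<omega>)"
  by (auto simp: jump_vector_def)

lemma jump_vector_nonneg:
  assumes "is \<in> distinct_lists k UNIV" "\<omega> \<in> space M" "j < Suc k"
  shows "0 \<le> jump_vector k is \<omega> j"
proof (cases "j < k")
  case False
  then have "j = k" using assms(3) by simp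
  then show ?thesis using sum_Z_le[OF assms(2,1)] by (simp add: jump_vector_simps)
qed (use Z_nonneg[OF assms(2)] in \<open>simp add: jump_vector_simps\<close>)

lemma nn_integral_lists:
  assumes [measurable]: "F \<in> borel_measurable (index_lists k \<Otimes>\<^sub>M M)"
  shows "(\<integral>\<^sup>+p. F p \<partial>(index_lists k \<Otimes>\<^sub>M M)) = (\<integral>\<^sup>+\<omega>. \<integral>\<^sup>+is. F (is, \<omega>) \<partial>index_lists k \<partial>M)"
proof -
  have "(\<integral>\<^sup>+p. F p \<partial>(index_lists k \<Otimes>\<^sub>M M)) = (\<integral>\<^sup>+is. \<integral>\<^sup>+\<omega>. F (is, \<omega>) \<partial>M \<partial>index_lists k)"
    by (rule nn_integral_fst[symmetric]) simp
  also have "\<dots> = (\<integral>\<^sup>+\<omega>. \<integral>\<^sup>+is. F (is, \<omega>) \<partial>index_lists k \<partial>M)"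
    by (rule nn_integral_count_space_nn_integral[symmetric]) auto
  finally show ?thesis .
qed

text \<open>Continuous with compact support in the positive half-line, as demanded by
  \<open>jump_lists_laplace\<close>, and increasing in \<open>n\<close> to the indicator of positive
  numbers, so that monotone convergence can remove it.\<close>

definition cutoff :: "nat \<Rightarrow> real \<Rightarrow> real"
  where "cutoff n x = max 0 (min 1 (min (real (Suc n) * x - 1) (real (Suc n) - x)))"

lemma cutoff_bounds: "0 \<le> cutoff n x" "cutoff n x \<le> 1"
  by (auto simp: cutoff_def)

lemma cutoff_continuous: "continuous_on S (cutoff n)"
  unfolding cutoff_def by (intro continuous_intros)

lemma cutoff_measurable [measurable]: "cutoff n \<in> borel_measurable borel"
  by (rule borel_measurable_continuous_onI[OF cutoff_continuous])

lemma cutoff_zero: "x < 1 / real (Suc n) \<Longrightarrow> cutoff n x = 0" "x > real (Suc n) \<Longrightarrow> cutoff n x = 0"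
  by (auto simp: cutoff_def field_simps)

lemma cutoff_mono: "n \<le> m \<Longrightarrow> cutoff n x \<le> cutoff m x"
proof (cases "x \<ge> 0")
  case True
  assume "n \<le> m"
  then have "real (Suc n) * x \<le> real (Suc m) * x" using True by (intro mult_right_mono) auto
  then show ?thesis unfolding cutoff_def using \<open>n \<le> m\<close> by (intro max.mono min.mono) auto
next
  case False
  then have "x < 0" by simp
  also have "0 < 1 / real (Suc n)" by simp
  finally have "x < 1 / real (Suc n)" .
  then show ?thesis using cutoff_zero(1)[of x n] cutoff_bounds(1)[of m x] by simp
qed

lemma cutoff_eventually:
  assumes "x > 0"
  shows "\<forall>\<^sub>F n in sequentially. cutoff n x = 1"
  using eventually_ge_at_top[of "nat \<lceil>2 / x\<rceil>"] eventually_ge_at_top[of "nat \<lceil>x + 1\<rceil>"]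
proof eventually_elim
  case (elim n)
  have "2 / x \<le> real (Suc n)" using elim(1) by linarith
  then have "real (Suc n) * x \<ge> 2" using assms by (simp add: pos_divide_le_eq)
  moreover have "real (Suc n) \<ge> x + 1" using elim(2) by linarith
  ultimately show ?case unfolding cutoff_def by simp
qed

lemma levy_cutoff_finite: "(\<integral>\<^sup>+x. ennreal (cutoff n x) \<partial>levy) < \<infinity>"
proof -
  define a where "a = 1 / real (Suc n)"
  have a: "1 - exp (- a) > 0" by (simp add: a_def)
  have "(\<integral>\<^sup>+x. ennreal (cutoff n x) \<partial>levy) \<le> (\<integral>\<^sup>+x. ennreal (1 / (1 - exp (- a))) * ennreal (1 - exp (- (1 * x))) \<partial>levy)"
  proof (intro nn_integral_mono)
    fix x
    show "ennreal (cutoff n x) \<le> ennreal (1 / (1 - exp (- a))) * ennreal (1 - exp (- (1 * x)))"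
    proof (cases "x < a")
      case False
      then have "1 - exp (- a) \<le> 1 - exp (- (1 * x))" by simp
      then have "1 \<le> 1 / (1 - exp (- a)) * (1 - exp (- (1 * x)))" using a by (simp add: pos_le_divide_eq)
      then have "cutoff n x \<le> 1 / (1 - exp (- a)) * (1 - exp (- (1 * x)))" using cutoff_bounds(2)[of n x] by linarith
      then show ?thesis using a by (subst ennreal_mult'[symmetric]) (auto intro: ennreal_leI)
    qed (simp add: cutoff_zero a_def)
  qed
  also have "\<dots> = ennreal (1 / (1 - exp (- a))) * ennreal (1 powr \<alpha>)"
    by (subst nn_integral_cmult) (use levy_laplace[of 1] in auto)
  also have "\<dots> < \<infinity>" by (simp add: ennreal_mult_less_top)
  finally show ?thesis .
qed

text \<open>The exponential on the last coordinate shifts its Laplace argument by 1. The argument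
  thus stays positive when all \<open>l j\<close> are 0, and the weighted measure is finite.\<close>

definition cutoff_weight :: "nat \<Rightarrow> nat \<Rightarrow> nat \<Rightarrow> real \<Rightarrow> real"
  where "cutoff_weight n k j x = (if j < k then cutoff n x else exp (- x))"

lemma cutoff_weight_measurable [measurable]: "cutoff_weight n k j \<in> borel_measurable borel"
  unfolding cutoff_weight_def by simp

lemma cutoff_weight_nonneg: "0 \<le> cutoff_weight n k j x"
  by (simp add: cutoff_weight_def cutoff_bounds)

text \<open>After weighting, both sides are finite measures on nonnegative vectors, so their joint
  transforms decide. These are given by \<open>jump_lists_laplace\<close> with the functions
  \<open>cutoff n x * exp (- (l j * x))\<close> and the argument \<open>1 + l k\<close> for the
  rest.\<close>

lemma mecke_cutoff:
  "distr (density (index_lists k \<Otimes>\<^sub>M M) (\<lambda>p. ennreal (\<Prod>j<Suc k. cutoff_weight n k j (jump_vector k (fst p) (snd p) j))))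
     (\<Pi>\<^sub>M j\<in>{..<Suc k}. borel) (\<lambda>(is, \<omega>). jump_vector k is \<omega>)
   = PiM {..<Suc k} (\<lambda>j. density (jump_law k j) (\<lambda>x. ennreal (cutoff_weight n k j x)))"
  (is "?\<Lambda> = PiM _ ?m")
proof (rule PiM_eqI_laplace)
  let ?w = "\<lambda>p. \<Prod>j<Suc k. cutoff_weight n k j (jump_vector k (fst p) (snd p) j)"
  have jv: "(\<lambda>p. jump_vector k (fst p) (snd p)) \<in> index_lists k \<Otimes>\<^sub>M M \<rightarrow>\<^sub>M (\<Pi>\<^sub>M j\<in>{..<Suc k}. borel)"
    using jump_vector_measurable[of k] by (simp add: case_prod_beta')
  have [measurable]: "(\<lambda>p. jump_vector k (fst p) (snd p) j) \<in> borel_measurable (index_lists k \<Otimes>\<^sub>M M)" if "j < Suc k" for j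
    using measurable_compose[OF jv measurable_component_singleton[of j]] that by simp
  have wm [measurable]: "?w \<in> borel_measurable (index_lists k \<Otimes>\<^sub>M M)"
    by (intro borel_measurable_prod measurable_compose[OF _ cutoff_weight_measurable]) simp
  have w0: "?w p \<ge> 0" for p using cutoff_weight_nonneg by (intro prod_nonneg) auto
  have lap: "(\<integral>\<^sup>+p. ennreal (?w p * (\<Prod>j<Suc k. exp (- (real (l j) * jump_vector k (fst p) (snd p) j)))) \<partial>(index_lists k \<Otimes>\<^sub>M M))
    = ennreal ((\<Prod>j<k. \<integral>x. cutoff n x * exp (- (real (l j) * \<bar>x\<bar>)) \<partial>levy) * exp (- ((1 + real (l k)) powr \<alpha>)))" for l
  proof -
    have "(\<integral>\<^sup>+p. ennreal (?w p * (\<Prod>j<Suc k. exp (- (real (l j) * jump_vector k (fst p) (snd p) j)))) \<partial>(index_lists k \<Otimes>\<^sub>M M))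
      = (\<integral>\<^sup>+\<omega>. \<integral>\<^sup>+is. ennreal (?w (is, \<omega>) * (\<Prod>j<Suc k. exp (- (real (l j) * jump_vector k is \<omega> j)))) \<partial>index_lists k \<partial>M)"
      by (subst nn_integral_lists) auto
    also have "\<dots> = (\<integral>\<^sup>+\<omega>. \<integral>\<^sup>+is. ennreal ((\<Prod>j<k. cutoff n (Z (is ! j) \<omega>) * exp (- (real (l j) * \<bar>Z (is ! j) \<omega>\<bar>)))
        * exp (- (1 + real (l k)) * (T \<omega> - (\<Sum>j<k. Z (is ! j) \<omega>)))) \<partial>index_lists k \<partial>M)"
      by (intro nn_integral_cong arg_cong[where f=ennreal])
        (simp add: jump_vector_simps cutoff_weight_def prod.distrib Z_nonneg exp_add[symmetric] algebra_simps)
    also have "\<dots> = ennreal ((\<Prod>j<k. \<integral>x. cutoff n x * exp (- (real (l j) * \<bar>x\<bar>)) \<partial>levy) * exp (- ((1 + real (l k)) powr \<alpha>)))"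
    proof (rule jump_lists_laplace[where a="1 / real (Suc n)" and b="real (Suc n)"])
      show "continuous_on UNIV (\<lambda>x. cutoff n x * exp (- (real (l j) * \<bar>x\<bar>)))" for j
        by (intro continuous_intros cutoff_continuous)
      show "cutoff n x * exp (- (real (l j) * \<bar>x\<bar>)) \<le> 1" for j x
        using cutoff_bounds[of n x] by (intro mult_le_one) auto
    qed (auto simp: cutoff_bounds cutoff_zero simp del: of_nat_Suc)
    finally show ?thesis .
  qed
  have fin_m: "finite_measure (?m j)" for j
  proof
    have "(\<integral>\<^sup>+x. ennreal (exp (- x)) \<partial>distr M borel T) \<le> (\<integral>\<^sup>+\<omega>. 1 \<partial>M)"
      by (subst nn_integral_distr, simp, simp, intro nn_integral_mono) (auto simp: T_nonneg)
    then have "(\<integral>\<^sup>+x. ennreal (cutoff_weight n k j x) \<partial>jump_law k j) < \<infinity>"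
      using levy_cutoff_finite[of n] by (auto simp: cutoff_weight_def jump_law_def emeasure_space_1 le_less_trans)
    then show "emeasure (?m j) (space (?m j)) \<noteq> \<infinity>"
      by (subst emeasure_density) (auto simp: jump_law_def cong: nn_integral_cong)
  qed
  then show "finite_measure (?m j)" for j .
  show "sets (?m j) = sets borel" for j by simp
  show "AE x in ?m j. x \<ge> 0" for j
  proof (cases "j < k")
    case True
    then have eq: "jump_law k j = levy" by (simp add: jump_law_def)
    have "AE x in levy. 0 < ennreal (cutoff_weight n k j x) \<longrightarrow> 0 \<le> x" using AE_levy by eventually_elim simp
    then show ?thesis unfolding eq by (subst AE_density) auto
  next
    case False
    then have eq: "jump_law k j = distr M borel T" by (simp add: jump_law_def)
    have "AE x in distr M borel T. 0 < ennreal (cutoff_weight n k j x) \<longrightarrow> 0 \<le> x"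
      by (subst AE_distr_iff) (auto simp: T_nonneg)
    then show ?thesis unfolding eq by (subst AE_density) auto
  qed
  show "finite_measure ?\<Lambda>"
  proof (rule finite_measure.finite_measure_distr)
    show "finite_measure (density (index_lists k \<Otimes>\<^sub>M M) (\<lambda>p. ennreal (?w p)))"
    proof
      show "emeasure (density (index_lists k \<Otimes>\<^sub>M M) (\<lambda>p. ennreal (?w p))) (space (density (index_lists k \<Otimes>\<^sub>M M) (\<lambda>p. ennreal (?w p)))) \<noteq> \<infinity>"
        using lap[of "\<lambda>_. 0"] by (subst emeasure_density) (auto cong: nn_integral_cong)
    qed
  qed simp
  show "AE x in ?\<Lambda>. x j \<ge> 0" if "j \<in> {..<Suc k}" for j
  proof -
    have "Measurable.pred (\<Pi>\<^sub>M j\<in>{..<Suc k}. borel) (\<lambda>x. x j \<ge> (0 :: real))" using that by measurable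
    then show ?thesis using that
      by (subst AE_distr_iff) (auto simp: AE_density pred_def space_pair_measure jump_vector_nonneg intro!: AE_I2)
  qed
  fix l :: "nat \<Rightarrow> nat"
  have [measurable]: "(\<lambda>x. \<Prod>j<Suc k. exp (- (real (l j) * x j))) \<in> borel_measurable (\<Pi>\<^sub>M j\<in>{..<Suc k}. borel)"
    by (intro borel_measurable_prod) simp
  have "(\<integral>x. (\<Prod>j<Suc k. exp (- (real (l j) * x j))) \<partial>?\<Lambda>)
    = enn2real (\<integral>\<^sup>+x. ennreal (\<Prod>j<Suc k. exp (- (real (l j) * x j))) \<partial>?\<Lambda>)"
    by (rule integral_eq_nn_integral) (auto intro!: AE_I2 prod_nonneg mult_nonneg_nonneg)
  also have "(\<integral>\<^sup>+x. ennreal (\<Prod>j<Suc k. exp (- (real (l j) * x j))) \<partial>?\<Lambda>)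
    = (\<integral>\<^sup>+p. ennreal (?w p * (\<Prod>j<Suc k. exp (- (real (l j) * jump_vector k (fst p) (snd p) j)))) \<partial>(index_lists k \<Otimes>\<^sub>M M))"
    using w0 by (subst nn_integral_distr, simp, simp, subst nn_integral_density)
      (auto simp: case_prod_beta' ennreal_mult' intro!: borel_measurable_prod)
  also note lap
  also have "enn2real (ennreal ((\<Prod>j<k. \<integral>x. cutoff n x * exp (- (real (l j) * \<bar>x\<bar>)) \<partial>levy) * exp (- ((1 + real (l k)) powr \<alpha>))))
    = (\<Prod>j<k. \<integral>x. cutoff n x * exp (- (real (l j) * \<bar>x\<bar>)) \<partial>levy) * exp (- ((1 + real (l k)) powr \<alpha>))"
    by (rule enn2real_ennreal) (auto intro!: mult_nonneg_nonneg prod_nonneg Bochner_Integration.integral_nonneg simp: cutoff_bounds)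
  also have "\<dots> = (\<Prod>j<Suc k. \<integral>x. exp (- (real (l j) * x)) \<partial>?m j)"
  proof -
    have "(\<integral>x. exp (- (real (l j) * x)) \<partial>?m j) = (\<integral>x. cutoff n x * exp (- (real (l j) * \<bar>x\<bar>)) \<partial>levy)" if "j < k" for j
    proof -
      have "(\<integral>x. exp (- (real (l j) * x)) \<partial>?m j) = (\<integral>x. cutoff n x * exp (- (real (l j) * x)) \<partial>levy)"
        using that by (subst integral_density) (auto simp: jump_law_def cutoff_weight_def cutoff_bounds)
      also have "\<dots> = (\<integral>x. cutoff n x * exp (- (real (l j) * \<bar>x\<bar>)) \<partial>levy)"
        by (intro integral_cong_AE) (use AE_levy in \<open>auto elim!: eventually_mono\<close>)
      finally show ?thesis .
    qed
    moreover have "(\<integral>x. exp (- (real (l k) * x)) \<partial>?m k) = exp (- ((1 + real (l k)) powr \<alpha>))"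
    proof -
      have "(\<integral>x. exp (- (real (l k) * x)) \<partial>?m k) = expectation (\<lambda>\<omega>. exp (- (1 + real (l k)) * T \<omega>))"
        by (subst integral_density)
          (auto simp: jump_law_def cutoff_weight_def integral_distr exp_add[symmetric] algebra_simps)
      then show ?thesis using laplace[of "1 + real (l k)"] by simp
    qed
    ultimately show ?thesis by simp
  qed
  finally show "(\<integral>x. (\<Prod>j<Suc k. exp (- (real (l j) * x j))) \<partial>?\<Lambda>) = (\<Prod>j<Suc k. \<integral>x. exp (- (real (l j) * x)) \<partial>?m j)" .
qed auto

text \<open>Passes from the finite weighted measures to arbitrary measurable functions.
  \<open>F0\<close> discards ranks that are 0: they are padding and no jumps, and the cutoffs
  increase only to the indicator of positive coordinates.\<close>

lemma mecke_vector:
  assumes F [measurable]: "F \<in> borel_measurable (\<Pi>\<^sub>M j\<in>{..<Suc k}. borel)"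
    and F0: "\<And>x j. j < k \<Longrightarrow> x j \<le> 0 \<Longrightarrow> F x = 0"
  shows "(\<integral>\<^sup>+\<omega>. \<integral>\<^sup>+is. F (jump_vector k is \<omega>) \<partial>index_lists k \<partial>M) = (\<integral>\<^sup>+x. F x \<partial>PiM {..<Suc k} (jump_law k))"
proof -
  interpret product_sigma_finite "jump_law k" by (rule product_sigma_finite_jump_law)
  have jv: "(\<lambda>p. jump_vector k (fst p) (snd p)) \<in> index_lists k \<Otimes>\<^sub>M M \<rightarrow>\<^sub>M (\<Pi>\<^sub>M j\<in>{..<Suc k}. borel)"
    using jump_vector_measurable[of k] by (simp add: case_prod_beta')
  define w where "w n x = ennreal (\<Prod>j<k. cutoff n (x j))" for n and x :: "nat \<Rightarrow> real"
  have comp: "(\<lambda>x. g (x j)) \<in> borel_measurable (\<Pi>\<^sub>M j\<in>{..<Suc k}. borel)"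
    if "g \<in> borel_measurable borel" "j < Suc k" for g :: "real \<Rightarrow> real" and j
    using that by (intro measurable_compose[OF measurable_component_singleton[of j "{..<Suc k}" "\<lambda>_. borel"]]) auto
  have wm [measurable]: "w n \<in> borel_measurable (\<Pi>\<^sub>M j\<in>{..<Suc k}. borel)" for n
    unfolding w_def by (intro measurable_compose[OF _ measurable_ennreal] borel_measurable_prod comp) auto
  have P: "measurable (PiM {..<Suc k} (jump_law k)) N = measurable (\<Pi>\<^sub>M j\<in>{..<Suc k}. borel) N" for N :: "ennreal measure"
    by (intro measurable_cong_sets sets_PiM_jump_law refl)
  have cut: "(\<integral>\<^sup>+p. w n (jump_vector k (fst p) (snd p)) * F (jump_vector k (fst p) (snd p)) \<partial>(index_lists k \<Otimes>\<^sub>M M))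
    = (\<integral>\<^sup>+x. w n x * F x \<partial>PiM {..<Suc k} (jump_law k))" for n
  proof -
    \<comment> \<open>Compensates the weight \<open>exp (- x k)\<close> of the last coordinate, so
      that only the cutoffs of the jumps remain.\<close>
    define G where "G x = F x * ennreal (exp (x k))" for x
    have [measurable]: "G \<in> borel_measurable (\<Pi>\<^sub>M j\<in>{..<Suc k}. borel)" unfolding G_def by measurable
    have split: "ennreal (\<Prod>j<Suc k. cutoff_weight n k j (x j)) * G x = w n x * F x" for x
    proof -
      have "(\<Prod>j<Suc k. cutoff_weight n k j (x j)) = (\<Prod>j<k. cutoff n (x j)) * exp (- x k)"
        by (simp add: cutoff_weight_def)
      then have "ennreal (\<Prod>j<Suc k. cutoff_weight n k j (x j)) * G x = w n x * F x * (ennreal (exp (- x k)) * ennreal (exp (x k)))"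
        unfolding G_def w_def by (simp add: ennreal_mult' ennreal_mult'' prod_nonneg cutoff_bounds mult_ac)
      also have "ennreal (exp (- x k)) * ennreal (exp (x k)) = 1" by (simp add: ennreal_mult'[symmetric] exp_add[symmetric] del: ennreal_mult')
      finally show ?thesis by simp
    qed
    have cwm: "(\<lambda>x. ennreal (\<Prod>j<Suc k. cutoff_weight n k j (x j))) \<in> borel_measurable (\<Pi>\<^sub>M j\<in>{..<Suc k}. borel)"
      by (intro measurable_compose[OF _ measurable_ennreal] borel_measurable_prod comp) auto
    let ?\<Lambda> = "distr (density (index_lists k \<Otimes>\<^sub>M M) (\<lambda>p. ennreal (\<Prod>j<Suc k. cutoff_weight n k j (jump_vector k (fst p) (snd p) j))))
      (\<Pi>\<^sub>M j\<in>{..<Suc k}. borel) (\<lambda>(is, \<omega>). jump_vector k is \<omega>)"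
    have "(\<integral>\<^sup>+x. G x \<partial>?\<Lambda>) = (\<integral>\<^sup>+p. w n (jump_vector k (fst p) (snd p)) * F (jump_vector k (fst p) (snd p)) \<partial>(index_lists k \<Otimes>\<^sub>M M))"
    proof -
      have "(\<integral>\<^sup>+x. G x \<partial>?\<Lambda>) = (\<integral>\<^sup>+p. G (jump_vector k (fst p) (snd p)) \<partial>density (index_lists k \<Otimes>\<^sub>M M) (\<lambda>p. ennreal (\<Prod>j<Suc k. cutoff_weight n k j (jump_vector k (fst p) (snd p) j))))"
        by (subst nn_integral_distr) (auto simp: case_prod_beta')
      also have "\<dots> = (\<integral>\<^sup>+p. ennreal (\<Prod>j<Suc k. cutoff_weight n k j (jump_vector k (fst p) (snd p) j)) * G (jump_vector k (fst p) (snd p)) \<partial>(index_lists k \<Otimes>\<^sub>M M))"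
        by (rule nn_integral_density[OF measurable_compose[OF jv cwm] measurable_compose[OF jv]]) measurable
      finally show ?thesis unfolding split .
    qed
    moreover have "(\<integral>\<^sup>+x. G x \<partial>?\<Lambda>) = (\<integral>\<^sup>+x. w n x * F x \<partial>PiM {..<Suc k} (jump_law k))"
    proof -
      have sf: "sigma_finite_measure (density (jump_law k j) (\<lambda>x. ennreal (cutoff_weight n k j x)))" for j
        by (subst sigma_finite_measure.sigma_finite_iff_density_finite'[OF sigma_finite_measures]) auto
      have "?\<Lambda> = density (PiM {..<Suc k} (jump_law k)) (\<lambda>x. \<Prod>j\<in>{..<Suc k}. ennreal (cutoff_weight n k j (x j)))"
        unfolding mecke_cutoff by (rule PiM_density[symmetric]) (auto intro: sf)
      also have "\<dots> = density (PiM {..<Suc k} (jump_law k)) (\<lambda>x. ennreal (\<Prod>j<Suc k. cutoff_weight n k j (x j)))"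
        by (simp only: prod_ennreal cutoff_weight_nonneg)
      finally have eq: "?\<Lambda> = \<dots>" .
      show ?thesis unfolding eq
        by (subst nn_integral_density) (use cwm in \<open>auto simp: P split simp del: prod.lessThan_Suc\<close>)
    qed
    ultimately show ?thesis by simp
  qed
  have w_mono: "w n x \<le> w m x" if "n \<le> m" for n m x
    unfolding w_def using cutoff_mono[OF that] by (intro ennreal_leI prod_mono) (auto simp: cutoff_bounds)
  have w_lim: "(\<lambda>n. w n x * F x) \<longlonglongrightarrow> F x" for x
  proof (cases "\<exists>j<k. x j \<le> 0")
    case True
    then have "F x = 0" using F0 by blast
    then show ?thesis by simp
  next
    case False
    have "\<forall>\<^sub>F n in sequentially. \<forall>j\<in>{..<k}. cutoff n (x j) = 1"
      using False by (intro eventually_ball_finite ballI cutoff_eventually) (auto simp: not_le)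
    then have "\<forall>\<^sub>F n in sequentially. w n x * F x = F x"
      by eventually_elim (simp add: w_def)
    then show ?thesis by (rule tendsto_eventually)
  qed
  have "(\<lambda>n. \<integral>\<^sup>+p. w n (jump_vector k (fst p) (snd p)) * F (jump_vector k (fst p) (snd p)) \<partial>(index_lists k \<Otimes>\<^sub>M M))
    \<longlonglongrightarrow> (\<integral>\<^sup>+p. F (jump_vector k (fst p) (snd p)) \<partial>(index_lists k \<Otimes>\<^sub>M M))"
  proof (rule nn_integral_LIMSEQ)
    show "(\<lambda>p. w n (jump_vector k (fst p) (snd p)) * F (jump_vector k (fst p) (snd p))) \<in> borel_measurable (index_lists k \<Otimes>\<^sub>M M)" for n
      by (intro borel_measurable_times_ennreal measurable_compose[OF jv] wm F)
  qed (auto simp: incseq_def le_fun_def w_lim intro!: mult_right_mono w_mono)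
  moreover have "(\<lambda>n. \<integral>\<^sup>+x. w n x * F x \<partial>PiM {..<Suc k} (jump_law k)) \<longlonglongrightarrow> (\<integral>\<^sup>+x. F x \<partial>PiM {..<Suc k} (jump_law k))"
    by (rule nn_integral_LIMSEQ) (auto simp: P incseq_def le_fun_def w_lim intro!: mult_right_mono w_mono)
  ultimately have "(\<integral>\<^sup>+p. F (jump_vector k (fst p) (snd p)) \<partial>(index_lists k \<Otimes>\<^sub>M M)) = (\<integral>\<^sup>+x. F x \<partial>PiM {..<Suc k} (jump_law k))"
    unfolding cut by (rule LIMSEQ_unique)
  then show ?thesis
    by (subst (asm) nn_integral_lists) (auto intro: measurable_compose[OF jv])
qed

text \<open>A Mecke formula in which the only functional of the remaining jumps is their sum.\<close>

lemma mecke: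
  assumes F [measurable]: "case_prod F \<in> borel_measurable ((\<Pi>\<^sub>M j\<in>{..<k}. borel) \<Otimes>\<^sub>M borel)"
    and F0: "\<And>x r j. j < k \<Longrightarrow> x j \<le> 0 \<Longrightarrow> F x r = 0"
  shows "(\<integral>\<^sup>+\<omega>. \<integral>\<^sup>+is. F (\<lambda>j\<in>{..<k}. Z (is ! j) \<omega>) (T \<omega> - (\<Sum>j<k. Z (is ! j) \<omega>)) \<partial>index_lists k \<partial>M)
    = (\<integral>\<^sup>+x. \<integral>\<^sup>+\<omega>. F x (T \<omega>) \<partial>M \<partial>(\<Pi>\<^sub>M j\<in>{..<k}. levy))"
proof -
  interpret product_sigma_finite "jump_law k" by (rule product_sigma_finite_jump_law)
  let ?G = "\<lambda>x. F (restrict x {..<k}) (x k)"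
  have G: "?G \<in> borel_measurable (\<Pi>\<^sub>M j\<in>{..<Suc k}. borel)"
  proof -
    have "(\<lambda>x. (restrict x {..<k}, x k)) \<in> (\<Pi>\<^sub>M j\<in>{..<Suc k}. borel) \<rightarrow>\<^sub>M (\<Pi>\<^sub>M j\<in>{..<k}. borel) \<Otimes>\<^sub>M borel"
      by (intro measurable_Pair measurable_restrict_subset measurable_component_singleton) auto
    from measurable_compose[OF this F] show ?thesis by simp
  qed
  have Gj: "?G \<in> borel_measurable (PiM (insert k {..<k}) (jump_law k))"
    using G unfolding lessThan_Suc[symmetric] by (subst measurable_cong_sets[OF sets_PiM_jump_law refl])
  have "(\<integral>\<^sup>+\<omega>. \<integral>\<^sup>+is. F (\<lambda>j\<in>{..<k}. Z (is ! j) \<omega>) (T \<omega> - (\<Sum>j<k. Z (is ! j) \<omega>)) \<partial>index_lists k \<partial>M)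
    = (\<integral>\<^sup>+\<omega>. \<integral>\<^sup>+is. ?G (jump_vector k is \<omega>) \<partial>index_lists k \<partial>M)"
    by (intro nn_integral_cong arg_cong2[where f=F]) (auto simp: jump_vector_def fun_eq_iff)
  also have "\<dots> = (\<integral>\<^sup>+x. ?G x \<partial>PiM {..<Suc k} (jump_law k))"
    by (rule mecke_vector[OF G]) (auto simp: F0)
  also have "\<dots> = (\<integral>\<^sup>+x. \<integral>\<^sup>+r. ?G (x(k := r)) \<partial>jump_law k k \<partial>PiM {..<k} (jump_law k))"
    unfolding lessThan_Suc by (rule product_nn_integral_insert[OF _ _ Gj]) auto
  also have "\<dots> = (\<integral>\<^sup>+x. \<integral>\<^sup>+\<omega>. F x (T \<omega>) \<partial>M \<partial>PiM {..<k} (jump_law k))"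
  proof (intro nn_integral_cong)
    fix x assume x: "x \<in> space (PiM {..<k} (jump_law k))"
    then have "restrict (x(k := r)) {..<k} = x" for r
      by (auto simp: space_PiM PiE_def extensional_def fun_eq_iff)
    then have "(\<integral>\<^sup>+r. ?G (x(k := r)) \<partial>jump_law k k) = (\<integral>\<^sup>+r. F x r \<partial>distr M borel T)"
      by (simp add: jump_law_def)
    also have "\<dots> = (\<integral>\<^sup>+\<omega>. F x (T \<omega>) \<partial>M)"
    proof (rule nn_integral_distr)
      have "x \<in> space (\<Pi>\<^sub>M j\<in>{..<k}. borel)" using x by (auto simp: space_PiM jump_law_def split: if_splits)
      from measurable_compose[OF measurable_Pair1'[OF this] F] show "F x \<in> borel_measurable (distr M borel T)" by simp
    qed simp
    finally show "(\<integral>\<^sup>+r. ?G (x(k := r)) \<partial>jump_law k k) = (\<integral>\<^sup>+\<omega>. F x (T \<omega>) \<partial>M)" .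
  qed
  also have "PiM {..<k} (jump_law k) = (\<Pi>\<^sub>M j\<in>{..<k}. levy)"
    by (intro PiM_cong) (auto simp: jump_law_def)
  finally show ?thesis .
qed

end

section \<open>Total jump mass and its moments\<close>

context stable_jumps
begin

lemma mecke_single:
  assumes F [measurable]: "case_prod F \<in> borel_measurable (borel \<Otimes>\<^sub>M borel)"
    and F0: "\<And>x r. x \<le> 0 \<Longrightarrow> F x r = 0"
  shows "(\<integral>\<^sup>+\<omega>. (\<Sum>i. F (Z i \<omega>) (T \<omega> - Z i \<omega>)) \<partial>M) = (\<integral>\<^sup>+x. \<integral>\<^sup>+\<omega>. F x (T \<omega>) \<partial>M \<partial>levy)"
proof -
  interpret product_sigma_finite "\<lambda>_::nat. levy" by (rule product_sigma_finite.intro) (rule sigma_finite_levy)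
  let ?F = "\<lambda>x r. F (x (0::nat)) r"
  have m0: "(\<lambda>x. x (0::nat)) \<in> borel_measurable (\<Pi>\<^sub>M j\<in>{..<1::nat}. borel :: real measure)"
    by (rule measurable_component_singleton) simp
  have "(\<integral>\<^sup>+\<omega>. (\<Sum>i. F (Z i \<omega>) (T \<omega> - Z i \<omega>)) \<partial>M)
    = (\<integral>\<^sup>+\<omega>. \<integral>\<^sup>+is. ?F (\<lambda>j\<in>{..<1}. Z (is ! j) \<omega>) (T \<omega> - (\<Sum>j<1. Z (is ! j) \<omega>)) \<partial>index_lists 1 \<partial>M)"
  proof (intro nn_integral_cong)
    fix \<omega>
    have "(\<integral>\<^sup>+is. ?F (\<lambda>j\<in>{..<1}. Z (is ! j) \<omega>) (T \<omega> - (\<Sum>j<1. Z (is ! j) \<omega>)) \<partial>index_lists 1)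
      = (\<integral>\<^sup>+i. ?F (\<lambda>j\<in>{..<1}. Z ([i] ! j) \<omega>) (T \<omega> - (\<Sum>j<1. Z ([i] ! j) \<omega>)) \<partial>count_space UNIV)"
      by (rule nn_integral_bij_count_space[OF distinct_lists_1, symmetric])
    then show "(\<Sum>i. F (Z i \<omega>) (T \<omega> - Z i \<omega>))
      = (\<integral>\<^sup>+is. ?F (\<lambda>j\<in>{..<1}. Z (is ! j) \<omega>) (T \<omega> - (\<Sum>j<1. Z (is ! j) \<omega>)) \<partial>index_lists 1)"
      by (simp add: nn_integral_count_space_nat)
  qed
  also have "\<dots> = (\<integral>\<^sup>+x. \<integral>\<^sup>+\<omega>. ?F x (T \<omega>) \<partial>M \<partial>(\<Pi>\<^sub>M j\<in>{..<1}. levy))"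
  proof (rule mecke)
    have "(\<lambda>p. (fst p (0::nat), snd p)) \<in> (\<Pi>\<^sub>M j\<in>{..<1::nat}. borel) \<Otimes>\<^sub>M borel \<rightarrow>\<^sub>M borel \<Otimes>\<^sub>M (borel :: real measure)"
      using m0 by (intro measurable_Pair measurable_compose[OF measurable_fst m0]) auto
    from measurable_compose[OF this F]
    show "(\<lambda>(x, r). ?F x r) \<in> borel_measurable ((\<Pi>\<^sub>M j\<in>{..<1::nat}. borel) \<Otimes>\<^sub>M borel)" by (simp add: case_prod_beta')
  qed (use F0 in auto)
  also have "\<dots> = (\<integral>\<^sup>+x. \<integral>\<^sup>+\<omega>. F (x 0) (T \<omega>) \<partial>M \<partial>(\<Pi>\<^sub>M j\<in>{0::nat}. levy))"
    by (simp add: lessThan_Suc)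
  also have "\<dots> = (\<integral>\<^sup>+x. \<integral>\<^sup>+\<omega>. F x (T \<omega>) \<partial>M \<partial>levy)"
  proof (rule product_nn_integral_singleton)
    have "(\<lambda>(x, \<omega>). F x (T \<omega>)) \<in> borel_measurable (borel \<Otimes>\<^sub>M M)" by measurable
    then show "(\<lambda>x. \<integral>\<^sup>+\<omega>. F x (T \<omega>) \<partial>M) \<in> borel_measurable levy"
      by (simp add: borel_measurable_nn_integral)
  qed
  finally show ?thesis .
qed

lemma laplace_nn: "l \<ge> 0 \<Longrightarrow> (\<integral>\<^sup>+\<omega>. ennreal (exp (- (l * T \<omega>))) \<partial>M) = ennreal (exp (- (l powr \<alpha>)))"
  using laplace[of l] T_nonneg
  by (subst nn_integral_eq_integral) (auto intro!: integrable_const_bound[where B=1])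

lemma sum_Z_exp:
  assumes l: "l > 0"
  shows "(\<integral>\<^sup>+\<omega>. (\<Sum>i. ennreal (Z i \<omega> * exp (- (l * T \<omega>)))) \<partial>M) = ennreal (\<alpha> * l powr (\<alpha> - 1) * exp (- (l powr \<alpha>)))"
proof -
  let ?F = "\<lambda>x r. ennreal (x * exp (- (l * x))) * ennreal (exp (- (l * r)))"
  have "(\<integral>\<^sup>+\<omega>. (\<Sum>i. ennreal (Z i \<omega> * exp (- (l * T \<omega>)))) \<partial>M) = (\<integral>\<^sup>+\<omega>. (\<Sum>i. ?F (Z i \<omega>) (T \<omega> - Z i \<omega>)) \<partial>M)"
    by (intro nn_integral_cong suminf_cong) (simp add: ennreal_mult''[symmetric] mult.assoc exp_add[symmetric] right_diff_distrib)
  also have "\<dots> = (\<integral>\<^sup>+x. \<integral>\<^sup>+\<omega>. ?F x (T \<omega>) \<partial>M \<partial>levy)"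
    by (rule mecke_single) (auto simp: mult_nonpos_nonneg ennreal_neg)
  also have "\<dots> = (\<integral>\<^sup>+x. ennreal (x * exp (- (l * x))) * ennreal (exp (- (l powr \<alpha>))) \<partial>levy)"
    using l by (intro nn_integral_cong) (simp add: nn_integral_cmult laplace_nn)
  also have "\<dots> = ennreal (\<alpha> * l powr (\<alpha> - 1)) * ennreal (exp (- (l powr \<alpha>)))"
    using l by (subst nn_integral_multc) (auto simp: levy_exp1)
  finally show ?thesis by (simp add: ennreal_mult'')
qed

lemma suminf_Z:
  assumes "\<omega> \<in> space M"
  shows "(\<Sum>i. ennreal (Z i \<omega>)) = ennreal (\<Sum>i. Z i \<omega>)" "(\<Sum>i. Z i \<omega>) \<le> T \<omega>" "summable (\<lambda>i. Z i \<omega>)"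
  using increasing_path.rank_summable[OF path[OF assms]] increasing_path.suminf_rank_le[OF path[OF assms]] Z_nonneg[OF assms]
  by (auto intro: suminf_ennreal2)

text \<open>\<open>T * exp (- T)\<close> is the limit of difference quotients of the Laplace
  transform at 1. Fatou's lemma gives one inequality, which is the one needed to exclude a
  drift.\<close>

lemma expectation_T_exp_le: "(\<integral>\<^sup>+\<omega>. ennreal (T \<omega> * exp (- T \<omega>)) \<partial>M) \<le> ennreal (\<alpha> * exp (- 1))"
proof -
  define f where "f n \<omega> = real (Suc n) * (exp (- (1 * T \<omega>)) - exp (- ((1 + 1 / real (Suc n)) * T \<omega>)))" for n \<omega>
  have [measurable]: "f n \<in> borel_measurable M" for n unfolding f_def by measurable
  have lim: "(\<lambda>n. f n \<omega>) \<longlonglongrightarrow> T \<omega> * exp (- T \<omega>)" for \<omega>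
    unfolding f_def by real_asymp
  have f0: "0 \<le> f n \<omega>" if "\<omega> \<in> space M" for n \<omega>
    unfolding f_def using mult_right_mono[of 1 "1 + 1 / real (Suc n)", OF _ T_nonneg[OF that]]
    by (intro mult_nonneg_nonneg) auto
  have int: "integrable M (\<lambda>\<omega>. exp (- (l * T \<omega>)))" if "l \<ge> 0" for l
    by (rule integrable_const_bound[where B=1]) (use that T_nonneg in auto)
  have Ef: "(\<integral>\<^sup>+\<omega>. ennreal (f n \<omega>) \<partial>M) = ennreal (real (Suc n) * (exp (- 1) - exp (- ((1 + 1 / real (Suc n)) powr \<alpha>))))" for n
  proof -
    have "integrable M (f n)" unfolding f_def by (intro integrable_mult_right Bochner_Integration.integrable_diff int) auto
    then have "(\<integral>\<^sup>+\<omega>. ennreal (f n \<omega>) \<partial>M) = ennreal (expectation (f n))"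
      using f0 by (intro nn_integral_eq_integral) auto
    also have "expectation (f n) = real (Suc n) * (expectation (\<lambda>\<omega>. exp (- (1 * T \<omega>))) - expectation (\<lambda>\<omega>. exp (- ((1 + 1 / real (Suc n)) * T \<omega>))))"
      unfolding f_def using int[of 1] int[of "1 + 1 / real (Suc n)"] by simp
    also have "\<dots> = real (Suc n) * (exp (- 1) - exp (- ((1 + 1 / real (Suc n)) powr \<alpha>)))"
    proof -
      have lap: "expectation (\<lambda>\<omega>. exp (- (l * T \<omega>))) = exp (- (l powr \<alpha>))" if "l \<ge> 0" for l
        using laplace[OF that] by simp
      have "0 \<le> 1 + 1 / real (Suc n)" by simp
      then show ?thesis by (simp only: lap[OF zero_le_one] lap powr_one_eq_one)
    qed
    finally show ?thesis .
  qed
  have "(\<integral>\<^sup>+\<omega>. ennreal (T \<omega> * exp (- T \<omega>)) \<partial>M) = (\<integral>\<^sup>+\<omega>. liminf (\<lambda>n. ennreal (f n \<omega>)) \<partial>M)"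
    by (intro nn_integral_cong lim_imp_Liminf[symmetric] tendsto_ennrealI lim) simp
  also have "\<dots> \<le> liminf (\<lambda>n. \<integral>\<^sup>+\<omega>. ennreal (f n \<omega>) \<partial>M)"
    by (rule nn_integral_liminf) simp
  also have "\<dots> = ennreal (\<alpha> * exp (- 1))"
    unfolding Ef by (intro lim_imp_Liminf tendsto_ennrealI) (simp, real_asymp)
  finally show ?thesis .
qed

text \<open>There is no drift: the jumps carry all of \<open>E (T exp (- T))\<close>.\<close>

lemma AE_pure_jump: "AE \<omega> in M. (\<Sum>i. Z i \<omega>) = T \<omega>"
proof -
  let ?S = "\<lambda>\<omega>. \<Sum>i. Z i \<omega>"
  have [measurable]: "?S \<in> borel_measurable M" by measurable
  have "(\<integral>\<^sup>+\<omega>. ennreal (?S \<omega> * exp (- T \<omega>)) \<partial>M) = (\<integral>\<^sup>+\<omega>. (\<Sum>i. ennreal (Z i \<omega> * exp (- (1 * T \<omega>)))) \<partial>M)"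
    by (intro nn_integral_cong)
      (simp add: ennreal_mult'' suminf_Z(1)[symmetric])
  also have "\<dots> = ennreal (\<alpha> * exp (- 1))" using sum_Z_exp[of 1] by simp
  finally have S: "(\<integral>\<^sup>+\<omega>. ennreal (?S \<omega> * exp (- T \<omega>)) \<partial>M) = ennreal (\<alpha> * exp (- 1))" .
  \<comment> \<open>Jump part and drift part are both nonnegative. The first already attains the
    upper bound for their sum, so the integral of the second is 0.\<close>
  have "(\<integral>\<^sup>+\<omega>. ennreal (?S \<omega> * exp (- T \<omega>)) \<partial>M) + (\<integral>\<^sup>+\<omega>. ennreal ((T \<omega> - ?S \<omega>) * exp (- T \<omega>)) \<partial>M)
    = (\<integral>\<^sup>+\<omega>. ennreal (T \<omega> * exp (- T \<omega>)) \<partial>M)"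
    by (subst nn_integral_add[symmetric], simp, simp, intro nn_integral_cong)
      (simp add: suminf_Z suminf_nonneg Z_nonneg ennreal_plus[symmetric] distrib_right[symmetric] del: ennreal_plus)
  then have "ennreal (\<alpha> * exp (- 1)) + (\<integral>\<^sup>+\<omega>. ennreal ((T \<omega> - ?S \<omega>) * exp (- T \<omega>)) \<partial>M) \<le> ennreal (\<alpha> * exp (- 1)) + 0"
    using expectation_T_exp_le unfolding S by simp
  then have "(\<integral>\<^sup>+\<omega>. ennreal ((T \<omega> - ?S \<omega>) * exp (- T \<omega>)) \<partial>M) = 0"
    by (subst (asm) ennreal_add_left_cancel_le) auto
  then have "AE \<omega> in M. ennreal ((T \<omega> - ?S \<omega>) * exp (- T \<omega>)) = 0"
    by (subst (asm) nn_integral_0_iff_AE) auto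
  then show ?thesis using AE_space
    by eventually_elim (use suminf_Z(2) in \<open>auto simp: ennreal_eq_0_iff mult_le_0_iff intro!: antisym\<close>)
qed

text \<open>The atom at 0 is at most every value of the Laplace transform, and these tend to 0 at
  infinity.\<close>

lemma AE_X_pos:
  assumes n: "n > 0"
  shows "AE \<omega> in M. X n c \<omega> > 0"
proof -
  have bound: "prob {\<omega> \<in> space M. X n c \<omega> = 0} \<le> exp (- (real m powr \<alpha>) / real n)" for m
  proof -
    have "prob {\<omega> \<in> space M. X n c \<omega> = 0} = expectation (indicator {\<omega> \<in> space M. X n c \<omega> = 0})" by simp
    also have "\<dots> \<le> expectation (\<lambda>\<omega>. exp (- real m * X n c \<omega>))"
    proof (rule integral_mono)
      show "integrable M (\<lambda>\<omega>. exp (- real m * X n c \<omega>))"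
        by (rule integrable_const_bound[where B=1]) (use X_nonneg in auto)
    qed (auto simp: indicator_def emeasure_eq_measure)
    also have "\<dots> = exp (- (real m powr \<alpha>) / real n)"
      using laplace_small[OF n, of "real m"] expectation_X[OF n, of "\<lambda>x. exp (- real m * x)"] by simp
    finally show ?thesis .
  qed
  have "(\<lambda>m. exp (- (real m powr \<alpha>) / real n)) \<longlonglongrightarrow> 0" using index n by real_asymp
  then have "prob {\<omega> \<in> space M. X n c \<omega> = 0} \<le> 0"
    by (rule LIMSEQ_le_const) (use bound in auto)
  then have "prob {\<omega> \<in> space M. X n c \<omega> = 0} = 0" by (simp add: measure_le_0_iff)
  then have "AE \<omega> in M. X n c \<omega> \<noteq> 0"
    by (subst (asm) prob_eq_0) (auto simp: eventually_mono)
  then show ?thesis using AE_space by eventually_elim (use X_nonneg in \<open>auto simp: order_less_le\<close>)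
qed

lemma AE_T_pos: "AE \<omega> in M. T \<omega> > 0"
  using AE_X_pos[of 1 0, OF zero_less_one] AE_space by eventually_elim (use sum_X[of _ 1] in auto)

lemma AE_Z_pos: "AE \<omega> in M. \<forall>i. Z i \<omega> > 0"
proof -
  have "AE \<omega> in M. \<forall>n c. n > 0 \<longrightarrow> X n c \<omega> > 0"
    unfolding AE_all_countable using AE_X_pos by auto
  then show ?thesis using AE_pure_jump AE_space
  proof eventually_elim
    case (elim \<omega>)
    show ?case
      by (intro allI increasing_path.rank_pos[OF path[OF elim(3)] elim(2)]) (use elim(1) in auto)
  qed
qed

section \<open>Moments of the total jump mass\<close>

lemma expectation_T_exp:
  assumes l: "l > 0"
  shows "(\<integral>\<^sup>+\<omega>. ennreal (T \<omega> * exp (- (l * T \<omega>))) \<partial>M) = ennreal (\<alpha> * l powr (\<alpha> - 1) * exp (- (l powr \<alpha>)))"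
proof -
  have "(\<integral>\<^sup>+\<omega>. ennreal (T \<omega> * exp (- (l * T \<omega>))) \<partial>M) = (\<integral>\<^sup>+\<omega>. (\<Sum>i. ennreal (Z i \<omega> * exp (- (l * T \<omega>)))) \<partial>M)"
  proof (intro nn_integral_cong_AE, use AE_pure_jump AE_space in eventually_elim)
    case (elim \<omega>)
    then show ?case by (simp add: ennreal_mult'' suminf_Z(1))
  qed
  then show ?thesis using sum_Z_exp[OF l] by simp
qed

text \<open>Both sides of \<open>moment_identity\<close> are multiples of this integral. Its value
  is \<open>Gamma (1 + q / \<alpha>) / \<alpha>\<close> for q > - \<alpha> and infinite otherwise,
  but only the common factor matters for the comparison.\<close>

definition moment_integral :: "real \<Rightarrow> ennreal"
  where "moment_integral q = (\<integral>\<^sup>+l. ennreal (indicator {0<..} l * l powr (q + \<alpha> - 1) * exp (- (l powr \<alpha>))) \<partial>lborel)"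

lemma powr_eq_Gamma_integral:
  assumes "p > 0" "t > 0"
  shows "ennreal (t powr (- p)) = ennreal (1 / Gamma p) * (\<integral>\<^sup>+l. ennreal (indicator {0<..} l * l powr (p - 1) * exp (- (t * l))) \<partial>lborel)"
proof -
  have "Gamma p > 0" by (rule Gamma_real_pos[OF assms(1)])
  then have "t powr (- p) = 1 / Gamma p * (Gamma p * t powr (- p))" "0 \<le> 1 / Gamma p" by simp_all
  then show ?thesis unfolding nn_integral_Gamma[OF assms] by (metis ennreal_mult')
qed

text \<open>For a single pick \<open>q = - \<gamma>\<close> is not positive, so
  \<open>T powr (- q)\<close> itself is no Gamma integral. Splitting off one factor \<open>T\<close>
  leaves the exponent \<open>q + 1 > 0\<close>, and that factor turns the transform into its
  derivative, \<open>expectation_T_exp\<close>.\<close>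

lemma T_moment:
  assumes q: "q > -1"
  shows "(\<integral>\<^sup>+\<omega>. ennreal (T \<omega> powr (- q)) \<partial>M) = ennreal (\<alpha> / Gamma (q + 1)) * moment_integral q"
proof -
  interpret pair_sigma_finite M lborel ..
  have G: "Gamma (q + 1) > 0" using q by (intro Gamma_real_pos) auto
  have "(\<integral>\<^sup>+\<omega>. ennreal (T \<omega> powr (- q)) \<partial>M) = (\<integral>\<^sup>+\<omega>. \<integral>\<^sup>+l. ennreal (1 / Gamma (q + 1)) *
    (ennreal (T \<omega>) * ennreal (indicator {0<..} l * l powr q * exp (- (T \<omega> * l)))) \<partial>lborel \<partial>M)"
  proof (intro nn_integral_cong_AE, use AE_T_pos in eventually_elim)
    case (elim \<omega>)
    have "T \<omega> powr (- q) = T \<omega> * T \<omega> powr (- (q + 1))" using elim powr_mult_base[of "T \<omega>" "- (q + 1)"] by simp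
    then have "ennreal (T \<omega> powr (- q)) = ennreal (T \<omega>) * ennreal (T \<omega> powr (- (q + 1)))" using elim by (simp add: ennreal_mult')
    also have "\<dots> = ennreal (T \<omega>) * (ennreal (1 / Gamma (q + 1)) * (\<integral>\<^sup>+l. ennreal (indicator {0<..} l * l powr q * exp (- (T \<omega> * l))) \<partial>lborel))"
      using powr_eq_Gamma_integral[of "q + 1" "T \<omega>"] q elim by simp
    finally show ?case by (simp add: nn_integral_cmult mult_ac)
  qed
  also have "\<dots> = (\<integral>\<^sup>+l. \<integral>\<^sup>+\<omega>. ennreal (1 / Gamma (q + 1)) *
    (ennreal (T \<omega>) * ennreal (indicator {0<..} l * l powr q * exp (- (T \<omega> * l)))) \<partial>M \<partial>lborel)"
    by (rule Fubini'[symmetric]) measurable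
  also have "\<dots> = (\<integral>\<^sup>+l. ennreal (\<alpha> / Gamma (q + 1)) * ennreal (indicator {0<..} l * l powr (q + \<alpha> - 1) * exp (- (l powr \<alpha>))) \<partial>lborel)"
  proof (intro nn_integral_cong)
    fix l :: real
    have "(\<integral>\<^sup>+\<omega>. ennreal (1 / Gamma (q + 1)) * (ennreal (T \<omega>) * ennreal (indicator {0<..} l * l powr q * exp (- (T \<omega> * l)))) \<partial>M)
      = (\<integral>\<^sup>+\<omega>. ennreal (1 / Gamma (q + 1) * indicator {0<..} l * l powr q) * ennreal (T \<omega> * exp (- (l * T \<omega>))) \<partial>M)"
      using G by (intro nn_integral_cong) (simp add: ennreal_mult''[symmetric] ennreal_mult'[symmetric] T_nonneg mult_ac)
    also have "\<dots> = ennreal (1 / Gamma (q + 1) * indicator {0<..} l * l powr q) * (\<integral>\<^sup>+\<omega>. ennreal (T \<omega> * exp (- (l * T \<omega>))) \<partial>M)"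
      by (rule nn_integral_cmult) simp
    also have "\<dots> = ennreal (\<alpha> / Gamma (q + 1)) * ennreal (indicator {0<..} l * l powr (q + \<alpha> - 1) * exp (- (l powr \<alpha>)))"
    proof (cases "l > 0")
      case True
      then have "l powr q * l powr (\<alpha> - 1) = l powr (q + \<alpha> - 1)" by (simp add: powr_add[symmetric] add_diff_eq)
      then show ?thesis using True G index
        by (simp add: expectation_T_exp ennreal_mult''[symmetric] mult_ac)
    qed simp
    finally show "(\<integral>\<^sup>+\<omega>. ennreal (1 / Gamma (q + 1)) * (ennreal (T \<omega>) * ennreal (indicator {0<..} l * l powr q * exp (- (T \<omega> * l)))) \<partial>M)
      = ennreal (\<alpha> / Gamma (q + 1)) * ennreal (indicator {0<..} l * l powr (q + \<alpha> - 1) * exp (- (l powr \<alpha>)))" .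
  qed
  also have "\<dots> = ennreal (\<alpha> / Gamma (q + 1)) * moment_integral q"
    unfolding moment_integral_def by (rule nn_integral_cmult) simp
  finally show ?thesis .
qed

text \<open>The Gamma integral of exponent \<open>q + 2\<close> turns the power of the sum
  \<open>T + y\<close> into a product of exponentials. The part in \<open>T\<close> integrates to
  its Laplace transform and the part in \<open>y\<close> to \<open>levy_exp2\<close>, leaving the
  integrand of \<open>moment_integral\<close>.\<close>

lemma T_levy_moment:
  assumes q: "q > -1"
  shows "(\<integral>\<^sup>+y. \<integral>\<^sup>+\<omega>. ennreal (y\<^sup>2 * (T \<omega> + y) powr (- q - 2)) \<partial>M \<partial>levy)
    = ennreal (\<alpha> * (1 - \<alpha>) / Gamma (q + 2)) * moment_integral q"
proof -
  interpret levy: sigma_finite_measure levy by (rule sigma_finite_levy)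
  interpret P: pair_sigma_finite M lborel ..
  interpret L: pair_sigma_finite levy lborel ..
  have G: "Gamma (q + 2) > 0" using q by (intro Gamma_real_pos) auto
  define c where "c l = 1 / Gamma (q + 2) * indicator {0<..} l * l powr (q + 1)" for l :: real
  have c0: "c l \<ge> 0" for l using G by (simp add: c_def)
  have [measurable]: "c \<in> borel_measurable borel" unfolding c_def by measurable
  have inner: "(\<integral>\<^sup>+\<omega>. ennreal (y\<^sup>2 * (T \<omega> + y) powr (- q - 2)) \<partial>M)
    = (\<integral>\<^sup>+l. ennreal (c l) * (ennreal (y\<^sup>2 * exp (- (l * y))) * ennreal (exp (- (l powr \<alpha>)))) \<partial>lborel)" if y: "y > 0" for y
  proof -
    have "(\<integral>\<^sup>+\<omega>. ennreal (y\<^sup>2 * (T \<omega> + y) powr (- q - 2)) \<partial>M)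
      = (\<integral>\<^sup>+\<omega>. \<integral>\<^sup>+l. ennreal (c l * y\<^sup>2 * exp (- (l * y))) * ennreal (exp (- (l * T \<omega>))) \<partial>lborel \<partial>M)"
    proof (intro nn_integral_cong)
      fix \<omega> assume "\<omega> \<in> space M"
      then have pos: "T \<omega> + y > 0" using y T_nonneg by (simp add: add_nonneg_pos)
      have "ennreal (y\<^sup>2 * (T \<omega> + y) powr (- q - 2)) = ennreal (y\<^sup>2) * ennreal ((T \<omega> + y) powr (- (q + 2)))"
        by (simp add: ennreal_mult')
      also have "\<dots> = ennreal (y\<^sup>2) * (ennreal (1 / Gamma (q + 2)) * (\<integral>\<^sup>+l. ennreal (indicator {0<..} l * l powr (q + 1) * exp (- ((T \<omega> + y) * l))) \<partial>lborel))"
      proof -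
        have e: "q + 2 - 1 = q + 1" and q2: "q + 2 > 0" using q by auto
        show ?thesis unfolding powr_eq_Gamma_integral[OF q2 pos] e ..
      qed
      also have "\<dots> = (\<integral>\<^sup>+l. ennreal (y\<^sup>2) * (ennreal (1 / Gamma (q + 2)) * ennreal (indicator {0<..} l * l powr (q + 1) * exp (- ((T \<omega> + y) * l)))) \<partial>lborel)"
        by (simp add: nn_integral_cmult)
      also have "\<dots> = (\<integral>\<^sup>+l. ennreal (c l * y\<^sup>2 * exp (- (l * y))) * ennreal (exp (- (l * T \<omega>))) \<partial>lborel)"
      proof (intro nn_integral_cong)
        fix l :: real
        have "exp (- ((T \<omega> + y) * l)) = exp (- (l * y)) * exp (- (l * T \<omega>))"
          by (simp add: exp_add[symmetric] algebra_simps)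
        then show "ennreal (y\<^sup>2) * (ennreal (1 / Gamma (q + 2)) * ennreal (indicator {0<..} l * l powr (q + 1) * exp (- ((T \<omega> + y) * l))))
          = ennreal (c l * y\<^sup>2 * exp (- (l * y))) * ennreal (exp (- (l * T \<omega>)))"
          using G by (simp add: ennreal_mult'[symmetric] ennreal_mult''[symmetric] c_def mult_ac)
      qed
      finally show "ennreal (y\<^sup>2 * (T \<omega> + y) powr (- q - 2))
        = (\<integral>\<^sup>+l. ennreal (c l * y\<^sup>2 * exp (- (l * y))) * ennreal (exp (- (l * T \<omega>))) \<partial>lborel)" .
    qed
    also have "\<dots> = (\<integral>\<^sup>+l. \<integral>\<^sup>+\<omega>. ennreal (c l * y\<^sup>2 * exp (- (l * y))) * ennreal (exp (- (l * T \<omega>))) \<partial>M \<partial>lborel)"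
      by (rule P.Fubini'[symmetric]) measurable
    also have "\<dots> = (\<integral>\<^sup>+l. ennreal (c l) * (ennreal (y\<^sup>2 * exp (- (l * y))) * ennreal (exp (- (l powr \<alpha>)))) \<partial>lborel)"
    proof (intro nn_integral_cong)
      fix l :: real
      show "(\<integral>\<^sup>+\<omega>. ennreal (c l * y\<^sup>2 * exp (- (l * y))) * ennreal (exp (- (l * T \<omega>))) \<partial>M)
        = ennreal (c l) * (ennreal (y\<^sup>2 * exp (- (l * y))) * ennreal (exp (- (l powr \<alpha>))))"
      proof (cases "l > 0")
        case True
        then show ?thesis using c0[of l]
          by (subst nn_integral_cmult) (auto simp: laplace_nn ennreal_mult'[symmetric] ennreal_mult''[symmetric] mult.assoc)
      qed (simp add: c_def)
    qed
    finally show ?thesis .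
  qed
  have "(\<integral>\<^sup>+y. \<integral>\<^sup>+\<omega>. ennreal (y\<^sup>2 * (T \<omega> + y) powr (- q - 2)) \<partial>M \<partial>levy)
    = (\<integral>\<^sup>+y. \<integral>\<^sup>+l. ennreal (c l) * (ennreal (y\<^sup>2 * exp (- (l * y))) * ennreal (exp (- (l powr \<alpha>)))) \<partial>lborel \<partial>levy)"
    by (intro nn_integral_cong_AE, use AE_levy in eventually_elim) (rule inner)
  also have "\<dots> = (\<integral>\<^sup>+l. \<integral>\<^sup>+y. ennreal (c l) * (ennreal (y\<^sup>2 * exp (- (l * y))) * ennreal (exp (- (l powr \<alpha>)))) \<partial>levy \<partial>lborel)"
    by (rule L.Fubini'[symmetric]) measurable
  also have "\<dots> = (\<integral>\<^sup>+l. ennreal (\<alpha> * (1 - \<alpha>) / Gamma (q + 2)) * ennreal (indicator {0<..} l * l powr (q + \<alpha> - 1) * exp (- (l powr \<alpha>))) \<partial>lborel)"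
  proof (intro nn_integral_cong)
    fix l :: real
    show "(\<integral>\<^sup>+y. ennreal (c l) * (ennreal (y\<^sup>2 * exp (- (l * y))) * ennreal (exp (- (l powr \<alpha>)))) \<partial>levy)
      = ennreal (\<alpha> * (1 - \<alpha>) / Gamma (q + 2)) * ennreal (indicator {0<..} l * l powr (q + \<alpha> - 1) * exp (- (l powr \<alpha>)))"
    proof (cases "l > 0")
      case True
      have "(\<integral>\<^sup>+y. ennreal (c l) * (ennreal (y\<^sup>2 * exp (- (l * y))) * ennreal (exp (- (l powr \<alpha>)))) \<partial>levy)
        = ennreal (c l) * (ennreal (\<alpha> * (1 - \<alpha>) * l powr (\<alpha> - 2)) * ennreal (exp (- (l powr \<alpha>))))"
        using True by (subst nn_integral_cmult, simp, subst nn_integral_multc) (auto simp: levy_exp2)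
      also have "\<dots> = ennreal (c l * (\<alpha> * (1 - \<alpha>) * l powr (\<alpha> - 2) * exp (- (l powr \<alpha>))))"
        using c0[of l] by (simp add: ennreal_mult'[symmetric] ennreal_mult''[symmetric])
      also have "c l * (\<alpha> * (1 - \<alpha>) * l powr (\<alpha> - 2) * exp (- (l powr \<alpha>)))
        = \<alpha> * (1 - \<alpha>) / Gamma (q + 2) * (indicator {0<..} l * l powr (q + \<alpha> - 1) * exp (- (l powr \<alpha>)))"
      proof -
        have "l powr (q + 1) * l powr (\<alpha> - 2) = l powr (q + \<alpha> - 1)" by (simp add: powr_add[symmetric] add_diff_eq)
        then show ?thesis using True by (simp add: c_def mult_ac)
      qed
      finally show ?thesis using index G by (simp add: ennreal_mult'[symmetric])
    qed (simp add: c_def)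
  qed
  also have "\<dots> = ennreal (\<alpha> * (1 - \<alpha>) / Gamma (q + 2)) * moment_integral q"
    unfolding moment_integral_def by (rule nn_integral_cmult) simp
  finally show ?thesis .
qed

text \<open>The constant is the quotient of \<open>\<alpha> * (1 - \<alpha>) / Gamma (q + 2)\<close>
  by \<open>\<alpha> / Gamma (q + 1)\<close>.\<close>

lemma moment_identity:
  assumes q: "q > -1"
  shows "(\<integral>\<^sup>+y. \<integral>\<^sup>+\<omega>. ennreal (y\<^sup>2 * (T \<omega> + y) powr (- q - 2)) \<partial>M \<partial>levy)
    = ennreal ((1 - \<alpha>) / (1 + q)) * (\<integral>\<^sup>+\<omega>. ennreal (T \<omega> powr (- q)) \<partial>M)"
proof -
  have G: "Gamma (q + 2) = (q + 1) * Gamma (q + 1)" "Gamma (q + 1) > 0"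
    using Gamma_plus1[of "q + 1"] q nonpos_Ints_nonpos[of "q + 1"] Gamma_real_pos[of "q + 1"] by (auto simp: add.assoc)
  have "\<alpha> * (1 - \<alpha>) / Gamma (q + 2) = (1 - \<alpha>) / (1 + q) * (\<alpha> / Gamma (q + 1))"
    using q G by (simp add: field_simps)
  then show ?thesis unfolding T_levy_moment[OF q] T_moment[OF q]
    using q index G(2) by (simp add: mult.assoc[symmetric] ennreal_mult''[symmetric])
qed

text \<open>By \<open>T_moment\<close> the question is whether \<open>moment_integral (- g)\<close>
  converges. At 0 its exponent \<alpha> - g - 1 exceeds -1 because g < \<alpha>, and at infinity the
  exponential dominates.\<close>

lemma T_moment_finite:
  assumes g: "0 \<le> g" "g < \<alpha>"
  shows "(\<integral>\<^sup>+\<omega>. ennreal (T \<omega> powr g) \<partial>M) < \<infinity>"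
proof -
  \<comment> \<open>With \<open>m * \<alpha> \<ge> 2\<close> the bound
    \<open>fact m * l powr (- (m * \<alpha>))\<close> for the exponential leaves the integrable tail
    \<open>l powr (- 2)\<close>.\<close>
  define m where "m = nat \<lceil>2 / \<alpha>\<rceil>"
  have "2 / \<alpha> \<le> real m" unfolding m_def by linarith
  then have m: "2 \<le> real m * \<alpha>" using index by (simp add: pos_divide_le_eq)
  have "moment_integral (- g)
    \<le> (\<integral>\<^sup>+l. ennreal (l powr (\<alpha> - g - 1)) * indicator {0..1} l + ennreal (fact m) * (ennreal (l powr (- 2)) * indicator {1..} l) \<partial>lborel)"
    unfolding moment_integral_def
  proof (intro nn_integral_mono)
    fix l :: real
    consider "l \<le> 0" | "0 < l" "l < 1" | "l \<ge> 1" by linarith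
    then show "ennreal (indicator {0<..} l * l powr (- g + \<alpha> - 1) * exp (- (l powr \<alpha>)))
      \<le> ennreal (l powr (\<alpha> - g - 1)) * indicator {0..1} l + ennreal (fact m) * (ennreal (l powr (- 2)) * indicator {1..} l)"
    proof cases
      case 2
      then show ?thesis by (auto intro!: ennreal_leI mult_left_le)
    next
      case 3
      have "(l powr \<alpha>) ^ m * exp (- 1 * l powr \<alpha>) \<le> fact m / 1 ^ m" by (rule power_exp_bounded) auto
      then have "l powr (real m * \<alpha>) * exp (- (l powr \<alpha>)) \<le> fact m"
        using 3 by (simp add: powr_realpow[symmetric] powr_powr mult.commute)
      then have "l powr (- g + \<alpha> - 1 - real m * \<alpha>) * (l powr (real m * \<alpha>) * exp (- (l powr \<alpha>))) \<le> l powr (- 2) * fact m"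
        using 3 m g index by (intro mult_mono powr_mono) auto
      moreover have "l powr (- g + \<alpha> - 1 - real m * \<alpha>) * l powr (real m * \<alpha>) = l powr (- g + \<alpha> - 1)"
        by (simp add: powr_add[symmetric])
      ultimately have "l powr (- g + \<alpha> - 1) * exp (- (l powr \<alpha>)) \<le> fact m * l powr (- 2)"
        unfolding mult.assoc[symmetric] by (simp only: mult.commute[of "fact m"])
      then have "ennreal (indicator {0<..} l * l powr (- g + \<alpha> - 1) * exp (- (l powr \<alpha>))) \<le> ennreal (fact m * l powr (- 2))"
        using 3 by (intro ennreal_leI) simp
      also have "\<dots> = ennreal (fact m) * (ennreal (l powr (- 2)) * indicator {1..} l)"
        using 3 by (simp add: ennreal_mult')
      also have "\<dots> \<le> ennreal (l powr (\<alpha> - g - 1)) * indicator {0..1} l + \<dots>" by simp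
      finally show ?thesis .
    qed auto
  qed
  also have "\<dots> = (\<integral>\<^sup>+l. ennreal (l powr (\<alpha> - g - 1)) * indicator {0..1} l \<partial>lborel)
      + ennreal (fact m) * (\<integral>\<^sup>+l. ennreal (l powr (- 2)) * indicator {1..} l \<partial>lborel)"
    by (subst nn_integral_add) (auto simp: nn_integral_cmult)
  also have "(\<integral>\<^sup>+l. ennreal (l powr (\<alpha> - g - 1)) * indicator {0..1} l \<partial>lborel) = ennreal (1 powr (\<alpha> - g - 1 + 1) / (\<alpha> - g - 1 + 1))"
    using g by (intro nn_integral_has_integral_lebesgue' has_integral_powr_from_0) auto
  also have "(\<integral>\<^sup>+l. ennreal (l powr (- 2)) * indicator {1..} l \<partial>lborel) = ennreal (- (1 powr (- 2 + 1)) / (- 2 + 1 :: real))"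
    by (intro nn_integral_has_integral_lebesgue' has_integral_powr_to_inf) auto
  finally have "moment_integral (- g) < \<infinity>" by (simp add: le_less_trans ennreal_mult_less_top)
  then show ?thesis using T_moment[of "- g"] g index by (simp add: ennreal_mult_less_top)
qed

section \<open>Scaling, and the squares of the unsampled jumps\<close>

lemma PiM_levy_scale:
  assumes r: "r > 0" and F: "F \<in> borel_measurable (\<Pi>\<^sub>M j\<in>{..<k}. borel)"
  shows "(\<integral>\<^sup>+x. F x \<partial>(\<Pi>\<^sub>M j\<in>{..<k}. levy)) = ennreal (r powr (- (real k * \<alpha>))) * (\<integral>\<^sup>+x. F (\<lambda>j\<in>{..<k}. r * x j) \<partial>(\<Pi>\<^sub>M j\<in>{..<k}. levy))"
  using F
proof (induction k arbitrary: F)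
  case 0
  interpret product_sigma_finite "\<lambda>_::nat. levy" by (rule product_sigma_finite.intro) (rule sigma_finite_levy)
  show ?case using r by (simp add: nn_integral_empty restrict_def space_PiM_empty)
next
  case (Suc k)
  interpret levy: sigma_finite_measure levy by (rule sigma_finite_levy)
  interpret product_sigma_finite "\<lambda>_::nat. levy" by (rule product_sigma_finite.intro) (rule sigma_finite_levy)
  have sets: "sets (\<Pi>\<^sub>M j\<in>J. levy) = sets (\<Pi>\<^sub>M j\<in>J. borel)" for J :: "nat set" by (intro sets_PiM_cong) auto
  have F' [measurable]: "F \<in> borel_measurable (\<Pi>\<^sub>M j\<in>insert k {..<k}. borel)" using Suc.prems by (simp add: lessThan_Suc)
  have Fl: "F \<in> borel_measurable (\<Pi>\<^sub>M j\<in>insert k {..<k}. levy)"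
    using F' by (subst measurable_cong_sets[OF sets refl])
  have up: "(\<lambda>(x, y). F (x(k := y))) \<in> borel_measurable ((\<Pi>\<^sub>M j\<in>{..<k}. borel) \<Otimes>\<^sub>M borel)"
    using measurable_compose[OF measurable_add_dim F'] by (simp add: case_prod_beta')
  have scale_meas: "(\<lambda>x. \<lambda>j\<in>{..<k}. r * x j) \<in> (\<Pi>\<^sub>M j\<in>{..<k}. borel) \<rightarrow>\<^sub>M (\<Pi>\<^sub>M j\<in>{..<k}. borel)"
    by (intro measurable_restrict borel_measurable_times measurable_component_singleton) auto
  define H where "H x = (\<integral>\<^sup>+y. F (x(k := r * y)) \<partial>levy)" for x
  have H: "H \<in> borel_measurable (\<Pi>\<^sub>M j\<in>{..<k}. borel)"
  proof -
    have "(\<lambda>p. F ((fst p)(k := r * snd p))) \<in> borel_measurable ((\<Pi>\<^sub>M j\<in>{..<k}. borel) \<Otimes>\<^sub>M borel)"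
      using measurable_compose[of "\<lambda>p. (fst p, r * snd p)" "(\<Pi>\<^sub>M j\<in>{..<k}. borel) \<Otimes>\<^sub>M borel", OF _ up] by simp
    then have "case_prod (\<lambda>x y. F (x(k := r * y))) \<in> borel_measurable ((\<Pi>\<^sub>M j\<in>{..<k}. borel) \<Otimes>\<^sub>M levy)"
      by (subst measurable_cong_sets[OF sets_pair_measure_cong refl]) (auto simp: case_prod_beta')
    then show ?thesis unfolding H_def by (rule levy.borel_measurable_nn_integral)
  qed
  have meas1: "(\<lambda>y. F (x(k := y))) \<in> borel_measurable borel" if "x \<in> space (\<Pi>\<^sub>M j\<in>{..<k}. levy)" for x
  proof -
    have "x \<in> space (\<Pi>\<^sub>M j\<in>{..<k}. borel)" using that by (simp add: space_PiM)
    from measurable_compose[OF measurable_Pair1'[OF this] up] show ?thesis by simp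
  qed
  have "(\<integral>\<^sup>+x. F x \<partial>(\<Pi>\<^sub>M j\<in>{..<Suc k}. levy)) = (\<integral>\<^sup>+x. \<integral>\<^sup>+y. F (x(k := y)) \<partial>levy \<partial>(\<Pi>\<^sub>M j\<in>{..<k}. levy))"
    unfolding lessThan_Suc by (rule product_nn_integral_insert[OF _ _ Fl]) auto
  also have "\<dots> = (\<integral>\<^sup>+x. ennreal (r powr (- \<alpha>)) * H x \<partial>(\<Pi>\<^sub>M j\<in>{..<k}. levy))"
    unfolding H_def using r meas1 by (intro nn_integral_cong levy_scale) auto
  also have "\<dots> = ennreal (r powr (- \<alpha>)) * (\<integral>\<^sup>+x. H x \<partial>(\<Pi>\<^sub>M j\<in>{..<k}. levy))"
    using H by (intro nn_integral_cmult) (subst measurable_cong_sets[OF sets refl])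
  also have "(\<integral>\<^sup>+x. H x \<partial>(\<Pi>\<^sub>M j\<in>{..<k}. levy)) = ennreal (r powr (- (real k * \<alpha>))) * (\<integral>\<^sup>+x. H (\<lambda>j\<in>{..<k}. r * x j) \<partial>(\<Pi>\<^sub>M j\<in>{..<k}. levy))"
    by (rule Suc.IH[OF H])
  also have "(\<integral>\<^sup>+x. H (\<lambda>j\<in>{..<k}. r * x j) \<partial>(\<Pi>\<^sub>M j\<in>{..<k}. levy))
    = (\<integral>\<^sup>+x. \<integral>\<^sup>+y. F (\<lambda>j\<in>{..<Suc k}. r * (x(k := y)) j) \<partial>levy \<partial>(\<Pi>\<^sub>M j\<in>{..<k}. levy))"
    unfolding H_def by (intro nn_integral_cong arg_cong[where f=F]) (auto simp: fun_eq_iff)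
  also have "\<dots> = (\<integral>\<^sup>+x. F (\<lambda>j\<in>{..<Suc k}. r * x j) \<partial>(\<Pi>\<^sub>M j\<in>{..<Suc k}. levy))"
    unfolding lessThan_Suc
  proof (rule product_nn_integral_insert[symmetric])
    have "(\<lambda>x. \<lambda>j\<in>insert k {..<k}. r * x j) \<in> (\<Pi>\<^sub>M j\<in>insert k {..<k}. borel) \<rightarrow>\<^sub>M (\<Pi>\<^sub>M j\<in>insert k {..<k}. borel)"
      by (intro measurable_restrict borel_measurable_times measurable_component_singleton) auto
    from measurable_compose[OF this F']
    show "(\<lambda>x. F (\<lambda>j\<in>insert k {..<k}. r * x j)) \<in> borel_measurable (\<Pi>\<^sub>M j\<in>insert k {..<k}. levy)"
      by (subst measurable_cong_sets[OF sets refl])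
  qed auto
  also have "ennreal (r powr (- \<alpha>)) * (ennreal (r powr (- (real k * \<alpha>))) * I) = ennreal (r powr (- (real (Suc k) * \<alpha>))) * I" for I
    by (simp add: mult.assoc[symmetric] ennreal_mult''[symmetric] powr_add[symmetric] algebra_simps)
  finally show ?case .
qed

end

text \<open>A list of \<open>k + 1\<close> distinct indices is a list of \<open>k\<close> together
  with one index off it. A sum over the unsampled jumps thereby becomes an instance of the Mecke
  formula for \<open>k + 1\<close> jumps.\<close>

lemma nn_integral_distinct_lists_Suc:
  fixes h :: "nat list \<Rightarrow> ennreal"
  shows "(\<integral>\<^sup>+is. h is \<partial>count_space (distinct_lists (Suc k) UNIV))
    = (\<integral>\<^sup>+is. (\<Sum>i. h (is @ [i]) * indicator (- set is) i) \<partial>count_space (distinct_lists k UNIV))"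
proof -
  let ?D = "distinct_lists k (UNIV :: nat set)"
  let ?P = "Sigma ?D (\<lambda>is. - set is)"
  have bij: "bij_betw (\<lambda>(is, i). is @ [i]) ?P (distinct_lists (Suc k) UNIV)"
    unfolding bij_betw_def
  proof
    show "inj_on (\<lambda>(is, i). is @ [i]) ?P" by (auto simp: inj_on_def)
    show "(\<lambda>(is, i). is @ [i]) ` ?P = distinct_lists (Suc k) UNIV"
    proof (intro equalityI subsetI)
      fix xs assume xs: "xs \<in> distinct_lists (Suc k) (UNIV :: nat set)"
      then obtain ys y where y: "xs = ys @ [y]" by (cases xs rule: rev_cases) (auto simp: distinct_lists_def)
      then have "(ys, y) \<in> ?P" using xs by (auto simp: distinct_lists_def)
      then show "xs \<in> (\<lambda>(is, i). is @ [i]) ` ?P" using y by force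
    qed (auto simp: distinct_lists_def)
  qed
  have "(\<integral>\<^sup>+is. h is \<partial>count_space (distinct_lists (Suc k) UNIV)) = (\<integral>\<^sup>+p. h (case p of (is, i) \<Rightarrow> is @ [i]) \<partial>count_space ?P)"
    by (rule nn_integral_bij_count_space[OF bij, symmetric])
  also have "\<dots> = (\<integral>\<^sup>+p. (case p of (is, i) \<Rightarrow> h (is @ [i]) * indicator (- set is) i * indicator ?D is) \<partial>count_space UNIV)"
    by (subst nn_integral_count_space_indicator) (auto intro!: nn_integral_cong simp: indicator_def)
  also have "\<dots> = (\<integral>\<^sup>+is. \<integral>\<^sup>+i. h (is @ [i]) * indicator (- set is) i * indicator ?D is \<partial>count_space UNIV \<partial>count_space UNIV)"
    by (subst nn_integral_fst_count_space[symmetric]) simp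
  also have "\<dots> = (\<integral>\<^sup>+is. (\<Sum>i. h (is @ [i]) * indicator (- set is) i) * indicator ?D is \<partial>count_space UNIV)"
    by (simp add: nn_integral_multc nn_integral_count_space_nat)
  also have "\<dots> = (\<integral>\<^sup>+is. (\<Sum>i. h (is @ [i]) * indicator (- set is) i) \<partial>count_space ?D)"
    by (subst nn_integral_count_space_indicator) auto
  finally show ?thesis .
qed

context stable_jumps
begin

definition positive_vectors :: "nat \<Rightarrow> (nat \<Rightarrow> real) set"
  where "positive_vectors k = {x. \<forall>j<k. x j > 0}"

text \<open>The common part of the two Mecke integrands: \<open>x\<close> are the sampled jumps and \<open>r\<close> is the sum of
  all other ones.\<close>

definition kernel :: "nat \<Rightarrow> real \<Rightarrow> ((nat \<Rightarrow> real) \<Rightarrow> ennreal) \<Rightarrow> (nat \<Rightarrow> real) \<Rightarrow> real \<Rightarrow> ennreal"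
  where "kernel k \<theta> G x r = indicator (positive_vectors k) x * ennreal ((r + (\<Sum>j<k. x j)) powr (- \<theta> - 2))
    * G (\<lambda>j\<in>{..<k}. x j / (r + (\<Sum>j<k. x j)))"

lemma kernel_measurable:
  assumes G: "G \<in> borel_measurable (\<Pi>\<^sub>M j\<in>{..<k}. borel)"
  shows "case_prod (kernel k \<theta> G) \<in> borel_measurable ((\<Pi>\<^sub>M j\<in>{..<k}. borel) \<Otimes>\<^sub>M borel)"
proof -
  let ?P = "(\<Pi>\<^sub>M j\<in>{..<k}. borel :: real measure) \<Otimes>\<^sub>M (borel :: real measure)"
  have [measurable]: "(\<lambda>p. fst p j) \<in> borel_measurable ?P" if "j \<in> {..<k}" for j
    by (rule measurable_compose[OF measurable_fst measurable_component_singleton[OF that]])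
  have s [measurable]: "(\<lambda>p. snd p + (\<Sum>j<k. fst p j)) \<in> borel_measurable ?P" by measurable
  have ind: "(\<lambda>p. indicator (positive_vectors k) (fst p) :: ennreal) \<in> borel_measurable ?P"
  proof -
    have "{p \<in> space ?P. \<forall>j\<in>{..<k}. fst p j > 0} \<in> sets ?P"
      by (rule sets.sets_Collect_finite_All) (auto intro!: borel_measurable_less)
    then have "(\<lambda>p. indicator {p \<in> space ?P. \<forall>j\<in>{..<k}. fst p j > 0} p :: ennreal) \<in> borel_measurable ?P"
      by (rule borel_measurable_indicator)
    then show ?thesis
      by (rule measurable_cong[THEN iffD1, rotated]) (auto simp: indicator_def positive_vectors_def)
  qed
  have "(\<lambda>p. \<lambda>j\<in>{..<k}. fst p j / (snd p + (\<Sum>j<k. fst p j))) \<in> ?P \<rightarrow>\<^sub>M (\<Pi>\<^sub>M j\<in>{..<k}. borel)"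
    by (rule measurable_restrict) measurable
  note Gm = measurable_compose[OF this G]
  have "(\<lambda>p. ennreal ((snd p + (\<Sum>j<k. fst p j)) powr (- \<theta> - 2))) \<in> borel_measurable ?P" by measurable
  then show ?thesis unfolding kernel_def case_prod_beta'
    by (intro borel_measurable_times_ennreal ind Gm)
qed

lemma sets_PiM_levy: "sets (\<Pi>\<^sub>M j\<in>J. levy) = sets (\<Pi>\<^sub>M j\<in>J. borel)"
  by (intro sets_PiM_cong) auto

text \<open>After scaling the sampled jumps by \<open>R\<close> their ratios to the total are free
  of \<open>R\<close>. The power of the total contributes \<open>R powr (- \<theta> - 2)\<close>,
  the Levy measures \<open>R powr (- \<alpha>)\<close> each. This separates the sampled jumps from
  the size of the rest.\<close>

lemma kernel_scale:
  assumes G: "G \<in> borel_measurable (\<Pi>\<^sub>M j\<in>{..<k}. borel)" and R: "R > 0"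
  shows "(\<integral>\<^sup>+x. kernel k \<theta> G x R \<partial>(\<Pi>\<^sub>M j\<in>{..<k}. levy))
    = ennreal (R powr (- (real k * \<alpha> + \<theta>) - 2)) * (\<integral>\<^sup>+x. kernel k \<theta> G x 1 \<partial>(\<Pi>\<^sub>M j\<in>{..<k}. levy))"
proof -
  have m: "(\<lambda>x. kernel k \<theta> G x r) \<in> borel_measurable (\<Pi>\<^sub>M j\<in>{..<k}. borel)" for r
    using measurable_compose[OF measurable_Pair2' kernel_measurable[OF G]] by simp
  have "(\<integral>\<^sup>+x. kernel k \<theta> G x R \<partial>(\<Pi>\<^sub>M j\<in>{..<k}. levy))
    = ennreal (R powr (- (real k * \<alpha>))) * (\<integral>\<^sup>+x. kernel k \<theta> G (\<lambda>j\<in>{..<k}. R * x j) R \<partial>(\<Pi>\<^sub>M j\<in>{..<k}. levy))"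
    by (rule PiM_levy_scale[OF R m])
  also have "(\<integral>\<^sup>+x. kernel k \<theta> G (\<lambda>j\<in>{..<k}. R * x j) R \<partial>(\<Pi>\<^sub>M j\<in>{..<k}. levy))
    = (\<integral>\<^sup>+x. ennreal (R powr (- \<theta> - 2)) * kernel k \<theta> G x 1 \<partial>(\<Pi>\<^sub>M j\<in>{..<k}. levy))"
  proof (intro nn_integral_cong)
    fix x :: "nat \<Rightarrow> real"
    show "kernel k \<theta> G (\<lambda>j\<in>{..<k}. R * x j) R = ennreal (R powr (- \<theta> - 2)) * kernel k \<theta> G x 1"
    proof (cases "x \<in> positive_vectors k")
      case True
      then have s: "1 + (\<Sum>j<k. x j) > 0" by (intro add_pos_nonneg sum_nonneg) (auto simp: positive_vectors_def intro: less_imp_le)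
      have e: "R + (\<Sum>j<k. R * x j) = R * (1 + (\<Sum>j<k. x j))" by (simp add: sum_distrib_left distrib_left)
      have "(\<lambda>j\<in>{..<k}. (\<lambda>j\<in>{..<k}. R * x j) j / (R + (\<Sum>j<k. (\<lambda>j\<in>{..<k}. R * x j) j)))
        = (\<lambda>j\<in>{..<k}. x j / (1 + (\<Sum>j<k. x j)))"
        using R s by (auto simp: fun_eq_iff e)
      moreover have "(\<lambda>j\<in>{..<k}. R * x j) \<in> positive_vectors k" using True R by (auto simp: positive_vectors_def)
      ultimately show ?thesis using True R s
        by (simp add: kernel_def e powr_mult ennreal_mult'' mult.assoc)
    next
      case False
      then have "(\<lambda>j\<in>{..<k}. R * x j) \<notin> positive_vectors k"
        using R by (auto simp: positive_vectors_def zero_less_mult_iff)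
      then show ?thesis using False by (simp add: kernel_def)
    qed
  qed
  also have "\<dots> = ennreal (R powr (- \<theta> - 2)) * (\<integral>\<^sup>+x. kernel k \<theta> G x 1 \<partial>(\<Pi>\<^sub>M j\<in>{..<k}. levy))"
    using m by (intro nn_integral_cmult) (subst measurable_cong_sets[OF sets_PiM_levy refl])
  also have "ennreal (R powr (- (real k * \<alpha>))) * (ennreal (R powr (- \<theta> - 2)) * I) = ennreal (R powr (- (real k * \<alpha> + \<theta>) - 2)) * I" for I
  proof -
    have "R powr (- (real k * \<alpha>)) * R powr (- \<theta> - 2) = R powr (- (real k * \<alpha> + \<theta>) - 2)"
      by (simp add: powr_add[symmetric] algebra_simps)
    then show ?thesis by (simp add: mult.assoc[symmetric] ennreal_mult''[symmetric])
  qed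
  finally show ?thesis .
qed

abbreviation ratios :: "nat \<Rightarrow> nat list \<Rightarrow> 'a \<Rightarrow> nat \<Rightarrow> real"
  where "ratios k is \<omega> \<equiv> (\<lambda>j\<in>{..<k}. Z (is ! j) \<omega> / T \<omega>)"

lemma ennreal_mult_between: "0 \<le> b \<Longrightarrow> ennreal a * g * ennreal b = ennreal (a * b) * g"
  by (simp add: ennreal_mult'' mult_ac)

lemma powr_minus_two_mult_square:
  "s > 0 \<Longrightarrow> s powr (- t - 2) * y\<^sup>2 = s powr (- t) * (y / s)\<^sup>2" for s t y :: real
  by (simp add: powr_diff power_divide powr_numeral)

text \<open>The squared rest ratio is \<open>r\<^sup>2\<close> over the squared total; the latter is
  the reason for the \<open>- 2\<close> in \<open>kernel\<close>. Mecke's formula makes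
  \<open>r\<close> a copy of \<open>T\<close>, and scaling by it leaves a moment of \<open>T\<close>
  times an integral that depends only on \<open>G\<close>.\<close>

lemma sampled_square_of_rest:
  assumes G: "G \<in> borel_measurable (\<Pi>\<^sub>M j\<in>{..<k}. borel)"
  shows "(\<integral>\<^sup>+\<omega>. \<integral>\<^sup>+is. ennreal (T \<omega> powr (- \<theta>)) * G (ratios k is \<omega>) * ennreal ((1 - (\<Sum>j<k. ratios k is \<omega> j))\<^sup>2) \<partial>index_lists k \<partial>M)
    = (\<integral>\<^sup>+\<omega>. ennreal (T \<omega> powr (- (real k * \<alpha> + \<theta>))) \<partial>M) * (\<integral>\<^sup>+x. kernel k \<theta> G x 1 \<partial>(\<Pi>\<^sub>M j\<in>{..<k}. levy))"
proof -
  interpret product_sigma_finite "\<lambda>_::nat. levy" by (rule product_sigma_finite.intro) (rule sigma_finite_levy)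
  interpret PL: sigma_finite_measure "\<Pi>\<^sub>M j\<in>{..<k}. levy" by (rule sigma_finite) simp
  interpret P: pair_sigma_finite "\<Pi>\<^sub>M j\<in>{..<k}. levy" M ..
  let ?F = "\<lambda>x r. kernel k \<theta> G x r * ennreal (r\<^sup>2)"
  have Fm: "case_prod ?F \<in> borel_measurable ((\<Pi>\<^sub>M j\<in>{..<k}. borel) \<Otimes>\<^sub>M borel)"
    using kernel_measurable[OF G, of \<theta>] unfolding case_prod_beta' by measurable
  have "(\<integral>\<^sup>+\<omega>. \<integral>\<^sup>+is. ennreal (T \<omega> powr (- \<theta>)) * G (ratios k is \<omega>) * ennreal ((1 - (\<Sum>j<k. ratios k is \<omega> j))\<^sup>2) \<partial>index_lists k \<partial>M)
    = (\<integral>\<^sup>+\<omega>. \<integral>\<^sup>+is. ?F (\<lambda>j\<in>{..<k}. Z (is ! j) \<omega>) (T \<omega> - (\<Sum>j<k. Z (is ! j) \<omega>)) \<partial>index_lists k \<partial>M)"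
  proof (intro nn_integral_cong_AE, use AE_Z_pos AE_T_pos in eventually_elim)
    case (elim \<omega>)
    show ?case
    proof (intro nn_integral_cong)
      fix "is"
      let ?s = "\<Sum>j<k. Z (is ! j) \<omega>"
      have "(\<lambda>j\<in>{..<k}. Z (is ! j) \<omega>) \<in> positive_vectors k" using elim(1) by (auto simp: positive_vectors_def)
      moreover have "T \<omega> powr (- \<theta> - 2) * (T \<omega> - ?s)\<^sup>2 = T \<omega> powr (- \<theta>) * (1 - (\<Sum>j<k. ratios k is \<omega> j))\<^sup>2"
        using powr_minus_two_mult_square[OF elim(2), of \<theta> "T \<omega> - ?s"] elim(2)
        by (simp add: diff_divide_distrib sum_divide_distrib)
      moreover have "(\<lambda>j\<in>{..<k}. (\<lambda>j\<in>{..<k}. Z (is ! j) \<omega>) j / (T \<omega> - ?s + (\<Sum>j<k. (\<lambda>j\<in>{..<k}. Z (is ! j) \<omega>) j))) = ratios k is \<omega>"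
        by (auto simp: fun_eq_iff)
      ultimately show "ennreal (T \<omega> powr (- \<theta>)) * G (ratios k is \<omega>) * ennreal ((1 - (\<Sum>j<k. ratios k is \<omega> j))\<^sup>2)
        = ?F (\<lambda>j\<in>{..<k}. Z (is ! j) \<omega>) (T \<omega> - ?s)"
        unfolding kernel_def by (simp add: ennreal_mult_between)
    qed
  qed
  also have "\<dots> = (\<integral>\<^sup>+x. \<integral>\<^sup>+\<omega>. ?F x (T \<omega>) \<partial>M \<partial>(\<Pi>\<^sub>M j\<in>{..<k}. levy))"
    by (rule mecke[OF Fm]) (auto simp: kernel_def positive_vectors_def indicator_def dest: leD)
  also have "\<dots> = (\<integral>\<^sup>+\<omega>. \<integral>\<^sup>+x. ?F x (T \<omega>) \<partial>(\<Pi>\<^sub>M j\<in>{..<k}. levy) \<partial>M)"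
  proof (rule P.Fubini'[symmetric])
    have "(\<lambda>p. (fst p, T (snd p))) \<in> (\<Pi>\<^sub>M j\<in>{..<k}. levy) \<Otimes>\<^sub>M M \<rightarrow>\<^sub>M (\<Pi>\<^sub>M j\<in>{..<k}. borel) \<Otimes>\<^sub>M borel"
      by (subst measurable_cong_sets[OF sets_pair_measure_cong[OF sets_PiM_levy refl] refl]) measurable
    from measurable_compose[OF this Fm]
    show "(\<lambda>(x, \<omega>). ?F x (T \<omega>)) \<in> borel_measurable ((\<Pi>\<^sub>M j\<in>{..<k}. levy) \<Otimes>\<^sub>M M)" by (simp add: case_prod_beta')
  qed
  also have "\<dots> = (\<integral>\<^sup>+\<omega>. ennreal (T \<omega> powr (- (real k * \<alpha> + \<theta>))) * (\<integral>\<^sup>+x. kernel k \<theta> G x 1 \<partial>(\<Pi>\<^sub>M j\<in>{..<k}. levy)) \<partial>M)"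
  proof (intro nn_integral_cong_AE, use AE_T_pos in eventually_elim)
    case (elim \<omega>)
    have m: "(\<lambda>x. kernel k \<theta> G x (T \<omega>)) \<in> borel_measurable (\<Pi>\<^sub>M j\<in>{..<k}. levy)"
      using measurable_compose[OF measurable_Pair2' kernel_measurable[OF G]]
      by (subst measurable_cong_sets[OF sets_PiM_levy refl]) simp
    have "(\<integral>\<^sup>+x. ?F x (T \<omega>) \<partial>(\<Pi>\<^sub>M j\<in>{..<k}. levy)) = ennreal ((T \<omega>)\<^sup>2 * T \<omega> powr (- (real k * \<alpha> + \<theta>) - 2)) * (\<integral>\<^sup>+x. kernel k \<theta> G x 1 \<partial>(\<Pi>\<^sub>M j\<in>{..<k}. levy))"
      by (subst nn_integral_multc[OF m]) (simp add: kernel_scale[OF G elim] ennreal_mult' mult_ac)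
    also have "(T \<omega>)\<^sup>2 * T \<omega> powr (- (real k * \<alpha> + \<theta>) - 2) = T \<omega> powr (- (real k * \<alpha> + \<theta>))"
      using powr_minus_two_mult_square[OF elim, of "real k * \<alpha> + \<theta>" "T \<omega>"] elim by (simp add: mult.commute)
    finally show ?case .
  qed
  also have "\<dots> = (\<integral>\<^sup>+\<omega>. ennreal (T \<omega> powr (- (real k * \<alpha> + \<theta>))) \<partial>M) * (\<integral>\<^sup>+x. kernel k \<theta> G x 1 \<partial>(\<Pi>\<^sub>M j\<in>{..<k}. levy))"
    by (rule nn_integral_multc) simp
  finally show ?thesis .
qed

text \<open>Mecke's formula for \<open>k + 1\<close> jumps, with the extra jump \<open>y\<close>
  then counted to the rest. Scaling by \<open>T + y\<close> in place of \<open>T\<close> produces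
  the same integral of \<open>G\<close> as in \<open>sampled_square_of_rest\<close>, so that only
  the moments differ.\<close>

lemma sampled_sum_of_squares:
  assumes G: "G \<in> borel_measurable (\<Pi>\<^sub>M j\<in>{..<k}. borel)"
  shows "(\<integral>\<^sup>+\<omega>. \<integral>\<^sup>+is. ennreal (T \<omega> powr (- \<theta>)) * G (ratios k is \<omega>)
      * (\<Sum>i. ennreal ((Z i \<omega> / T \<omega>)\<^sup>2) * indicator (- set is) i) \<partial>index_lists k \<partial>M)
    = (\<integral>\<^sup>+y. \<integral>\<^sup>+\<omega>. ennreal (y\<^sup>2 * (T \<omega> + y) powr (- (real k * \<alpha> + \<theta>) - 2)) \<partial>M \<partial>levy)
      * (\<integral>\<^sup>+x. kernel k \<theta> G x 1 \<partial>(\<Pi>\<^sub>M j\<in>{..<k}. levy))"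
proof -
  interpret levy: sigma_finite_measure levy by (rule sigma_finite_levy)
  interpret product_sigma_finite "\<lambda>_::nat. levy" by (rule product_sigma_finite.intro) (rule sigma_finite_levy)
  interpret PL: sigma_finite_measure "\<Pi>\<^sub>M j\<in>{..<k}. levy" by (rule sigma_finite) simp
  interpret LM: pair_sigma_finite levy M ..
  interpret P: pair_sigma_finite "\<Pi>\<^sub>M j\<in>{..<k}. levy" "levy \<Otimes>\<^sub>M M" ..
  let ?K = "\<integral>\<^sup>+x. kernel k \<theta> G x 1 \<partial>(\<Pi>\<^sub>M j\<in>{..<k}. levy)"
  let ?q = "real k * \<alpha> + \<theta>"
  \<comment> \<open>Here \<open>r\<close> remains after all \<open>k + 1\<close> jumps, so the rest
    seen from the first \<open>k\<close> of them is \<open>r + y\<close>.\<close>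
  define H where "H x y r = kernel k \<theta> G x (r + y) * ennreal (indicator {0<..} y * y\<^sup>2)" for x y r
  let ?F = "\<lambda>x r. H (restrict x {..<k}) (x k) r"
  have Hm: "(\<lambda>p. H (fst p) (fst (snd p)) (snd (snd p))) \<in> borel_measurable ((\<Pi>\<^sub>M j\<in>{..<k}. borel) \<Otimes>\<^sub>M (borel \<Otimes>\<^sub>M borel))"
  proof -
    have "(\<lambda>p. (fst p, snd (snd p) + fst (snd p))) \<in> (\<Pi>\<^sub>M j\<in>{..<k}. borel) \<Otimes>\<^sub>M (borel \<Otimes>\<^sub>M (borel :: real measure)) \<rightarrow>\<^sub>M (\<Pi>\<^sub>M j\<in>{..<k}. borel) \<Otimes>\<^sub>M borel"
      by measurable
    from measurable_compose[OF this kernel_measurable[OF G, of \<theta>]] show ?thesis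
      unfolding H_def by (intro borel_measurable_times_ennreal) (simp, measurable)
  qed
  have Fm: "case_prod ?F \<in> borel_measurable ((\<Pi>\<^sub>M j\<in>{..<Suc k}. borel) \<Otimes>\<^sub>M borel)"
  proof -
    have "(\<lambda>p. (restrict (fst p) {..<k}, fst p k, snd p)) \<in> (\<Pi>\<^sub>M j\<in>{..<Suc k}. borel) \<Otimes>\<^sub>M borel \<rightarrow>\<^sub>M (\<Pi>\<^sub>M j\<in>{..<k}. borel) \<Otimes>\<^sub>M (borel \<Otimes>\<^sub>M (borel :: real measure))"
      by (intro measurable_Pair measurable_compose[OF measurable_fst measurable_restrict_subset]
        measurable_compose[OF measurable_fst measurable_component_singleton] measurable_snd) auto
    from measurable_compose[OF this Hm] show ?thesis by (simp add: case_prod_beta')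
  qed
  have "(\<integral>\<^sup>+\<omega>. \<integral>\<^sup>+is. ennreal (T \<omega> powr (- \<theta>)) * G (ratios k is \<omega>)
      * (\<Sum>i. ennreal ((Z i \<omega> / T \<omega>)\<^sup>2) * indicator (- set is) i) \<partial>index_lists k \<partial>M)
    = (\<integral>\<^sup>+\<omega>. \<integral>\<^sup>+is. ?F (\<lambda>j\<in>{..<Suc k}. Z (is ! j) \<omega>) (T \<omega> - (\<Sum>j<Suc k. Z (is ! j) \<omega>)) \<partial>index_lists (Suc k) \<partial>M)"
  proof (intro nn_integral_cong_AE, use AE_Z_pos AE_T_pos in eventually_elim)
    case (elim \<omega>)
    show ?case unfolding nn_integral_distinct_lists_Suc
    proof (intro nn_integral_cong)
      fix "is" assume "is \<in> space (index_lists k)"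
      then have len: "length is = k" by (simp add: distinct_lists_def)
      let ?s = "\<Sum>j<k. Z (is ! j) \<omega>"
      have pos: "(\<lambda>j\<in>{..<k}. Z (is ! j) \<omega>) \<in> positive_vectors k" using elim(1) by (auto simp: positive_vectors_def)
      have "?F (\<lambda>j\<in>{..<Suc k}. Z ((is @ [i]) ! j) \<omega>) (T \<omega> - (\<Sum>j<Suc k. Z ((is @ [i]) ! j) \<omega>))
        = ennreal (T \<omega> powr (- \<theta>)) * G (ratios k is \<omega>) * ennreal ((Z i \<omega> / T \<omega>)\<^sup>2)" for i
      proof -
        have x: "restrict (\<lambda>j\<in>{..<Suc k}. Z ((is @ [i]) ! j) \<omega>) {..<k} = (\<lambda>j\<in>{..<k}. Z (is ! j) \<omega>)"
          "(\<lambda>j\<in>{..<Suc k}. Z ((is @ [i]) ! j) \<omega>) k = Z i \<omega>"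
          "(\<Sum>j<Suc k. Z ((is @ [i]) ! j) \<omega>) = ?s + Z i \<omega>"
          using len by (auto simp: fun_eq_iff nth_append intro!: sum.cong)
        have r: "(\<lambda>j\<in>{..<k}. (\<lambda>j\<in>{..<k}. Z (is ! j) \<omega>) j / (T \<omega> - (?s + Z i \<omega>) + Z i \<omega> + (\<Sum>j<k. (\<lambda>j\<in>{..<k}. Z (is ! j) \<omega>) j))) = ratios k is \<omega>"
          by (auto simp: fun_eq_iff)
        have s: "T \<omega> - (?s + Z i \<omega>) + Z i \<omega> + (\<Sum>j<k. (\<lambda>j\<in>{..<k}. Z (is ! j) \<omega>) j) = T \<omega>" by simp
        have "H (\<lambda>j\<in>{..<k}. Z (is ! j) \<omega>) (Z i \<omega>) (T \<omega> - (?s + Z i \<omega>))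
          = ennreal (T \<omega> powr (- \<theta> - 2)) * G (ratios k is \<omega>) * ennreal ((Z i \<omega>)\<^sup>2)"
          unfolding H_def kernel_def r unfolding s using pos elim(1) by simp
        also have "\<dots> = ennreal (T \<omega> powr (- \<theta> - 2) * (Z i \<omega>)\<^sup>2) * G (ratios k is \<omega>)"
          by (simp add: ennreal_mult'' mult_ac)
        also have "T \<omega> powr (- \<theta> - 2) * (Z i \<omega>)\<^sup>2 = T \<omega> powr (- \<theta>) * (Z i \<omega> / T \<omega>)\<^sup>2"
          by (rule powr_minus_two_mult_square[OF elim(2)])
        finally show ?thesis unfolding x by (simp only: ennreal_mult_between zero_le_power2)
      qed
      then show "ennreal (T \<omega> powr (- \<theta>)) * G (ratios k is \<omega>) * (\<Sum>i. ennreal ((Z i \<omega> / T \<omega>)\<^sup>2) * indicator (- set is) i)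
        = (\<Sum>i. ?F (\<lambda>j\<in>{..<Suc k}. Z ((is @ [i]) ! j) \<omega>) (T \<omega> - (\<Sum>j<Suc k. Z ((is @ [i]) ! j) \<omega>)) * indicator (- set is) i)"
        by (simp only: ennreal_suminf_cmult[symmetric] mult.assoc)
    qed
  qed
  also have "\<dots> = (\<integral>\<^sup>+x. \<integral>\<^sup>+\<omega>. ?F x (T \<omega>) \<partial>M \<partial>(\<Pi>\<^sub>M j\<in>{..<Suc k}. levy))"
  proof (rule mecke[OF Fm])
    fix x :: "nat \<Rightarrow> real" and r j assume "j < Suc k" "x j \<le> 0"
    then show "?F x r = 0"
      by (cases "j = k") (auto simp: H_def kernel_def positive_vectors_def indicator_def dest: leD)
  qed
  also have "\<dots> = (\<integral>\<^sup>+x. \<integral>\<^sup>+y. \<integral>\<^sup>+\<omega>. ?F (x(k := y)) (T \<omega>) \<partial>M \<partial>levy \<partial>(\<Pi>\<^sub>M j\<in>{..<k}. levy))"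
    unfolding lessThan_Suc
  proof (rule product_nn_integral_insert)
    have "(\<lambda>(x, \<omega>). ?F x (T \<omega>)) \<in> borel_measurable ((\<Pi>\<^sub>M j\<in>insert k {..<k}. borel) \<Otimes>\<^sub>M M)"
    proof -
      have "(\<lambda>p. (fst p, T (snd p))) \<in> (\<Pi>\<^sub>M j\<in>{..<Suc k}. borel) \<Otimes>\<^sub>M M \<rightarrow>\<^sub>M (\<Pi>\<^sub>M j\<in>{..<Suc k}. borel) \<Otimes>\<^sub>M borel" by measurable
      from measurable_compose[OF this Fm] show ?thesis by (simp add: case_prod_beta' lessThan_Suc)
    qed
    then have "(\<lambda>x. \<integral>\<^sup>+\<omega>. ?F x (T \<omega>) \<partial>M) \<in> borel_measurable (\<Pi>\<^sub>M j\<in>insert k {..<k}. borel)"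
      by (rule borel_measurable_nn_integral)
    then show "(\<lambda>x. \<integral>\<^sup>+\<omega>. ?F x (T \<omega>) \<partial>M) \<in> borel_measurable (\<Pi>\<^sub>M j\<in>insert k {..<k}. levy)"
      by (subst measurable_cong_sets[OF sets_PiM_levy refl])
  qed auto
  also have "\<dots> = (\<integral>\<^sup>+x. \<integral>\<^sup>+y. \<integral>\<^sup>+\<omega>. H x y (T \<omega>) \<partial>M \<partial>levy \<partial>(\<Pi>\<^sub>M j\<in>{..<k}. levy))"
  proof (intro nn_integral_cong)
    fix x y \<omega> assume "x \<in> space (\<Pi>\<^sub>M j\<in>{..<k}. levy)"
    then have "restrict (x(k := y)) {..<k} = x" by (auto simp: space_PiM PiE_def extensional_def fun_eq_iff)
    then show "?F (x(k := y)) (T \<omega>) = H x y (T \<omega>)" by simp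
  qed
  also have "\<dots> = (\<integral>\<^sup>+x. \<integral>\<^sup>+p. H x (fst p) (T (snd p)) \<partial>(levy \<Otimes>\<^sub>M M) \<partial>(\<Pi>\<^sub>M j\<in>{..<k}. levy))"
  proof (intro nn_integral_cong)
    fix x assume "x \<in> space (\<Pi>\<^sub>M j\<in>{..<k}. levy)"
    then have x: "x \<in> space (\<Pi>\<^sub>M j\<in>{..<k}. borel)" by (simp add: space_PiM)
    have "(\<lambda>p. (x, fst p, T (snd p))) \<in> levy \<Otimes>\<^sub>M M \<rightarrow>\<^sub>M (\<Pi>\<^sub>M j\<in>{..<k}. borel) \<Otimes>\<^sub>M (borel \<Otimes>\<^sub>M borel)"
      by (subst measurable_cong_sets[OF sets_pair_measure_cong[OF sets_levy refl] refl]) (use x in measurable)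
    from measurable_compose[OF this Hm]
    have "(\<lambda>p. H x (fst p) (T (snd p))) \<in> borel_measurable (levy \<Otimes>\<^sub>M M)" by simp
    from nn_integral_fst[OF this]
    show "(\<integral>\<^sup>+y. \<integral>\<^sup>+\<omega>. H x y (T \<omega>) \<partial>M \<partial>levy) = (\<integral>\<^sup>+p. H x (fst p) (T (snd p)) \<partial>(levy \<Otimes>\<^sub>M M))" by simp
  qed
  also have "\<dots> = (\<integral>\<^sup>+p. \<integral>\<^sup>+x. H x (fst p) (T (snd p)) \<partial>(\<Pi>\<^sub>M j\<in>{..<k}. levy) \<partial>(levy \<Otimes>\<^sub>M M))"
  proof (rule P.Fubini'[symmetric])
    have "(\<lambda>p. (fst p, fst (snd p), T (snd (snd p)))) \<in> (\<Pi>\<^sub>M j\<in>{..<k}. levy) \<Otimes>\<^sub>M (levy \<Otimes>\<^sub>M M) \<rightarrow>\<^sub>M (\<Pi>\<^sub>M j\<in>{..<k}. borel) \<Otimes>\<^sub>M (borel \<Otimes>\<^sub>M borel)"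
      by (subst measurable_cong_sets[OF sets_pair_measure_cong[OF sets_PiM_levy sets_pair_measure_cong[OF sets_levy refl]] refl]) measurable
    from measurable_compose[OF this Hm]
    show "(\<lambda>(x, p). H x (fst p) (T (snd p))) \<in> borel_measurable ((\<Pi>\<^sub>M j\<in>{..<k}. levy) \<Otimes>\<^sub>M (levy \<Otimes>\<^sub>M M))"
      by (simp add: case_prod_beta')
  qed
  also have "\<dots> = (\<integral>\<^sup>+p. ennreal (indicator {0<..} (fst p) * ((fst p)\<^sup>2 * (T (snd p) + fst p) powr (- ?q - 2))) * ?K \<partial>(levy \<Otimes>\<^sub>M M))"
  proof (intro nn_integral_cong)
    fix p assume "p \<in> space (levy \<Otimes>\<^sub>M M)"
    then have \<omega>: "snd p \<in> space M" by (auto simp: space_pair_measure)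
    show "(\<integral>\<^sup>+x. H x (fst p) (T (snd p)) \<partial>(\<Pi>\<^sub>M j\<in>{..<k}. levy)) = ennreal (indicator {0<..} (fst p) * ((fst p)\<^sup>2 * (T (snd p) + fst p) powr (- ?q - 2))) * ?K"
    proof (cases "fst p > 0")
      case True
      have pos: "T (snd p) + fst p > 0" using True T_nonneg[OF \<omega>] by simp
      have m: "(\<lambda>x. kernel k \<theta> G x (T (snd p) + fst p)) \<in> borel_measurable (\<Pi>\<^sub>M j\<in>{..<k}. levy)"
        using measurable_compose[OF measurable_Pair2' kernel_measurable[OF G]]
        by (subst measurable_cong_sets[OF sets_PiM_levy refl]) simp
      show ?thesis unfolding H_def
        by (subst nn_integral_multc[OF m]) (use True in \<open>simp add: kernel_scale[OF G pos] ennreal_mult' mult_ac\<close>)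
    qed (simp add: H_def)
  qed
  also have "\<dots> = (\<integral>\<^sup>+p. ennreal (indicator {0<..} (fst p) * ((fst p)\<^sup>2 * (T (snd p) + fst p) powr (- ?q - 2))) \<partial>(levy \<Otimes>\<^sub>M M)) * ?K"
    by (rule nn_integral_multc) (subst measurable_cong_sets[OF sets_pair_measure_cong[OF sets_levy refl] refl], measurable)
  also have "(\<integral>\<^sup>+p. ennreal (indicator {0<..} (fst p) * ((fst p)\<^sup>2 * (T (snd p) + fst p) powr (- ?q - 2))) \<partial>(levy \<Otimes>\<^sub>M M))
    = (\<integral>\<^sup>+y. \<integral>\<^sup>+\<omega>. ennreal (indicator {0<..} y * (y\<^sup>2 * (T \<omega> + y) powr (- ?q - 2))) \<partial>M \<partial>levy)"
  proof -
    have "(\<lambda>p. ennreal (indicator {0<..} (fst p) * ((fst p)\<^sup>2 * (T (snd p) + fst p) powr (- ?q - 2)))) \<in> borel_measurable (levy \<Otimes>\<^sub>M M)"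
      by (subst measurable_cong_sets[OF sets_pair_measure_cong[OF sets_levy refl] refl]) measurable
    from nn_integral_fst[OF this] show ?thesis by simp
  qed
  also have "\<dots> = (\<integral>\<^sup>+y. \<integral>\<^sup>+\<omega>. ennreal (y\<^sup>2 * (T \<omega> + y) powr (- ?q - 2)) \<partial>M \<partial>levy)"
    by (intro nn_integral_cong_AE, use AE_levy in eventually_elim) simp
  finally show ?thesis .
qed

text \<open>Both sides contain the same kernel integral as a factor. It is never divided out, so the
  identity is valid also where it is infinite.\<close>

lemma sampled_identity:
  assumes G: "G \<in> borel_measurable (\<Pi>\<^sub>M j\<in>{..<k}. borel)" and q: "real k * \<alpha> + \<theta> > -1"
  shows "(\<integral>\<^sup>+\<omega>. \<integral>\<^sup>+is. ennreal (T \<omega> powr (- \<theta>)) * G (ratios k is \<omega>)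
      * (\<Sum>i. ennreal ((Z i \<omega> / T \<omega>)\<^sup>2) * indicator (- set is) i) \<partial>index_lists k \<partial>M)
    = ennreal ((1 - \<alpha>) / (1 + (real k * \<alpha> + \<theta>)))
      * (\<integral>\<^sup>+\<omega>. \<integral>\<^sup>+is. ennreal (T \<omega> powr (- \<theta>)) * G (ratios k is \<omega>) * ennreal ((1 - (\<Sum>j<k. ratios k is \<omega> j))\<^sup>2) \<partial>index_lists k \<partial>M)"
  unfolding sampled_sum_of_squares[OF G] sampled_square_of_rest[OF G] moment_identity[OF q] by (simp add: mult.assoc)

text \<open>Mecke's formula for one jump \<open>x\<close>, followed by the scaling of
  \<open>x\<close> by \<open>T\<close>, factors the integral into a moment of \<open>T\<close> of
  order \<open>g\<close> and the integral of \<open>levy_tail_finite\<close>. Each factor is finite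
  because g < \<alpha>.\<close>

lemma dislocation_finite:
  assumes g: "0 \<le> g" "g < \<alpha>"
  shows "(\<integral>\<^sup>+\<omega>. ennreal (T \<omega> powr (\<alpha> + g)) * (\<Sum>i. ennreal (Z i \<omega> / T \<omega> * (1 - Z i \<omega> / T \<omega>))) \<partial>M) < \<infinity>"
proof -
  interpret levy: sigma_finite_measure levy by (rule sigma_finite_levy)
  interpret P: pair_sigma_finite levy M ..
  let ?F = "\<lambda>x r. ennreal (indicator {0<..} x * (x * r * (r + x) powr (\<alpha> + g - 2)))"
  have "(\<integral>\<^sup>+\<omega>. ennreal (T \<omega> powr (\<alpha> + g)) * (\<Sum>i. ennreal (Z i \<omega> / T \<omega> * (1 - Z i \<omega> / T \<omega>))) \<partial>M)
    = (\<integral>\<^sup>+\<omega>. (\<Sum>i. ?F (Z i \<omega>) (T \<omega> - Z i \<omega>)) \<partial>M)"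
  proof (intro nn_integral_cong_AE, use AE_Z_pos AE_T_pos in eventually_elim)
    case (elim \<omega>)
    have "ennreal (T \<omega> powr (\<alpha> + g)) * ennreal (Z i \<omega> / T \<omega> * (1 - Z i \<omega> / T \<omega>)) = ?F (Z i \<omega>) (T \<omega> - Z i \<omega>)" for i
    proof -
      have "T \<omega> powr (\<alpha> + g) * (Z i \<omega> / T \<omega> * (1 - Z i \<omega> / T \<omega>)) = Z i \<omega> * (T \<omega> - Z i \<omega>) * T \<omega> powr (\<alpha> + g - 2)"
        using elim(2) by (simp add: powr_diff powr_numeral field_simps power2_eq_square)
      then show ?thesis using elim(1) by (simp add: ennreal_mult'[symmetric])
    qed
    then show ?case by (simp only: ennreal_suminf_cmult[symmetric])
  qed
  also have "\<dots> = (\<integral>\<^sup>+x. \<integral>\<^sup>+\<omega>. ?F x (T \<omega>) \<partial>M \<partial>levy)"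
    by (rule mecke_single) auto
  also have "\<dots> = (\<integral>\<^sup>+\<omega>. \<integral>\<^sup>+x. ?F x (T \<omega>) \<partial>levy \<partial>M)"
    by (rule P.Fubini'[symmetric]) (subst measurable_cong_sets[OF sets_pair_measure_cong[OF sets_levy refl] refl], measurable)
  also have "\<dots> = (\<integral>\<^sup>+\<omega>. ennreal (T \<omega> powr g) * (\<integral>\<^sup>+x. ennreal (x * (1 + x) powr (\<alpha> + g - 2)) \<partial>levy) \<partial>M)"
  proof (intro nn_integral_cong_AE, use AE_T_pos in eventually_elim)
    case (elim \<omega>)
    have "(\<integral>\<^sup>+x. ?F x (T \<omega>) \<partial>levy) = ennreal (T \<omega> powr (- \<alpha>)) * (\<integral>\<^sup>+x. ?F (T \<omega> * x) (T \<omega>) \<partial>levy)"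
      by (rule levy_scale[OF elim]) simp
    also have "(\<integral>\<^sup>+x. ?F (T \<omega> * x) (T \<omega>) \<partial>levy) = (\<integral>\<^sup>+x. ennreal (T \<omega> powr (\<alpha> + g)) * ennreal (x * (1 + x) powr (\<alpha> + g - 2)) \<partial>levy)"
    proof (intro nn_integral_cong_AE, use AE_levy in eventually_elim)
      case (elim x)
      have "T \<omega> + T \<omega> * x = T \<omega> * (1 + x)" by (simp add: distrib_left)
      then have "T \<omega> * x * T \<omega> * (T \<omega> + T \<omega> * x) powr (\<alpha> + g - 2) = (T \<omega> powr (\<alpha> + g - 2) * (T \<omega>)\<^sup>2) * (x * (1 + x) powr (\<alpha> + g - 2))"
        using elim \<open>T \<omega> > 0\<close> by (simp add: powr_mult power2_eq_square)
      also have "T \<omega> powr (\<alpha> + g - 2) * (T \<omega>)\<^sup>2 = T \<omega> powr (\<alpha> + g)"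
        using \<open>T \<omega> > 0\<close> by (simp add: powr_diff powr_numeral)
      finally show ?case using elim \<open>T \<omega> > 0\<close> by (simp add: ennreal_mult'[symmetric])
    qed
    also have "\<dots> = ennreal (T \<omega> powr (\<alpha> + g)) * (\<integral>\<^sup>+x. ennreal (x * (1 + x) powr (\<alpha> + g - 2)) \<partial>levy)"
      by (rule nn_integral_cmult) simp
    also have "ennreal (T \<omega> powr (- \<alpha>)) * (ennreal (T \<omega> powr (\<alpha> + g)) * I) = ennreal (T \<omega> powr g) * I" for I
      by (simp add: mult.assoc[symmetric] ennreal_mult''[symmetric] powr_add[symmetric])
    finally show ?case .
  qed
  also have "\<dots> = (\<integral>\<^sup>+\<omega>. ennreal (T \<omega> powr g) \<partial>M) * (\<integral>\<^sup>+x. ennreal (x * (1 + x) powr (\<alpha> + g - 2)) \<partial>levy)"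
    by (rule nn_integral_multc) simp
  also have "\<dots> < \<infinity>" using T_moment_finite[OF g] levy_tail_finite[OF g(2)] by (simp add: ennreal_mult_less_top)
  finally show ?thesis .
qed

end

section \<open>Size-biased measures\<close>

text \<open>Turns the unordered sum in \<open>is_size_biased\<close> into an integral, to which
  Tonelli's theorem applies.\<close>

lemma infsum_ennreal_eq_nn_integral:
  fixes f :: "'i \<Rightarrow> ennreal"
  assumes A: "countable A"
  shows "infsum f A = (\<integral>\<^sup>+i. f i \<partial>count_space A)"
proof -
  have inf: "infsum f A = (SUP F\<in>{F. finite F \<and> F \<subseteq> A}. sum f F)"
    by (rule nonneg_infsum_complete) simp
  show ?thesis
  proof (rule antisym)
    show "infsum f A \<le> (\<integral>\<^sup>+i. f i \<partial>count_space A)"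
      unfolding inf
    proof (rule SUP_least)
      fix F assume "F \<in> {F. finite F \<and> F \<subseteq> A}"
      then have F: "finite F" "F \<subseteq> A" by auto
      have "sum f F = (\<integral>\<^sup>+i. f i \<partial>count_space F)" using F by (simp add: nn_integral_count_space_finite)
      also have "\<dots> = (\<integral>\<^sup>+i. f i * indicator F i \<partial>count_space A)"
        using F by (subst (1 2) nn_integral_count_space_indicator)
          (auto intro!: nn_integral_cong simp: indicator_def)
      also have "\<dots> \<le> (\<integral>\<^sup>+i. f i \<partial>count_space A)" by (intro nn_integral_mono) (auto simp: indicator_def)
      finally show "sum f F \<le> (\<integral>\<^sup>+i. f i \<partial>count_space A)" .
    qed
  next
    show "(\<integral>\<^sup>+i. f i \<partial>count_space A) \<le> infsum f A"
    proof (cases "finite A")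
      case True
      then show ?thesis by (simp add: nn_integral_count_space_finite)
    next
      case False
      have bij: "bij_betw (from_nat_into A) UNIV A" using A False by (rule bij_betw_from_nat_into)
      have "(\<integral>\<^sup>+i. f i \<partial>count_space A) = (\<integral>\<^sup>+n. f (from_nat_into A n) \<partial>count_space UNIV)"
        by (rule nn_integral_bij_count_space[OF bij, symmetric])
      also have "\<dots> = (SUP n. \<Sum>i<n. f (from_nat_into A i))"
        by (simp add: nn_integral_count_space_nat suminf_eq_SUP)
      also have "\<dots> \<le> infsum f A"
      proof (rule SUP_least)
        fix n
        have inj: "inj_on (from_nat_into A) {..<n}" using bij by (auto simp: bij_betw_def intro: inj_on_subset)
        have "(\<Sum>i<n. f (from_nat_into A i)) = sum f (from_nat_into A ` {..<n})"
          by (simp add: sum.reindex[OF inj])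
        also have "\<dots> \<le> infsum f A" unfolding inf
          by (rule SUP_upper) (use bij in \<open>auto simp: bij_betw_def\<close>)
        finally show "(\<Sum>i<n. f (from_nat_into A i)) \<le> infsum f A" .
      qed
      finally show ?thesis .
    qed
  qed
qed

definition sb_weight :: "nat \<Rightarrow> (nat \<Rightarrow> real) \<Rightarrow> nat list \<Rightarrow> real"
  where "sb_weight k s is = (\<Prod>j<k. s (is ! j)) / (\<Prod>j=1..<k. 1 - (\<Sum>l<j. s (is ! l)))"

lemma space_mass_partition_space [simp]: "space mass_partition_space = mass_partitions"
  by (simp add: mass_partition_space_def space_restrict_space space_PiM)

lemma mass_partition_measurable [measurable]: "(\<lambda>s. s i) \<in> borel_measurable mass_partition_space"
  unfolding mass_partition_space_def by (intro measurable_restrict_space1) measurable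

lemma mass_partitionD:
  assumes "s \<in> mass_partitions"
  shows "decseq s" "\<And>i. 0 \<le> s i" "summable s" "suminf s \<le> 1" "\<And>i. s i \<le> 1"
proof -
  show s: "decseq s" "\<And>i. 0 \<le> s i" "summable s" "suminf s \<le> 1" using assms by (auto simp: mass_partitions_def)
  show "s i \<le> 1" for i
    using sum_le_suminf[OF s(3), of "{i}"] s(2,4) by auto
qed

subsection \<open>Size-biased picks\<close>

text \<open>Index \<open>i\<close> owns the interval from \<open>part_sum s xs i\<close> to
  \<open>part_sum s xs (Suc i)\<close>, which is empty if \<open>i\<close> has been picked already.
  The intervals fill the remaining mass \<open>rest_mass s xs\<close>.\<close>

definition part_sum :: "(nat \<Rightarrow> real) \<Rightarrow> nat list \<Rightarrow> nat \<Rightarrow> real"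
  where "part_sum s xs i = (\<Sum>l<i. if l \<in> set xs then 0 else s l)"

definition rest_mass :: "(nat \<Rightarrow> real) \<Rightarrow> nat list \<Rightarrow> real"
  where "rest_mass s xs = 1 - (\<Sum>l\<in>set xs. s l)"

text \<open>The inverse of the distribution function of a size-biased pick among the indices off
  \<open>xs\<close>, so that a uniform \<open>v\<close> yields such a pick.\<close>

definition pick :: "(nat \<Rightarrow> real) \<Rightarrow> nat list \<Rightarrow> real \<Rightarrow> nat"
  where "pick s xs v = (LEAST i. v * rest_mass s xs < part_sum s xs (Suc i))"

primrec picks :: "(nat \<Rightarrow> real) \<Rightarrow> (nat \<Rightarrow> real) \<Rightarrow> nat \<Rightarrow> nat list"
  where
    "picks s u 0 = []"
  | "picks s u (Suc k) = picks s u k @ [pick s (picks s u k) (u k)]"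

lemma length_picks [simp]: "length (picks s u k) = k"
  by (induction k) auto

lemma nth_picks: "j < k \<Longrightarrow> k \<le> k' \<Longrightarrow> picks s u k' ! j = picks s u k ! j"
  by (induction k') (auto simp: nth_append le_Suc_eq)

text \<open>For a prescribed outcome the history before each pick is known, so the event splits into
  conditions on single coordinates of \<open>u\<close> and its probability into a product.\<close>

lemma picks_eq_iff:
  "picks s u k = is \<longleftrightarrow> length is = k \<and> (\<forall>j\<in>{..<k}. pick s (take j is) (u j) = is ! j)"
proof (induction k arbitrary: "is")
  case (Suc k)
  show ?case
  proof (cases "is" rule: rev_cases)
    case (snoc ys y)
    have "picks s u (Suc k) = ys @ [y] \<longleftrightarrow> picks s u k = ys \<and> pick s ys (u k) = y" by auto
    also have "\<dots> \<longleftrightarrow> (length ys = k \<and> (\<forall>j\<in>{..<k}. pick s (take j ys) (u j) = ys ! j)) \<and> pick s ys (u k) = y"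
      unfolding Suc ..
    also have "\<dots> \<longleftrightarrow> length (ys @ [y]) = Suc k
        \<and> (\<forall>j\<in>{..<Suc k}. pick s (take j (ys @ [y])) (u j) = (ys @ [y]) ! j)"
      by (auto simp: lessThan_Suc nth_append)
    finally show ?thesis unfolding snoc .
  qed simp
qed auto

lemma summable_off:
  fixes s :: "nat \<Rightarrow> real"
  assumes "summable s" "\<And>i. 0 \<le> s i"
  shows "summable (\<lambda>l. if l \<in> set xs then 0 else s l)"
    "(\<Sum>l. if l \<in> set xs then 0 else s l) = suminf s - (\<Sum>l\<in>set xs. s l)"
proof -
  have "(\<lambda>l. if l \<in> set xs then s l else 0) sums (\<Sum>l\<in>set xs. s l)"
    using sums_If_finite_set[of "set xs" s] by simp
  then have "(\<lambda>l. s l - (if l \<in> set xs then s l else 0)) sums (suminf s - (\<Sum>l\<in>set xs. s l))"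
    using assms by (intro sums_diff summable_sums)
  moreover have "(\<lambda>l. s l - (if l \<in> set xs then s l else 0)) = (\<lambda>l. if l \<in> set xs then 0 else s l)" by auto
  ultimately have "(\<lambda>l. if l \<in> set xs then 0 else s l) sums (suminf s - (\<Sum>l\<in>set xs. s l))" by simp
  then show "summable (\<lambda>l. if l \<in> set xs then 0 else s l)"
    "(\<Sum>l. if l \<in> set xs then 0 else s l) = suminf s - (\<Sum>l\<in>set xs. s l)" by (auto simp: sums_iff)
qed

text \<open>With total mass 1 and all parts positive, mass is left after finitely many picks: no
  denominator vanishes and there is always a next pick.\<close>

locale proper_partition =
  fixes s :: "nat \<Rightarrow> real"
  assumes in_mp: "s \<in> mass_partitions" and sum_one: "suminf s = 1" and pos: "\<And>i. s i > 0"
begin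

lemma rest_mass_eq: "rest_mass s xs = (\<Sum>l. if l \<in> set xs then 0 else s l)"
  using summable_off(2)[OF mass_partitionD(3,2)[OF in_mp]] sum_one by (simp add: rest_mass_def)

lemma rest_mass_pos: "rest_mass s xs > 0"
proof -
  obtain i where i: "i \<notin> set xs" using ex_new_if_finite[of "set xs"] by auto
  then have "0 < (\<Sum>l. if l \<in> set xs then 0 else s l)"
    using pos by (intro suminf_pos2[of _ i] summable_off mass_partitionD[OF in_mp]) (auto intro: less_imp_le)
  then show ?thesis by (simp add: rest_mass_eq)
qed

lemma part_sum_mono: "i \<le> j \<Longrightarrow> part_sum s xs i \<le> part_sum s xs j"
  unfolding part_sum_def using pos by (intro sum_mono2) (auto intro: less_imp_le)

lemma part_sum_le: "part_sum s xs i \<le> rest_mass s xs"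
  unfolding part_sum_def rest_mass_eq using pos
  by (intro sum_le_suminf summable_off mass_partitionD[OF in_mp]) (auto intro: less_imp_le)

lemma part_sum_nonneg: "0 \<le> part_sum s xs i"
  unfolding part_sum_def using pos by (intro sum_nonneg) (auto intro: less_imp_le)

lemma part_sum_tendsto: "part_sum s xs \<longlonglongrightarrow> rest_mass s xs"
  unfolding part_sum_def[abs_def] rest_mass_eq
  by (intro summable_LIMSEQ summable_off mass_partitionD[OF in_mp])

lemma pick_eq_iff:
  assumes v: "0 \<le> v" "v < 1"
  shows "pick s xs v = i \<longleftrightarrow> part_sum s xs i \<le> v * rest_mass s xs \<and> v * rest_mass s xs < part_sum s xs (Suc i)"
proof -
  \<comment> \<open>The strict bound \<open>v < 1\<close> ensures that some index satisfies the
    condition under \<open>LEAST\<close> in \<open>pick\<close>.\<close>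
  have "v * rest_mass s xs < rest_mass s xs" using v rest_mass_pos[of xs] by simp
  then have "\<forall>\<^sub>F i in sequentially. v * rest_mass s xs < part_sum s xs i"
    by (rule order_tendstoD(1)[OF part_sum_tendsto])
  then obtain N where "v * rest_mass s xs < part_sum s xs (Suc N)"
    by (metis eventually_sequentially le_SucI order_refl)
  then have ex: "\<exists>i. v * rest_mass s xs < part_sum s xs (Suc i)" by blast
  show ?thesis
  proof
    assume p: "pick s xs v = i"
    have "v * rest_mass s xs < part_sum s xs (Suc i)"
      using LeastI_ex[OF ex] p by (simp add: pick_def)
    moreover have "part_sum s xs i \<le> v * rest_mass s xs"
    proof (cases i)
      case 0
      then show ?thesis using v rest_mass_pos[of xs] by (simp add: part_sum_def)
    next
      case (Suc j)
      then have "\<not> v * rest_mass s xs < part_sum s xs (Suc j)"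
        using not_less_Least[of j "\<lambda>i. v * rest_mass s xs < part_sum s xs (Suc i)"] p by (simp add: pick_def)
      then show ?thesis using Suc by simp
    qed
    ultimately show "part_sum s xs i \<le> v * rest_mass s xs \<and> v * rest_mass s xs < part_sum s xs (Suc i)" by simp
  next
    assume i: "part_sum s xs i \<le> v * rest_mass s xs \<and> v * rest_mass s xs < part_sum s xs (Suc i)"
    show "pick s xs v = i" unfolding pick_def
    proof (rule Least_equality)
      fix j assume j: "v * rest_mass s xs < part_sum s xs (Suc j)"
      show "i \<le> j"
      proof (rule ccontr)
        assume "\<not> i \<le> j"
        then have "part_sum s xs (Suc j) \<le> part_sum s xs i" by (intro part_sum_mono) auto
        then show False using i j by simp
      qed
    qed (use i in simp)
  qed
qed

lemma emeasure_pick: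
  "emeasure lborel {v \<in> {0..<1}. pick s xs v = i} = ennreal (if i \<in> set xs then 0 else s i / rest_mass s xs)"
proof -
  let ?R = "rest_mass s xs"
  have "{v \<in> {0..<1}. pick s xs v = i} = {part_sum s xs i / ?R..<part_sum s xs (Suc i) / ?R}"
  proof (intro set_eqI iffI)
    fix v assume "v \<in> {v \<in> {0..<1}. pick s xs v = i}"
    then show "v \<in> {part_sum s xs i / ?R..<part_sum s xs (Suc i) / ?R}"
      using pick_eq_iff[of v xs i] rest_mass_pos[of xs] by (simp add: pos_divide_le_eq pos_less_divide_eq)
  next
    fix v assume v: "v \<in> {part_sum s xs i / ?R..<part_sum s xs (Suc i) / ?R}"
    have "0 \<le> part_sum s xs i / ?R" using part_sum_nonneg rest_mass_pos[of xs] by simp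
    then have "0 \<le> v" using v by auto
    moreover have "part_sum s xs (Suc i) / ?R \<le> 1" using part_sum_le rest_mass_pos[of xs] by simp
    then have "v < 1" using v by auto
    ultimately show "v \<in> {v \<in> {0..<1}. pick s xs v = i}"
      using v pick_eq_iff[of v xs i] rest_mass_pos[of xs] by (simp add: pos_divide_le_eq pos_less_divide_eq)
  qed
  moreover have "part_sum s xs i / ?R \<le> part_sum s xs (Suc i) / ?R"
    using rest_mass_pos[of xs] part_sum_mono[of i "Suc i"] by (intro divide_right_mono) auto
  moreover have "part_sum s xs (Suc i) / ?R - part_sum s xs i / ?R = (if i \<in> set xs then 0 else s i / ?R)"
    by (simp add: part_sum_def add_divide_distrib)
  ultimately show ?thesis by simp
qed

text \<open>For distinct indices the denominators are the masses left before each pick; the first of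
  them is 1, which is why the product in \<open>sb_weight\<close> starts at 1. A repeated index has
  probability 0.\<close>

lemma prod_pick_probabilities:
  assumes "length is = k"
  shows "(\<Prod>j<k. if is ! j \<in> set (take j is) then 0 else s (is ! j) / rest_mass s (take j is))
    = (if distinct is then sb_weight k s is else 0)"
proof (cases "distinct is")
  case True
  have sum: "(\<Sum>l\<in>set (take j is). s l) = (\<Sum>l<j. s (is ! l))" if "j < k" for j
    using sum.reindex_bij_betw[OF bij_betw_nth[of "take j is" "{..<j}" "set (take j is)"], of s] True assms that
    by (simp add: min_def)
  have notin: "is ! j \<notin> set (take j is)" if "j < k" for j
    using True assms that by (auto simp: in_set_conv_nth nth_eq_iff_index_eq)
  have "(\<Prod>j<k. if is ! j \<in> set (take j is) then 0 else s (is ! j) / rest_mass s (take j is))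
     = (\<Prod>j<k. s (is ! j) / (1 - (\<Sum>l<j. s (is ! l))))"
    using notin sum by (intro prod.cong) (auto simp: rest_mass_def)
  also have "\<dots> = (\<Prod>j<k. s (is ! j)) / (\<Prod>j<k. 1 - (\<Sum>l<j. s (is ! l)))" by (rule prod_dividef)
  also have "(\<Prod>j<k. 1 - (\<Sum>l<j. s (is ! l))) = (\<Prod>j=1..<k. 1 - (\<Sum>l<j. s (is ! l)))"
    by (rule prod.mono_neutral_right) (auto simp: not_le less_Suc_eq_0_disj)
  finally show ?thesis using True by (simp add: sb_weight_def)
next
  case False
  then obtain i j where "i < j" "j < k" "is ! i = is ! j"
    using assms by (metis distinct_conv_nth linorder_neqE_nat)
  then have "is ! j \<in> set (take j is)" using assms by (auto simp: in_set_conv_nth intro!: exI[of _ i])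
  then show ?thesis using False \<open>j < k\<close> by (intro trans[OF prod_zero]) auto
qed

end


subsection \<open>Existence and uniqueness of the size-biased measure\<close>

definition uniform_seq :: "(nat \<Rightarrow> real) measure"
  where "uniform_seq = (\<Pi>\<^sub>M _\<in>UNIV. uniform_measure lborel {0..<1})"

lemma sets_uniform_seq [measurable_cong]: "sets uniform_seq = sets (\<Pi>\<^sub>M _\<in>UNIV. borel)"
  unfolding uniform_seq_def by (intro sets_PiM_cong) auto

lemma prob_uniform: "prob_space (uniform_measure lborel {0..<1::real})"
  by (rule prob_space_uniform_measure) auto

lemma prob_uniform_seq: "prob_space uniform_seq"
  unfolding uniform_seq_def by (intro prob_space_PiM prob_uniform)

lemma part_sum_measurable [measurable]: "(\<lambda>s. part_sum s xs i) \<in> borel_measurable mass_partition_space"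
  unfolding part_sum_def by measurable

lemma rest_mass_measurable [measurable]: "(\<lambda>s. rest_mass s xs) \<in> borel_measurable mass_partition_space"
  unfolding rest_mass_def by measurable

lemma picks_measurable [measurable]:
  "(\<lambda>(s, u). picks s u k) \<in> mass_partition_space \<Otimes>\<^sub>M uniform_seq \<rightarrow>\<^sub>M count_space UNIV"
proof (induction k)
  case (Suc k)
  have "(\<lambda>p. pick (fst p) xs (snd p k)) \<in> mass_partition_space \<Otimes>\<^sub>M uniform_seq \<rightarrow>\<^sub>M count_space UNIV" for xs
    unfolding pick_def by measurable
  then have "(\<lambda>p. xs @ [pick (fst p) xs (snd p k)]) \<in> mass_partition_space \<Otimes>\<^sub>M uniform_seq \<rightarrow>\<^sub>M count_space UNIV" for xs
    by measurable
  from measurable_compose_countable[OF this, of "\<lambda>p. picks (fst p) (snd p) k"] Suc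
  show ?case by (simp add: case_prod_beta')
qed (simp add: case_prod_beta')

text \<open>For total mass 1 the sum in \<open>dislocation\<close> lies between
  \<open>1 - s 0\<close> and \<open>2 * (1 - s 0)\<close>, so the condition is the usual one on
  \<open>1 - s 0\<close>. In the form used here it is the size-biased integral of 1 minus the first
  pick.\<close>

locale size_bias =
  fixes \<nu> :: "(nat \<Rightarrow> real) measure"
  assumes sets_\<nu>: "sets \<nu> = sets mass_partition_space"
    and sum_one: "AE s in \<nu>. suminf s = 1"
    and pos: "AE s in \<nu>. \<forall>i. s i > 0"
    and dislocation: "(\<integral>\<^sup>+s. (\<Sum>i. ennreal (s i * (1 - s i))) \<partial>\<nu>) < \<infinity>"
begin

lemma sets_\<nu>' [measurable_cong]: "sets \<nu> = sets mass_partition_space"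
  by (rule sets_\<nu>)

lemma space_\<nu>: "space \<nu> = mass_partitions"
  using sets_eq_imp_space_eq[OF sets_\<nu>] by simp

lemma AE_proper: "AE s in \<nu>. proper_partition s"
  using sum_one pos AE_space by eventually_elim (auto simp: space_\<nu> intro: proper_partition.intro)

definition sb_seq :: "(nat \<Rightarrow> real) \<Rightarrow> (nat \<Rightarrow> real) \<Rightarrow> nat \<Rightarrow> real"
  where "sb_seq s u j = s (picks s u (Suc j) ! j)"

text \<open>The candidate for the size-biased measure. Driving all picks by one sequence of uniform
  variables makes the marginals consistent by construction, so no extension theorem for infinite
  measures is involved.\<close>

definition sb_measure :: "(nat \<Rightarrow> real) measure"
  where "sb_measure = distr (\<nu> \<Otimes>\<^sub>M uniform_seq) (\<Pi>\<^sub>M i\<in>UNIV. unit_interval) (\<lambda>(s, u). sb_seq s u)"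

lemma sb_seq_measurable [measurable]:
  "(\<lambda>(s, u). sb_seq s u) \<in> \<nu> \<Otimes>\<^sub>M uniform_seq \<rightarrow>\<^sub>M (\<Pi>\<^sub>M i\<in>UNIV. unit_interval)"
proof (rule measurable_PiM_single')
  fix j :: nat
  show "(\<lambda>p. (case p of (s, u) \<Rightarrow> sb_seq s u) j) \<in> \<nu> \<Otimes>\<^sub>M uniform_seq \<rightarrow>\<^sub>M unit_interval"
  proof (rule measurable_restrict_space2)
    show "(\<lambda>p. (case p of (s, u) \<Rightarrow> sb_seq s u) j) \<in> space (\<nu> \<Otimes>\<^sub>M uniform_seq) \<rightarrow> {0..1}"
      by (auto simp: space_pair_measure space_\<nu> sb_seq_def mass_partitionD)
    have "(\<lambda>p. fst p (picks (fst p) (snd p) (Suc j) ! j)) \<in> borel_measurable (mass_partition_space \<Otimes>\<^sub>M uniform_seq)"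
    proof (rule measurable_compose_countable)
      have "(\<lambda>p. picks (fst p) (snd p) (Suc j)) \<in> mass_partition_space \<Otimes>\<^sub>M uniform_seq \<rightarrow>\<^sub>M count_space UNIV"
        using picks_measurable[of "Suc j"] by (simp add: case_prod_beta')
      then show "(\<lambda>p. picks (fst p) (snd p) (Suc j) ! j) \<in> mass_partition_space \<Otimes>\<^sub>M uniform_seq \<rightarrow>\<^sub>M count_space UNIV"
        by (rule measurable_compose) simp
    qed measurable
    then show "(\<lambda>p. (case p of (s, u) \<Rightarrow> sb_seq s u) j) \<in> borel_measurable (\<nu> \<Otimes>\<^sub>M uniform_seq)"
      by (simp add: sb_seq_def case_prod_beta' cong: measurable_cong_sets)
  qed
qed (auto simp: space_PiM space_pair_measure space_\<nu> sb_seq_def mass_partitionD(2,5) simp del: picks.simps)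

lemma sets_sb_measure [simp, measurable_cong]: "sets sb_measure = sets (\<Pi>\<^sub>M i\<in>UNIV. unit_interval)"
  by (simp add: sb_measure_def)

lemma space_sb_measure: "space sb_measure = space (\<Pi>\<^sub>M i\<in>UNIV. unit_interval)"
  by (simp add: sb_measure_def)

lemma emeasure_picks:
  assumes "proper_partition s"
  shows "emeasure uniform_seq {u \<in> space uniform_seq. picks s u k = is}
    = (if is \<in> distinct_lists k UNIV then ennreal (sb_weight k s is) else 0)"
proof (cases "length is = k")
  case True
  interpret proper_partition s by fact
  interpret product_prob_space "\<lambda>_::nat. uniform_measure lborel {0..<1::real}" UNIV
    by (simp add: product_prob_space_def product_prob_space_axioms_def product_sigma_finite_def prob_uniform
      prob_space_imp_sigma_finite)
  have meas: "{v. pick s (take j is) v = is ! j} \<in> sets borel" for j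
  proof -
    have "(\<lambda>v. pick s (take j is) v) \<in> borel \<rightarrow>\<^sub>M count_space UNIV" unfolding pick_def by measurable
    then have "Measurable.pred borel (\<lambda>v. pick s (take j is) v = is ! j)" by measurable
    then show ?thesis by (simp add: pred_def)
  qed
  have "{u \<in> space uniform_seq. picks s u k = is}
    = {u \<in> space uniform_seq. \<forall>j\<in>{..<k}. u j \<in> {v. pick s (take j is) v = is ! j}}"
    using True by (simp add: picks_eq_iff)
  then have "emeasure uniform_seq {u \<in> space uniform_seq. picks s u k = is}
    = (\<Prod>j\<in>{..<k}. emeasure (uniform_measure lborel {0..<1}) {v. pick s (take j is) v = is ! j})"
    unfolding uniform_seq_def by (simp only:) (intro emeasure_PiM_Collect, use meas in auto)
  also have "\<dots> = (\<Prod>j\<in>{..<k}. ennreal (if is ! j \<in> set (take j is) then 0 else s (is ! j) / rest_mass s (take j is)))"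
  proof (intro prod.cong refl)
    fix j
    have "emeasure (uniform_measure lborel {0..<1}) {v. pick s (take j is) v = is ! j}
      = emeasure lborel ({0..<1} \<inter> {v. pick s (take j is) v = is ! j}) / emeasure lborel {0..<1::real}"
      by (rule emeasure_uniform_measure) (use meas in auto)
    also have "{0..<1} \<inter> {v. pick s (take j is) v = is ! j} = {v \<in> {0..<1}. pick s (take j is) v = is ! j}" by auto
    finally show "emeasure (uniform_measure lborel {0..<1}) {v. pick s (take j is) v = is ! j}
      = ennreal (if is ! j \<in> set (take j is) then 0 else s (is ! j) / rest_mass s (take j is))"
      unfolding emeasure_pick by (simp add: divide_ennreal_def)
  qed
  also have "\<dots> = ennreal (\<Prod>j\<in>{..<k}. if is ! j \<in> set (take j is) then 0 else s (is ! j) / rest_mass s (take j is))"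
    using pos rest_mass_pos by (intro prod_ennreal) (auto intro!: divide_nonneg_pos less_imp_le)
  also have "\<dots> = ennreal (if distinct is then sb_weight k s is else 0)"
    unfolding prod_pick_probabilities[OF True] ..
  finally show ?thesis using True by (simp add: distinct_lists_def)
next
  case False
  then have "{u \<in> space uniform_seq. picks s u k = is} = {}" by auto
  then have "emeasure uniform_seq {u \<in> space uniform_seq. picks s u k = is} = 0" by (simp only: emeasure_empty)
  then show ?thesis using False by (simp add: distinct_lists_def)
qed

lemma picks_section_measurable:
  assumes "s \<in> mass_partitions"
  shows "(\<lambda>u. picks s u k) \<in> uniform_seq \<rightarrow>\<^sub>M count_space UNIV"
proof -
  have "(\<lambda>u. (\<lambda>(s, u). picks s u k) (s, u)) \<in> uniform_seq \<rightarrow>\<^sub>M count_space UNIV"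
    by (rule measurable_compose[OF measurable_Pair1' picks_measurable]) (use assms in simp)
  then show ?thesis by simp
qed

lemma nn_integral_picks:
  assumes "proper_partition s"
  shows "(\<integral>\<^sup>+u. G (picks s u k) \<partial>uniform_seq) = (\<integral>\<^sup>+is. ennreal (sb_weight k s is) * G is \<partial>count_space (distinct_lists k UNIV))"
proof -
  interpret proper_partition s by fact
  note [measurable] = picks_section_measurable[OF in_mp]
  have "(\<integral>\<^sup>+u. G (picks s u k) \<partial>uniform_seq)
     = (\<integral>\<^sup>+u. \<integral>\<^sup>+is. G is * indicator {u \<in> space uniform_seq. picks s u k = is} u \<partial>count_space UNIV \<partial>uniform_seq)"
  proof (intro nn_integral_cong)
    fix u assume u: "u \<in> space uniform_seq"
    have "(\<integral>\<^sup>+is. G is * indicator {u \<in> space uniform_seq. picks s u k = is} u \<partial>count_space UNIV)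
      = (\<Sum>is\<in>{picks s u k}. G is * indicator {u \<in> space uniform_seq. picks s u k = is} u)"
      by (intro nn_integral_count_space') auto
    then show "G (picks s u k) = (\<integral>\<^sup>+is. G is * indicator {u \<in> space uniform_seq. picks s u k = is} u \<partial>count_space UNIV)"
      using u by simp
  qed
  also have "\<dots> = (\<integral>\<^sup>+is. \<integral>\<^sup>+u. G is * indicator {u \<in> space uniform_seq. picks s u k = is} u \<partial>uniform_seq \<partial>count_space UNIV)"
    by (rule nn_integral_count_space_nn_integral) auto
  also have "\<dots> = (\<integral>\<^sup>+is. G is * emeasure uniform_seq {u \<in> space uniform_seq. picks s u k = is} \<partial>count_space UNIV)"
    by (intro nn_integral_cong nn_integral_cmult_indicator) simp
  also have "\<dots> = (\<integral>\<^sup>+is. (ennreal (sb_weight k s is) * G is) * indicator (distinct_lists k UNIV) is \<partial>count_space UNIV)"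
    unfolding emeasure_picks[OF assms] by (intro nn_integral_cong) (auto simp: indicator_def mult.commute)
  finally show ?thesis by (simp add: nn_integral_count_space_indicator)
qed

lemma nn_integral_sb_measure:
  assumes F [measurable]: "F \<in> borel_measurable (\<Pi>\<^sub>M i\<in>{..<k}. unit_interval)"
  shows "(\<integral>\<^sup>+x. F (restrict x {..<k}) \<partial>sb_measure)
    = (\<integral>\<^sup>+s. \<integral>\<^sup>+is. ennreal (sb_weight k s is) * F (\<lambda>j\<in>{..<k}. s (is ! j)) \<partial>count_space (distinct_lists k UNIV) \<partial>\<nu>)"
proof -
  interpret prob_space uniform_seq by (rule prob_uniform_seq)
  have [measurable]: "(\<lambda>x. F (restrict x {..<k})) \<in> borel_measurable (\<Pi>\<^sub>M i\<in>UNIV. unit_interval)"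
    by (rule measurable_compose[OF measurable_restrict_subset F]) simp
  have seq: "restrict (sb_seq s u) {..<k} = (\<lambda>j\<in>{..<k}. s (picks s u k ! j))" for s u
  proof
    fix j
    show "restrict (sb_seq s u) {..<k} j = (\<lambda>j\<in>{..<k}. s (picks s u k ! j)) j"
      using nth_picks[of j "Suc j" k s u] by (simp add: sb_seq_def del: picks.simps)
  qed
  have "(\<integral>\<^sup>+x. F (restrict x {..<k}) \<partial>sb_measure) = (\<integral>\<^sup>+p. F (restrict (case p of (s, u) \<Rightarrow> sb_seq s u) {..<k}) \<partial>(\<nu> \<Otimes>\<^sub>M uniform_seq))"
    unfolding sb_measure_def by (rule nn_integral_distr) auto
  also have "\<dots> = (\<integral>\<^sup>+s. \<integral>\<^sup>+u. F (restrict (case (s, u) of (s, u) \<Rightarrow> sb_seq s u) {..<k}) \<partial>uniform_seq \<partial>\<nu>)"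
    \<comment> \<open>The possibly infinite measure \<open>\<nu>\<close> stays outermost: in this
      direction Tonelli's theorem asks for sigma-finiteness of the inner measure, here a
      probability.\<close>
    by (rule nn_integral_fst[symmetric]) measurable
  also have "\<dots> = (\<integral>\<^sup>+s. \<integral>\<^sup>+is. ennreal (sb_weight k s is) * F (\<lambda>j\<in>{..<k}. s (is ! j)) \<partial>count_space (distinct_lists k UNIV) \<partial>\<nu>)"
  proof (intro nn_integral_cong_AE, use AE_proper in eventually_elim)
    case (elim s)
    then show ?case using nn_integral_picks[of s "\<lambda>is. F (\<lambda>j\<in>{..<k}. s (is ! j))" k] by (simp add: seq)
  qed
  finally show ?thesis .
qed

lemma sb_weight_measurable [measurable]: "(\<lambda>s. sb_weight k s is) \<in> borel_measurable mass_partition_space"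
  unfolding sb_weight_def by measurable

lemma is_size_biased_sb_measure: "is_size_biased \<nu> sb_measure"
  unfolding is_size_biased_def
proof (intro conjI allI impI)
  fix k :: nat and A :: "nat \<Rightarrow> real set"
  assume A: "\<forall>j<k. A j \<in> sets unit_interval"
  have Ab: "A j \<in> sets borel" "A j \<subseteq> {0..1}" if "j < k" for j
    using A that by (auto simp: sets_restrict_space)
  let ?F = "\<lambda>x. indicator (Pi\<^sub>E {..<k} A) x :: ennreal"
  have F: "?F \<in> borel_measurable (\<Pi>\<^sub>M i\<in>{..<k}. unit_interval)"
    using A by (intro borel_measurable_indicator sets_PiM_I_finite) auto
  have "emeasure sb_measure {x \<in> space sb_measure. \<forall>j<k. x j \<in> A j}
    = (\<integral>\<^sup>+x. indicator {x \<in> space sb_measure. \<forall>j<k. x j \<in> A j} x \<partial>sb_measure)"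
  proof (rule nn_integral_indicator[symmetric])
    have "{x \<in> space sb_measure. \<forall>j<k. x j \<in> A j} = (\<Inter>j\<in>{..<k}. {x \<in> space sb_measure. x j \<in> A j}) \<inter> space sb_measure"
      by auto
    also have "\<dots> \<in> sets sb_measure"
    proof (cases "k = 0")
      case False
      have "{x \<in> space sb_measure. x j \<in> A j} \<in> sets sb_measure" if "j < k" for j
        using measurable_sets[OF measurable_component_singleton[of j UNIV "\<lambda>_. unit_interval"], of "A j"] A that
        by (simp add: vimage_def Int_def conj_commute space_sb_measure)
      then show ?thesis using False by (intro sets.Int sets.finite_INT sets.top) (auto simp: lessThan_empty_iff)
    qed (simp add: space_sb_measure)
    finally show "{x \<in> space sb_measure. \<forall>j<k. x j \<in> A j} \<in> sets sb_measure" .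
  qed
  also have "\<dots> = (\<integral>\<^sup>+x. ?F (restrict x {..<k}) \<partial>sb_measure)"
    by (intro nn_integral_cong) (auto simp: indicator_def PiE_iff)
  also have "\<dots> = (\<integral>\<^sup>+s. \<integral>\<^sup>+is. ennreal (sb_weight k s is) * ?F (\<lambda>j\<in>{..<k}. s (is ! j)) \<partial>count_space (distinct_lists k UNIV) \<partial>\<nu>)"
    by (rule nn_integral_sb_measure[OF F])
  also have "\<dots> = (\<integral>\<^sup>+s. \<integral>\<^sup>+is. ennreal (sb_weight k s is) * indicator {s \<in> space \<nu>. \<forall>j<k. s (is ! j) \<in> A j} s \<partial>count_space (distinct_lists k UNIV) \<partial>\<nu>)"
    by (intro nn_integral_cong) (auto simp: indicator_def PiE_iff)
  also have "\<dots> = (\<integral>\<^sup>+is. \<integral>\<^sup>+s. ennreal (sb_weight k s is) * indicator {s \<in> space \<nu>. \<forall>j<k. s (is ! j) \<in> A j} s \<partial>\<nu> \<partial>count_space (distinct_lists k UNIV))"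
  proof (rule nn_integral_count_space_nn_integral)
    fix "is"
    have "{s \<in> space \<nu>. \<forall>j<k. s (is ! j) \<in> A j} = {s \<in> space \<nu>. \<forall>j\<in>{..<k}. s (is ! j) \<in> A j}" by auto
    also have "\<dots> \<in> sets \<nu>"
    proof (rule sets.sets_Collect_finite_All)
      fix j assume "j \<in> {..<k}"
      then have [measurable]: "A j \<in> sets borel" using Ab by auto
      show "{s \<in> space \<nu>. s (is ! j) \<in> A j} \<in> sets \<nu>" by measurable
    qed simp
    finally have set: "{s \<in> space \<nu>. \<forall>j<k. s (is ! j) \<in> A j} \<in> sets \<nu>" .
    have "(\<lambda>s. ennreal (sb_weight k s is)) \<in> borel_measurable \<nu>" by measurable
    then show "(\<lambda>s. ennreal (sb_weight k s is) * indicator {s \<in> space \<nu>. \<forall>j<k. s (is ! j) \<in> A j} s) \<in> borel_measurable \<nu>"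
      by (rule borel_measurable_times_ennreal[OF _ borel_measurable_indicator[OF set]])
  qed simp
  also have "\<dots> = (\<Sum>\<^sub>\<infinity>is | length is = k \<and> distinct is.
           \<integral>\<^sup>+s\<in>{s \<in> space \<nu>. \<forall>j<k. s (is ! j) \<in> A j}.
             ennreal ((\<Prod>j<k. s (is ! j)) / (\<Prod>j=1..<k. 1 - (\<Sum>l<j. s (is ! l)))) \<partial>\<nu>)"
    by (subst infsum_ennreal_eq_nn_integral) (auto simp: sb_weight_def distinct_lists_def)
  finally show "emeasure sb_measure {x \<in> space sb_measure. \<forall>j<k. x j \<in> A j} = \<dots>" .
qed simp

text \<open>Exactly the events whose mass \<open>is_size_biased\<close> prescribes, hence the
  generator for the uniqueness proof.\<close>

definition cylinders :: "(nat \<Rightarrow> real) set set"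
  where "cylinders = {{x \<in> space (\<Pi>\<^sub>M i\<in>(UNIV :: nat set). unit_interval). \<forall>j<k. x j \<in> A j} |k A.
    k \<ge> 1 \<and> (\<forall>j<k. A j \<in> sets unit_interval)}"

lemma cylindersI:
  assumes "k \<ge> 1" "\<And>j. j < k \<Longrightarrow> A j \<in> sets unit_interval"
  shows "{x \<in> space (\<Pi>\<^sub>M i\<in>(UNIV :: nat set). unit_interval). \<forall>j<k. x j \<in> A j} \<in> cylinders"
  unfolding cylinders_def using assms by blast

lemma Int_stable_cylinders: "Int_stable cylinders"
proof (rule Int_stableI)
  fix a b assume "a \<in> cylinders" "b \<in> cylinders"
  then obtain k A l B where a: "a = {x \<in> space (\<Pi>\<^sub>M i\<in>(UNIV :: nat set). unit_interval). \<forall>j<k. x j \<in> A j}"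
      "k \<ge> 1" "\<forall>j<k. A j \<in> sets unit_interval"
    and b: "b = {x \<in> space (\<Pi>\<^sub>M i\<in>(UNIV :: nat set). unit_interval). \<forall>j<l. x j \<in> B j}"
      "l \<ge> 1" "\<forall>j<l. B j \<in> sets unit_interval"
    unfolding cylinders_def by blast
  define C where "C j = (if j < k then A j else {0..1}) \<inter> (if j < l then B j else {0..1})" for j
  have top: "{0..1} \<in> sets unit_interval" by (auto simp: sets_restrict_space)
  have sub: "D \<subseteq> {0..1}" if "D \<in> sets unit_interval" for D :: "real set" using that by (auto simp: sets_restrict_space)
  have "a \<inter> b = {x \<in> space (\<Pi>\<^sub>M i\<in>(UNIV :: nat set). unit_interval). \<forall>j<max k l. x j \<in> C j}"
  proof (intro set_eqI)
    fix x
    show "x \<in> a \<inter> b \<longleftrightarrow> x \<in> {x \<in> space (\<Pi>\<^sub>M i\<in>(UNIV :: nat set). unit_interval). \<forall>j<max k l. x j \<in> C j}"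
    proof (cases "x \<in> space (\<Pi>\<^sub>M i\<in>(UNIV :: nat set). unit_interval)")
      case True
      then have "x j \<in> {0..1}" for j by (auto simp: space_PiM)
      then have "x j \<in> C j \<longleftrightarrow> (j < k \<longrightarrow> x j \<in> A j) \<and> (j < l \<longrightarrow> x j \<in> B j)" for j unfolding C_def by simp
      then show ?thesis unfolding a(1) b(1) using True less_max_iff_disj[of _ k l] by blast
    qed (simp add: a(1) b(1))
  qed
  moreover have "C j \<in> sets unit_interval" for j
    unfolding C_def using a(3) b(3) top by (intro sets.Int) auto
  ultimately show "a \<inter> b \<in> cylinders"
    using a(2) cylindersI[of "max k l" C] by simp
qed

lemma sets_cylinders: "sets (\<Pi>\<^sub>M i\<in>(UNIV :: nat set). unit_interval)
  = sigma_sets (space (\<Pi>\<^sub>M i\<in>(UNIV :: nat set). unit_interval)) cylinders"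
proof
  let ?M = "\<Pi>\<^sub>M i\<in>(UNIV :: nat set). unit_interval"
  have top: "{0..1} \<in> sets unit_interval" by (auto simp: sets_restrict_space)
  show "sets ?M \<subseteq> sigma_sets (space ?M) cylinders"
    unfolding sets_PiM_single space_PiM[symmetric]
  proof (rule sigma_sets_mono)
    show "{{f \<in> space ?M. f i \<in> A} |i A. i \<in> UNIV \<and> A \<in> sets unit_interval} \<subseteq> sigma_sets (space ?M) cylinders"
    proof
      fix X assume "X \<in> {{f \<in> space ?M. f i \<in> A} |i A. i \<in> UNIV \<and> A \<in> sets unit_interval}"
      then obtain i A where X: "X = {f \<in> space ?M. f i \<in> A}" "A \<in> sets unit_interval" by auto
      define B where "B j = (if j = i then A else {0..1})" for j
      have "X = {f \<in> space ?M. \<forall>j<Suc i. f j \<in> B j}"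
        unfolding X(1) B_def by (auto simp: space_PiM)
      also have "\<dots> \<in> cylinders" by (rule cylindersI) (auto simp: B_def X top)
      finally show "X \<in> sigma_sets (space ?M) cylinders" by (rule sigma_sets.Basic)
    qed
  qed
  show "sigma_sets (space ?M) cylinders \<subseteq> sets ?M"
  proof (rule sets.sigma_sets_subset, rule)
    fix X assume "X \<in> cylinders"
    then obtain k A where X: "X = {x \<in> space ?M. \<forall>j<k. x j \<in> A j}" "k \<ge> 1" "\<forall>j<k. A j \<in> sets unit_interval"
      unfolding cylinders_def by blast
    have "{x \<in> space ?M. \<forall>j\<in>{..<k}. x j \<in> A j} \<in> sets ?M"
    proof (rule sets.sets_Collect_finite_All)
      fix j assume "j \<in> {..<k}"
      then show "{x \<in> space ?M. x j \<in> A j} \<in> sets ?M"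
        using measurable_sets[OF measurable_component_singleton[of j UNIV "\<lambda>_. unit_interval"], of "A j"] X
        by (simp add: vimage_def Int_def conj_commute)
    qed simp
    then show "X \<in> sets ?M" unfolding X(1) Ball_def lessThan_iff .
  qed
qed

text \<open>An infinite \<open>\<nu>\<close> concentrates near the partition with a single part, so
  finite mass needs a first pick bounded away from 1; there \<open>s i\<close> is at most
  \<open>(n + 1) * s i * (1 - s i)\<close>. The point 1 is added to let these events exhaust the
  space. It carries no mass, all parts being less than 1.\<close>

lemma sb_measure_cover_finite:
  "emeasure sb_measure {x \<in> space (\<Pi>\<^sub>M i\<in>(UNIV :: nat set). unit_interval). \<forall>j<1::nat. x j \<in> {0..1 - 1 / real (Suc n)} \<union> {1}} < \<infinity>"
proof -
  let ?M = "\<Pi>\<^sub>M i\<in>(UNIV :: nat set). unit_interval"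
  let ?A = "{0..1 - 1 / real (Suc n)} \<union> {1}"
  let ?F = "\<lambda>x. indicator ?A (x (0::nat)) :: ennreal"
  have [measurable]: "(\<lambda>x. x (0::nat)) \<in> borel_measurable (\<Pi>\<^sub>M i\<in>I. unit_interval)" if "0 \<in> I" for I
    using measurable_component_singleton[OF that, of "\<lambda>_. unit_interval"]
    by (simp add: measurable_restrict_space2_iff)
  have F: "?F \<in> borel_measurable (\<Pi>\<^sub>M i\<in>{..<1::nat}. unit_interval)" by measurable
  have "emeasure sb_measure {x \<in> space ?M. \<forall>j<1::nat. x j \<in> ?A}
    = (\<integral>\<^sup>+x. indicator {x \<in> space ?M. \<forall>j<1::nat. x j \<in> ?A} x \<partial>sb_measure)"
    by (rule nn_integral_indicator[symmetric]) simp
  also have "\<dots> = (\<integral>\<^sup>+x. ?F (restrict x {..<1}) \<partial>sb_measure)"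
    by (intro nn_integral_cong) (auto simp: indicator_def space_sb_measure)
  also have "\<dots> = (\<integral>\<^sup>+s. \<integral>\<^sup>+is. ennreal (sb_weight 1 s is) * ?F (\<lambda>j\<in>{..<1}. s (is ! j)) \<partial>count_space (distinct_lists 1 UNIV) \<partial>\<nu>)"
    by (rule nn_integral_sb_measure[OF F])
  also have "\<dots> \<le> (\<integral>\<^sup>+s. ennreal (real (Suc n)) * (\<Sum>i. ennreal (s i * (1 - s i))) \<partial>\<nu>)"
  proof (intro nn_integral_mono_AE, use AE_proper in eventually_elim)
    case (elim s)
    interpret proper_partition s by fact
    have lt1: "s i < 1" for i
    proof -
      have "sum s {i, Suc i} \<le> suminf s"
        using mass_partitionD[OF in_mp] by (intro sum_le_suminf) auto
      then show ?thesis using pos[of "Suc i"] sum_one by simp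
    qed
    have "(\<integral>\<^sup>+is. ennreal (sb_weight 1 s is) * ?F (\<lambda>j\<in>{..<1}. s (is ! j)) \<partial>count_space (distinct_lists 1 UNIV))
      = (\<integral>\<^sup>+i. ennreal (sb_weight 1 s [i]) * ?F (\<lambda>j\<in>{..<1}. s ([i] ! j)) \<partial>count_space UNIV)"
      by (rule nn_integral_bij_count_space[OF distinct_lists_1, symmetric])
    also have "\<dots> \<le> (\<integral>\<^sup>+i. ennreal (real (Suc n)) * ennreal (s i * (1 - s i)) \<partial>count_space UNIV)"
    proof (intro nn_integral_mono)
      fix i
      have "s i \<le> real (Suc n) * (s i * (1 - s i))" if "s i \<in> ?A"
      proof -
        have "s i \<le> 1 - 1 / real (Suc n)" using that lt1[of i] by auto
        then have "1 \<le> real (Suc n) * (1 - s i)" by (simp add: field_simps)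
        then have "s i * 1 \<le> s i * (real (Suc n) * (1 - s i))" using pos[of i] by (intro mult_left_mono) auto
        then show ?thesis by (simp add: mult_ac)
      qed
      then show "ennreal (sb_weight 1 s [i]) * ?F (\<lambda>j\<in>{..<1}. s ([i] ! j)) \<le> ennreal (real (Suc n)) * ennreal (s i * (1 - s i))"
        by (auto simp: sb_weight_def indicator_def ennreal_mult'[symmetric] simp del: of_nat_Suc intro!: ennreal_leI)
    qed
    also have "\<dots> = ennreal (real (Suc n)) * (\<Sum>i. ennreal (s i * (1 - s i)))"
      by (simp add: nn_integral_cmult nn_integral_count_space_nat del: of_nat_Suc)
    finally show ?case .
  qed
  also have "\<dots> = ennreal (real (Suc n)) * (\<integral>\<^sup>+s. (\<Sum>i. ennreal (s i * (1 - s i))) \<partial>\<nu>)"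
    by (rule nn_integral_cmult) measurable
  also have "\<dots> < \<infinity>" using dislocation by (auto simp: ennreal_mult_less_top)
  finally show ?thesis .
qed

text \<open>\<open>size_biased\<close> is a definite description, so existence has to be completed
  by uniqueness: cylinders are closed under intersection, generate the sigma-algebra, and those of
  \<open>sb_measure_cover_finite\<close> exhaust the space with finite mass.\<close>

lemma size_biased_eq: "size_biased \<nu> = sb_measure"
  unfolding size_biased_def
proof (rule the_equality)
  let ?M = "\<Pi>\<^sub>M i\<in>(UNIV :: nat set). unit_interval"
  fix N assume N: "is_size_biased \<nu> N"
  then have sN: "sets N = sets ?M" by (simp add: is_size_biased_def)
  have spN: "space N = space ?M" using sets_eq_imp_space_eq[OF sN] .
  define C where "C n = {x \<in> space ?M. \<forall>j<1::nat. x j \<in> {0..1 - 1 / real (Suc n)} \<union> {1}}" for n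
  show "N = sb_measure"
  proof (rule measure_eqI_generator_eq[OF Int_stable_cylinders, where A=C])
    show "cylinders \<subseteq> Pow (space ?M)" by (auto simp: cylinders_def)
    show "sets N = sigma_sets (space ?M) cylinders" "sets sb_measure = sigma_sets (space ?M) cylinders"
      using sN sets_cylinders by auto
    have eq: "emeasure N X = emeasure sb_measure X" if "X \<in> cylinders" for X
    proof -
      obtain k A where X: "X = {x \<in> space ?M. \<forall>j<k. x j \<in> A j}" "k \<ge> 1" "\<forall>j<k. A j \<in> sets unit_interval"
        using \<open>X \<in> cylinders\<close> unfolding cylinders_def by blast
      show ?thesis
      proof -
        have f: "emeasure P X = (\<Sum>\<^sub>\<infinity>is | length is = k \<and> distinct is.
           \<integral>\<^sup>+s\<in>{s \<in> space \<nu>. \<forall>j<k. s (is ! j) \<in> A j}.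
             ennreal ((\<Prod>j<k. s (is ! j)) / (\<Prod>j=1..<k. 1 - (\<Sum>l<j. s (is ! l)))) \<partial>\<nu>)"
          if P: "is_size_biased \<nu> P" for P
        proof -
          have "space P = space ?M" using P sets_eq_imp_space_eq[of P ?M] by (simp add: is_size_biased_def)
          then have "X = {x \<in> space P. \<forall>j<k. x j \<in> A j}" unfolding X(1) by (simp only:)
          moreover note conjunct2[OF P[unfolded is_size_biased_def], rule_format, OF X(2), of A] X(3)
          ultimately show ?thesis by (simp only:)
        qed
        show ?thesis unfolding f[OF N] f[OF is_size_biased_sb_measure] ..
      qed
    qed
    then show "\<And>X. X \<in> cylinders \<Longrightarrow> emeasure N X = emeasure sb_measure X" .
    have CE: "C n \<in> cylinders" for n
    proof -
      have "0 \<le> 1 / real (Suc n)" by simp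
      then have "{0..1 - 1 / real (Suc n)} \<union> {1} \<subseteq> {0..1}" by (simp del: of_nat_Suc)
      then have "{0..1 - 1 / real (Suc n)} \<union> {1} \<in> sets unit_interval"
        by (subst sets_restrict_space_iff) auto
      then show ?thesis unfolding C_def by (intro cylindersI) auto
    qed
    then show "range C \<subseteq> cylinders" by auto
    show "emeasure N (C i) \<noteq> \<infinity>" for i
      using eq[OF CE] sb_measure_cover_finite[of i] by (simp add: C_def)
    show "(\<Union>i. C i) = space ?M"
    proof
      show "space ?M \<subseteq> (\<Union>i. C i)"
      proof
        fix x assume x: "x \<in> space ?M"
        then have x0: "x 0 \<in> {0..1}" by (auto simp: space_PiM)
        show "x \<in> (\<Union>i. C i)"
        proof (cases "x 0 = 1")
          case False
          then obtain n where "1 / real (Suc n) < 1 - x 0" using x0 nat_approx_posE[of "1 - x 0"] by auto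
          then show ?thesis using x x0 by (auto simp: C_def intro!: exI[of _ n])
        qed (use x in \<open>auto simp: C_def\<close>)
      qed
    qed (auto simp: C_def)
  qed
qed (rule is_size_biased_sb_measure)

lemma nn_integral_first_marginals:
  assumes F [measurable]: "F \<in> borel_measurable (\<Pi>\<^sub>M i\<in>{..<k}. unit_interval)"
  shows "(\<integral>\<^sup>+x. F x \<partial>first_marginals k (size_biased \<nu>))
    = (\<integral>\<^sup>+s. \<integral>\<^sup>+is. ennreal (sb_weight k s is) * F (\<lambda>j\<in>{..<k}. s (is ! j)) \<partial>count_space (distinct_lists k UNIV) \<partial>\<nu>)"
  unfolding first_marginals_def size_biased_eq nn_integral_sb_measure[OF F, symmetric]
  by (rule nn_integral_distr) (auto intro: measurable_restrict_subset)

end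

section \<open>The alpha-gamma dislocation measure\<close>

lemma infsum_off_diagonal:
  assumes s: "s \<in> mass_partitions"
  shows "(\<Sum>\<^sub>\<infinity>(i, j)\<in>{(i, j). i \<noteq> j}. s i * s j) = (suminf s)\<^sup>2 - (\<Sum>i. (s i)\<^sup>2)"
    "summable (\<lambda>i. (s i)\<^sup>2)" "(\<Sum>i. (s i)\<^sup>2) \<le> (suminf s)\<^sup>2"
proof -
  note mp = mass_partitionD[OF s]
  have S: "(s has_sum suminf s) UNIV" using mp by (intro sums_nonneg_imp_has_sum summable_sums) auto
  have le: "s i \<le> suminf s" for i using sum_le_suminf[OF mp(3), of "{i}"] mp(2) by auto
  have sq: "summable (\<lambda>i. (s i)\<^sup>2)"
    by (rule summable_comparison_test'[OF mp(3)]) (use mp in \<open>auto simp: power2_eq_square mult_left_le\<close>)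
  then show "summable (\<lambda>i. (s i)\<^sup>2)" .
  let ?g = "\<lambda>i. s i * (suminf s - s i)"
  have "?g sums (suminf s * suminf s - (\<Sum>i. (s i)\<^sup>2))"
    using sums_diff[OF sums_mult[OF summable_sums[OF mp(3)], of "suminf s"] summable_sums[OF sq]]
    by (simp add: algebra_simps power2_eq_square)
  then have gs: "?g sums ((suminf s)\<^sup>2 - (\<Sum>i. (s i)\<^sup>2))" by (simp add: power2_eq_square)
  have g0: "?g i \<ge> 0" for i using le mp(2) by (intro mult_nonneg_nonneg) auto
  show "(\<Sum>i. (s i)\<^sup>2) \<le> (suminf s)\<^sup>2" using sums_le[OF g0 sums_zero gs] by simp
  have g: "(?g has_sum ((suminf s)\<^sup>2 - (\<Sum>i. (s i)\<^sup>2))) UNIV"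
    by (rule sums_nonneg_imp_has_sum[OF gs g0])
  let ?f = "\<lambda>(i, j). s i * s j"
  have f: "((\<lambda>j. ?f (i, j)) has_sum ?g i) (UNIV - {i})" for i
    using has_sum_cmult_right[OF has_sum_Diff[OF S has_sum_finite[of "{i}" s]], of "s i"] by simp
  have "(?f has_sum ((suminf s)\<^sup>2 - (\<Sum>i. (s i)\<^sup>2))) (Sigma UNIV (\<lambda>i. UNIV - {i}))"
    by (intro has_sum_SigmaI[OF f g] summable_on_SigmaI[OF f]) (use g mp(2) in \<open>auto simp: summable_on_def\<close>)
  moreover have "Sigma UNIV (\<lambda>i. UNIV - {i}) = {(i, j). i \<noteq> (j :: nat)}" by auto
  ultimately show "(\<Sum>\<^sub>\<infinity>(i, j)\<in>{(i, j). i \<noteq> j}. s i * s j) = (suminf s)\<^sup>2 - (\<Sum>i. (s i)\<^sup>2)"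
    by (simp add: infsumI)
qed

lemma (in size_bias) size_bias_density:
  assumes f [measurable]: "f \<in> borel_measurable mass_partition_space" and le: "\<And>s. s \<in> mass_partitions \<Longrightarrow> f s \<le> 1"
  shows "size_bias (density \<nu> f)"
proof
  have m: "f \<in> borel_measurable \<nu>" by measurable
  show "sets (density \<nu> f) = sets mass_partition_space" by (simp add: sets_\<nu>)
  show "AE s in density \<nu> f. suminf s = 1" using sum_one by (subst AE_density[OF m]) (auto elim: eventually_mono)
  show "AE s in density \<nu> f. \<forall>i. 0 < s i" using pos by (subst AE_density[OF m]) (auto elim: eventually_mono)
  have "(\<integral>\<^sup>+s. (\<Sum>i. ennreal (s i * (1 - s i))) \<partial>density \<nu> f) = (\<integral>\<^sup>+s. f s * (\<Sum>i. ennreal (s i * (1 - s i))) \<partial>\<nu>)"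
    by (rule nn_integral_density) measurable
  also have "\<dots> \<le> (\<integral>\<^sup>+s. 1 * (\<Sum>i. ennreal (s i * (1 - s i))) \<partial>\<nu>)"
    by (intro nn_integral_mono mult_right_mono le) (auto simp: space_\<nu>)
  finally show "(\<integral>\<^sup>+s. (\<Sum>i. ennreal (s i * (1 - s i))) \<partial>density \<nu> f) < \<infinity>" using dislocation by simp
qed

lemma unit_coordinate_measurable:
  "j \<in> I \<Longrightarrow> (\<lambda>x. x j) \<in> borel_measurable (\<Pi>\<^sub>M i\<in>I. unit_interval)"
  using measurable_component_singleton[of j I "\<lambda>_. unit_interval"] by (simp add: measurable_restrict_space2_iff)

text \<open>The first coordinate has the same law in all marginals, so the computation reduces to
  \<open>k = 1\<close>, where \<open>sb_weight\<close> is the part itself.\<close>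

lemma (in size_bias) nn_integral_first_coordinate:
  assumes k: "k \<ge> 1" and f [measurable]: "f \<in> borel_measurable borel"
  shows "(\<integral>\<^sup>+x. f (x 0) \<partial>first_marginals k (size_biased \<nu>)) = (\<integral>\<^sup>+s. (\<Sum>i. ennreal (s i) * f (s i)) \<partial>\<nu>)"
proof -
  have F: "(\<lambda>x. f (x 0)) \<in> borel_measurable (\<Pi>\<^sub>M i\<in>{..<n}. unit_interval)" if "n \<ge> 1" for n :: nat
    by (rule measurable_compose[OF unit_coordinate_measurable f]) (use that in auto)
  have "(\<integral>\<^sup>+x. f (x 0) \<partial>first_marginals n (size_biased \<nu>)) = (\<integral>\<^sup>+x. f (x 0) \<partial>sb_measure)" if "n \<ge> 1" for n
    unfolding first_marginals_def size_biased_eq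
    by (subst nn_integral_distr) (use that F[OF that] in \<open>auto intro: measurable_restrict_subset\<close>)
  from this[OF k] this[of 1]
  have "(\<integral>\<^sup>+x. f (x 0) \<partial>first_marginals k (size_biased \<nu>)) = (\<integral>\<^sup>+x. f (x 0) \<partial>first_marginals 1 (size_biased \<nu>))" by simp
  also have "\<dots> = (\<integral>\<^sup>+s. \<integral>\<^sup>+is. ennreal (sb_weight 1 s is) * f ((\<lambda>j\<in>{..<1}. s (is ! j)) 0) \<partial>count_space (distinct_lists 1 UNIV) \<partial>\<nu>)"
    by (rule nn_integral_first_marginals[OF F]) simp
  also have "\<dots> = (\<integral>\<^sup>+s. (\<Sum>i. ennreal (s i) * f (s i)) \<partial>\<nu>)"
  proof (intro nn_integral_cong)
    fix s :: "nat \<Rightarrow> real"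
    have "(\<integral>\<^sup>+is. ennreal (sb_weight 1 s is) * f ((\<lambda>j\<in>{..<1}. s (is ! j)) 0) \<partial>count_space (distinct_lists 1 UNIV))
      = (\<integral>\<^sup>+i. ennreal (sb_weight 1 s [i]) * f ((\<lambda>j\<in>{..<1}. s ([i] ! j)) 0) \<partial>count_space UNIV)"
      by (rule nn_integral_bij_count_space[OF distinct_lists_1, symmetric])
    then show "(\<integral>\<^sup>+is. ennreal (sb_weight 1 s is) * f ((\<lambda>j\<in>{..<1}. s (is ! j)) 0) \<partial>count_space (distinct_lists 1 UNIV))
      = (\<Sum>i. ennreal (s i) * f (s i))"
      by (simp add: sb_weight_def nn_integral_count_space_nat)
  qed
  finally show ?thesis .
qed

text \<open>Marginal events are sets of vectors over \<open>unit_interval\<close>, while the Mecke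
  formula speaks of real vectors. Clamping extends the indicator of such an event measurably to all
  of them.\<close>

lemma clamp_measurable:
  "(\<lambda>x. \<lambda>j\<in>{..<k}. min 1 (max 0 (x j))) \<in> (\<Pi>\<^sub>M j\<in>{..<k}. borel) \<rightarrow>\<^sub>M (\<Pi>\<^sub>M j\<in>{..<k}. unit_interval)"
proof (rule measurable_restrict)
  fix j assume j: "j \<in> {..<k}"
  have "(\<lambda>x. min 1 (max 0 (x j))) \<in> borel_measurable (\<Pi>\<^sub>M j\<in>{..<k}. borel :: real measure)"
    by (intro borel_measurable_min borel_measurable_max measurable_component_singleton[OF j]) auto
  then show "(\<lambda>x. min 1 (max 0 (x j))) \<in> (\<Pi>\<^sub>M j\<in>{..<k}. borel) \<rightarrow>\<^sub>M unit_interval"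
    by (rule measurable_restrict_space2[rotated]) auto
qed

definition vector_weight :: "nat \<Rightarrow> (nat \<Rightarrow> real) \<Rightarrow> real"
  where "vector_weight k x = (\<Prod>j<k. x j) / (\<Prod>j=1..<k. 1 - (\<Sum>l<j. x l))"

lemma vector_weight_measurable: "vector_weight k \<in> borel_measurable (\<Pi>\<^sub>M j\<in>{..<k}. borel)"
  unfolding vector_weight_def
  by (intro borel_measurable_divide borel_measurable_prod borel_measurable_diff borel_measurable_sum
    measurable_component_singleton) auto

lemma sb_weight_eq: "sb_weight k s is = vector_weight k (\<lambda>j\<in>{..<k}. s (is ! j))"
proof -
  have "(\<Prod>j=1..<k. 1 - (\<Sum>l<j. s (is ! l))) = (\<Prod>j=1..<k. 1 - (\<Sum>l<j. (\<lambda>j\<in>{..<k}. s (is ! j)) l))"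
    by (intro prod.cong arg_cong2[where f="(-)"] sum.cong) auto
  then show ?thesis by (simp add: sb_weight_def vector_weight_def)
qed

section \<open>The law of the normalised jumps\<close>

locale alpha_gamma = stable_jumps M \<sigma> \<alpha> for M :: "'a measure" and \<sigma> \<alpha> +
  fixes \<gamma> :: real
  assumes gamma: "0 \<le> \<gamma>" "\<gamma> < \<alpha>"
begin

text \<open>The coefficient 1 - \<alpha> - \<gamma> may be negative, but the expression is the
  convex combination of \<gamma> and 1 - \<alpha> with weights \<open>1 - y\<close> and
  \<open>y\<close>.\<close>

lemma convex_weight:
  assumes "0 \<le> y" "y \<le> 1"
  shows "0 \<le> \<gamma> + (1 - \<alpha> - \<gamma>) * y" "\<gamma> + (1 - \<alpha> - \<gamma>) * y \<le> 1"
proof -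
  have e: "\<gamma> + (1 - \<alpha> - \<gamma>) * y = \<gamma> * (1 - y) + (1 - \<alpha>) * y" by (simp add: algebra_simps)
  show "0 \<le> \<gamma> + (1 - \<alpha> - \<gamma>) * y" unfolding e using assms gamma index by (intro add_nonneg_nonneg mult_nonneg_nonneg) auto
  have "\<gamma> * (1 - y) \<le> 1 * (1 - y)" "(1 - \<alpha>) * y \<le> 1 * y" using assms gamma index by (intro mult_right_mono; simp)+
  then show "\<gamma> + (1 - \<alpha> - \<gamma>) * y \<le> 1" unfolding e by simp
qed

definition normalized_jumps :: "'a \<Rightarrow> nat \<Rightarrow> real"
  where "normalized_jumps \<omega> i = Z i \<omega> / T \<omega>"

abbreviation PD :: "(nat \<Rightarrow> real) measure"
  where "PD \<equiv> PD_star M \<sigma> (- \<alpha> - \<gamma>)"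

abbreviation tilt :: "'a \<Rightarrow> ennreal"
  where "tilt \<omega> \<equiv> ennreal (T \<omega> powr (- (- \<alpha> - \<gamma>)))"

lemma normalized_jumps_in: "\<omega> \<in> space M \<Longrightarrow> normalized_jumps \<omega> \<in> mass_partitions"
proof -
  assume \<omega>: "\<omega> \<in> space M"
  have T: "T \<omega> \<ge> 0" by (rule T_nonneg[OF \<omega>])
  have "summable (\<lambda>i. Z i \<omega> / T \<omega>)" using suminf_Z(3)[OF \<omega>] by (rule summable_divide)
  moreover have "(\<Sum>i. Z i \<omega> / T \<omega>) \<le> 1"
    using suminf_divide[OF suminf_Z(3)[OF \<omega>], of "T \<omega>"] suminf_Z(2)[OF \<omega>] T
    by (cases "T \<omega> = 0") (auto simp: divide_le_eq_1)
  moreover have "decseq (\<lambda>i. Z i \<omega> / T \<omega>)"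
    using increasing_path.rank_decseq[OF path[OF \<omega>]] T by (auto simp: decseq_def divide_right_mono)
  ultimately show ?thesis
    using Z_nonneg[OF \<omega>] T by (auto simp: mass_partitions_def normalized_jumps_def[abs_def])
qed

lemma normalized_jumps_measurable [measurable]: "normalized_jumps \<in> M \<rightarrow>\<^sub>M mass_partition_space"
  unfolding mass_partition_space_def
proof (rule measurable_restrict_space2)
  show "normalized_jumps \<in> M \<rightarrow>\<^sub>M (\<Pi>\<^sub>M i\<in>UNIV. borel)"
    by (rule measurable_PiM_single') (auto simp: normalized_jumps_def)
qed (auto simp: normalized_jumps_in)

lemma PD_eq: "PD = distr (density M tilt) mass_partition_space normalized_jumps"
  by (simp add: PD_star_def normalized_jumps_def[abs_def] jump_rank_def)

lemma sets_PD: "sets PD = sets mass_partition_space"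
  by (simp add: PD_eq)

lemma nn_integral_PD:
  assumes [measurable]: "f \<in> borel_measurable mass_partition_space"
  shows "(\<integral>\<^sup>+s. f s \<partial>PD) = (\<integral>\<^sup>+\<omega>. tilt \<omega> * f (normalized_jumps \<omega>) \<partial>M)"
  unfolding PD_eq by (subst nn_integral_distr) (auto simp: nn_integral_density)

lemma AE_PD:
  assumes P: "Measurable.pred mass_partition_space P" and AE: "AE \<omega> in M. P (normalized_jumps \<omega>)"
  shows "AE s in PD. P s"
  unfolding PD_eq using AE P by (subst AE_distr_iff) (auto simp: AE_density pred_def elim: eventually_mono)

lemma AE_normalized: "AE \<omega> in M. suminf (normalized_jumps \<omega>) = 1 \<and> (\<forall>i. normalized_jumps \<omega> i > 0) \<and> T \<omega> > 0"
  using AE_pure_jump AE_Z_pos AE_T_pos AE_space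
proof eventually_elim
  case (elim \<omega>)
  then show ?case using suminf_divide[OF suminf_Z(3)[OF elim(4)], of "T \<omega>"]
    by (simp add: normalized_jumps_def[abs_def])
qed

lemma size_bias_PD: "size_bias PD"
proof
  show "sets PD = sets mass_partition_space" by (rule sets_PD)
  show "AE s in PD. suminf s = 1"
    by (rule AE_PD, measurable) (use AE_normalized in \<open>auto elim: eventually_mono\<close>)
  show "AE s in PD. \<forall>i. 0 < s i"
    by (rule AE_PD, measurable) (use AE_normalized in \<open>auto elim: eventually_mono\<close>)
  have "(\<integral>\<^sup>+s. (\<Sum>i. ennreal (s i * (1 - s i))) \<partial>PD) = (\<integral>\<^sup>+\<omega>. tilt \<omega> * (\<Sum>i. ennreal (normalized_jumps \<omega> i * (1 - normalized_jumps \<omega> i))) \<partial>M)"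
    by (rule nn_integral_PD) measurable
  then show "(\<integral>\<^sup>+s. (\<Sum>i. ennreal (s i * (1 - s i))) \<partial>PD) < \<infinity>"
    using dislocation_finite[OF gamma] by (simp add: normalized_jumps_def add.commute)
qed

text \<open>The squared total is kept rather than replaced by 1. The function then agrees with the
  density in \<open>alpha_gamma_dislocation\<close> on every mass partition and not only almost
  everywhere.\<close>

definition weight :: "(nat \<Rightarrow> real) \<Rightarrow> real"
  where "weight s = \<gamma> + (1 - \<alpha> - \<gamma>) * ((suminf s)\<^sup>2 - (\<Sum>i. (s i)\<^sup>2))"

lemma weight_measurable [measurable]: "weight \<in> borel_measurable mass_partition_space"
  unfolding weight_def by measurable

lemma weight_bounds:
  assumes "s \<in> mass_partitions"
  shows "0 \<le> weight s" "weight s \<le> 1"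
proof -
  have "0 \<le> suminf s" using mass_partitionD[OF assms] by (intro suminf_nonneg) auto
  then have "(suminf s)\<^sup>2 \<le> 1" using mass_partitionD(4)[OF assms] by (simp add: power_le_one)
  moreover have "0 \<le> (\<Sum>i. (s i)\<^sup>2)" using infsum_off_diagonal(2)[OF assms] by (intro suminf_nonneg) auto
  ultimately show "0 \<le> weight s" "weight s \<le> 1"
    unfolding weight_def using infsum_off_diagonal(3)[OF assms] by (intro convex_weight; simp)+
qed

lemma alpha_gamma_dislocation_eq:
  "alpha_gamma_dislocation M \<sigma> \<alpha> \<gamma> = density PD (\<lambda>s. ennreal (weight s))"
proof -
  let ?w = "\<lambda>s. ennreal (\<gamma> + (1 - \<alpha> - \<gamma>) * (\<Sum>\<^sub>\<infinity>(i, j)\<in>{(i, j). i \<noteq> j}. s i * s j))"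
  have eq: "?w s = ennreal (weight s)" if "s \<in> space PD" for s
    using that sets_eq_imp_space_eq[OF sets_PD] by (simp add: weight_def infsum_off_diagonal(1))
  have w: "(\<lambda>s. ennreal (weight s)) \<in> borel_measurable PD"
    unfolding measurable_cong_sets[OF sets_PD refl] by measurable
  then have "?w \<in> borel_measurable PD" by (subst measurable_cong[OF eq])
  then show ?thesis unfolding alpha_gamma_dislocation_def
    using w eq by (intro density_cong AE_I2) auto
qed

lemma ratios_eq: "ratios k is \<omega> = (\<lambda>j\<in>{..<k}. normalized_jumps \<omega> (is ! j))"
  by (simp add: normalized_jumps_def)

lemma marginals_density:
  assumes f [measurable]: "f \<in> borel_measurable mass_partition_space" and le: "\<And>s. s \<in> mass_partitions \<Longrightarrow> f s \<le> 1"
    and F: "F \<in> borel_measurable (\<Pi>\<^sub>M i\<in>{..<k}. unit_interval)"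
  shows "(\<integral>\<^sup>+x. F x \<partial>first_marginals k (size_biased (density PD f)))
    = (\<integral>\<^sup>+is. \<integral>\<^sup>+\<omega>. tilt \<omega> * (f (normalized_jumps \<omega>) * (ennreal (vector_weight k (ratios k is \<omega>)) * F (ratios k is \<omega>))) \<partial>M \<partial>index_lists k)"
proof -
  interpret PD: size_bias PD by (rule size_bias_PD)
  interpret D: size_bias "density PD f" by (rule PD.size_bias_density[OF f le])
  have coord: "(\<lambda>s. \<lambda>j\<in>{..<k}. s (is ! j)) \<in> mass_partition_space \<rightarrow>\<^sub>M (\<Pi>\<^sub>M i\<in>{..<k}. unit_interval)" for "is"
    by (intro measurable_restrict measurable_restrict_space2) (auto simp: mass_partitionD)
  note Fm [measurable] = measurable_compose[OF coord F]
  have "(\<integral>\<^sup>+x. F x \<partial>first_marginals k (size_biased (density PD f)))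
    = (\<integral>\<^sup>+s. \<integral>\<^sup>+is. ennreal (sb_weight k s is) * F (\<lambda>j\<in>{..<k}. s (is ! j)) \<partial>index_lists k \<partial>density PD f)"
    by (rule D.nn_integral_first_marginals[OF F])
  also have "\<dots> = (\<integral>\<^sup>+is. \<integral>\<^sup>+s. ennreal (sb_weight k s is) * F (\<lambda>j\<in>{..<k}. s (is ! j)) \<partial>density PD f \<partial>index_lists k)"
    by (rule nn_integral_count_space_nn_integral) (simp, measurable)
  also have "\<dots> = (\<integral>\<^sup>+is. \<integral>\<^sup>+\<omega>. tilt \<omega> * (f (normalized_jumps \<omega>) * (ennreal (vector_weight k (ratios k is \<omega>)) * F (ratios k is \<omega>))) \<partial>M \<partial>index_lists k)"
  proof (intro nn_integral_cong)
    fix "is"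
    have "(\<integral>\<^sup>+s. ennreal (sb_weight k s is) * F (\<lambda>j\<in>{..<k}. s (is ! j)) \<partial>density PD f)
      = (\<integral>\<^sup>+s. f s * (ennreal (sb_weight k s is) * F (\<lambda>j\<in>{..<k}. s (is ! j))) \<partial>PD)"
      by (rule nn_integral_density) measurable
    also have "\<dots> = (\<integral>\<^sup>+\<omega>. tilt \<omega> * (f (normalized_jumps \<omega>) * (ennreal (sb_weight k (normalized_jumps \<omega>) is) * F (\<lambda>j\<in>{..<k}. normalized_jumps \<omega> (is ! j)))) \<partial>M)"
      by (rule nn_integral_PD) measurable
    finally show "(\<integral>\<^sup>+s. ennreal (sb_weight k s is) * F (\<lambda>j\<in>{..<k}. s (is ! j)) \<partial>density PD f)
      = (\<integral>\<^sup>+\<omega>. tilt \<omega> * (f (normalized_jumps \<omega>) * (ennreal (vector_weight k (ratios k is \<omega>)) * F (ratios k is \<omega>))) \<partial>M)"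
      by (simp add: sb_weight_eq ratios_eq)
  qed
  finally show ?thesis .
qed

lemma marginals_PD:
  assumes F: "F \<in> borel_measurable (\<Pi>\<^sub>M i\<in>{..<k}. unit_interval)"
  shows "(\<integral>\<^sup>+x. F x \<partial>first_marginals k (size_biased PD))
    = (\<integral>\<^sup>+is. \<integral>\<^sup>+\<omega>. tilt \<omega> * (ennreal (vector_weight k (ratios k is \<omega>)) * F (ratios k is \<omega>)) \<partial>M \<partial>index_lists k)"
  using marginals_density[of "\<lambda>_. 1", OF _ _ F] by (simp add: density_1)

section \<open>Comparison of the two densities\<close>

definition rest_squares :: "nat list \<Rightarrow> 'a \<Rightarrow> ennreal"
  where "rest_squares is \<omega> = (\<Sum>i. ennreal ((Z i \<omega> / T \<omega>)\<^sup>2) * indicator (- set is) i)"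

text \<open>This is (1 - \<alpha>) / (1 + q) with \<open>q = k * \<alpha> + \<theta>\<close> and
  \<theta> = - \<alpha> - \<gamma>, the factor from \<open>sampled_identity\<close>.\<close>

definition rest_const :: "nat \<Rightarrow> real"
  where "rest_const k = (1 - \<alpha>) / (1 + (real k - 1) * \<alpha> - \<gamma>)"

text \<open>The upper bound comes from \<gamma> < \<alpha>. It keeps the bracket in
  \<open>marginal_weight\<close> within \<open>{0..1}\<close>, so that the weight is nonnegative and
  its conversion to \<open>ennreal\<close> loses nothing.\<close>

lemma rest_const_bounds:
  assumes "k \<ge> 1"
  shows "0 \<le> rest_const k" "rest_const k \<le> 1"
proof -
  have "0 \<le> (real k - 1) * \<alpha>" using assms index by (intro mult_nonneg_nonneg) auto
  then have "1 - \<alpha> \<le> 1 + (real k - 1) * \<alpha> - \<gamma>" using gamma by linarith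
  then show "0 \<le> rest_const k" "rest_const k \<le> 1" unfolding rest_const_def using index by (auto simp: divide_le_eq_1)
qed

definition marginal_weight :: "nat \<Rightarrow> (nat \<Rightarrow> real) \<Rightarrow> real"
  where "marginal_weight k x = \<gamma> + (1 - \<alpha> - \<gamma>) *
    (1 - (\<Sum>i<k. (x i)\<^sup>2) - rest_const k * (1 - (\<Sum>i<k. x i))\<^sup>2)"

text \<open>\<open>D\<close> is the part of the density determined by the sampled ratios when the
  unsampled squares are ignored. The true density and the marginal one differ from it by \<beta>
  times \<open>rest_squares\<close> and \<beta> times \<open>e\<close>, two terms with equal
  integrals. Each sign of \<beta> gets its own additive form, since subtraction in
  \<open>ennreal\<close> is truncated. The last bound makes the correction integrable.\<close>

lemma weight_decomposition:
  assumes "suminf (normalized_jumps \<omega>) = 1" and \<omega>: "\<omega> \<in> space M" and "is": "is \<in> distinct_lists k UNIV" and k: "k \<ge> 1"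
  defines "\<beta> \<equiv> 1 - \<alpha> - \<gamma>" and "u \<equiv> ratios k is \<omega>"
  defines "D \<equiv> \<gamma> + \<beta> * (1 - (\<Sum>j<k. (u j)\<^sup>2))" and "e \<equiv> rest_const k * (1 - (\<Sum>j<k. u j))\<^sup>2"
  shows "\<beta> \<ge> 0 \<Longrightarrow> ennreal (weight (normalized_jumps \<omega>)) + ennreal \<bar>\<beta>\<bar> * rest_squares is \<omega> = ennreal D"
    and "\<beta> \<ge> 0 \<Longrightarrow> ennreal (marginal_weight k u) + ennreal \<bar>\<beta>\<bar> * ennreal e = ennreal D"
    and "\<beta> < 0 \<Longrightarrow> ennreal (weight (normalized_jumps \<omega>)) = ennreal D + ennreal \<bar>\<beta>\<bar> * rest_squares is \<omega>"
    and "\<beta> < 0 \<Longrightarrow> ennreal (marginal_weight k u) = ennreal D + ennreal \<bar>\<beta>\<bar> * ennreal e"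
    and "ennreal \<bar>\<beta>\<bar> * ennreal e \<le> ennreal (1 - u 0)"
proof -
  let ?s = "normalized_jumps \<omega>"
  note mp = mass_partitionD[OF normalized_jumps_in[OF \<omega>]]
  have is': "length is = k" "distinct is" using "is" by (auto simp: distinct_lists_def)
  have bij: "bij_betw (nth is) {..<k} (set is)" using is' by (intro bij_betw_nth) auto
  have u: "u j = ?s (is ! j)" if "j < k" for j using that by (simp add: u_def normalized_jumps_def)
  have u01: "0 \<le> u j" "u j \<le> 1" if "j < k" for j using mp(2,5) by (auto simp: u[OF that])
  have sum_u: "(\<Sum>j<k. u j) = (\<Sum>i\<in>set is. ?s i)" and sq_u: "(\<Sum>j<k. (u j)\<^sup>2) = (\<Sum>i\<in>set is. (?s i)\<^sup>2)"
    using sum.reindex_bij_betw[OF bij, of ?s] sum.reindex_bij_betw[OF bij, of "\<lambda>i. (?s i)\<^sup>2"] u by auto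
  note sq = infsum_off_diagonal(2)[OF normalized_jumps_in[OF \<omega>]]
  define v where "v = (\<Sum>i. if i \<in> set is then 0 else (?s i)\<^sup>2)"
  have v: "summable (\<lambda>i. if i \<in> set is then 0 else (?s i)\<^sup>2)" "v = (\<Sum>i. (?s i)\<^sup>2) - (\<Sum>j<k. (u j)\<^sup>2)"
    using summable_off[OF sq, of "is"] unfolding sq_u v_def by auto
  have v0: "v \<ge> 0" unfolding v_def using v(1) by (intro suminf_nonneg) auto
  have V: "rest_squares is \<omega> = ennreal v"
  proof -
    have "rest_squares is \<omega> = (\<Sum>i. ennreal (if i \<in> set is then 0 else (?s i)\<^sup>2))"
      unfolding rest_squares_def by (intro suminf_cong) (auto simp: normalized_jumps_def)
    then show ?thesis unfolding v_def using v(1) by (simp add: suminf_ennreal2)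
  qed
  have w: "weight ?s = D - \<beta> * v" by (simp add: weight_def assms(1) D_def \<beta>_def v(2) algebra_simps)
  have w': "marginal_weight k u = D - \<beta> * e" by (simp add: marginal_weight_def D_def \<beta>_def e_def algebra_simps)
  have sum1: "(\<Sum>j<k. u j) \<le> 1"
    unfolding sum_u using sum_le_suminf[OF mp(3), of "set is"] mp(2) assms(1) by auto
  have sum0: "0 \<le> (\<Sum>j<k. u j)" using u01 by (intro sum_nonneg) auto
  have sqle: "(\<Sum>j<k. (u j)\<^sup>2) \<le> (\<Sum>j<k. u j)"
    using u01 by (intro sum_mono) (auto simp: power2_eq_square mult_left_le)
  have sq0: "0 \<le> (\<Sum>j<k. (u j)\<^sup>2)" by (intro sum_nonneg) auto
  have rest: "(1 - (\<Sum>j<k. u j))\<^sup>2 \<le> 1 - (\<Sum>j<k. u j)"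
    using sum0 sum1 by (auto simp: power2_eq_square mult_left_le)
  have e: "0 \<le> e" "e \<le> 1 - (\<Sum>j<k. u j)"
    unfolding e_def using rest_const_bounds[OF k] rest
      mult_right_mono[of "rest_const k" 1 "(1 - (\<Sum>j<k. u j))\<^sup>2"] by auto
  have D0: "0 \<le> D" unfolding D_def \<beta>_def using sqle sum1 sq0 by (intro convex_weight) auto
  have w0: "0 \<le> D - \<beta> * v" using weight_bounds(1)[OF normalized_jumps_in[OF \<omega>]] w by simp
  have w0': "0 \<le> D - \<beta> * e"
  proof -
    have "0 \<le> \<gamma> + (1 - \<alpha> - \<gamma>) * (1 - (\<Sum>j<k. (u j)\<^sup>2) - e)" using sqle e sq0 by (intro convex_weight) auto
    then show ?thesis by (simp add: D_def \<beta>_def algebra_simps)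
  qed
  show "\<beta> \<ge> 0 \<Longrightarrow> ennreal (weight ?s) + ennreal \<bar>\<beta>\<bar> * rest_squares is \<omega> = ennreal D"
    unfolding V w using v0 w0 by (simp add: ennreal_mult''[symmetric] ennreal_plus[symmetric] del: ennreal_plus)
  show "\<beta> \<ge> 0 \<Longrightarrow> ennreal (marginal_weight k u) + ennreal \<bar>\<beta>\<bar> * ennreal e = ennreal D"
    unfolding w' using e w0' by (simp add: ennreal_mult''[symmetric] ennreal_plus[symmetric] del: ennreal_plus)
  show "ennreal (weight ?s) = ennreal D + ennreal \<bar>\<beta>\<bar> * rest_squares is \<omega>" if "\<beta> < 0"
  proof -
    have eq: "D - \<beta> * v = D + \<bar>\<beta>\<bar> * v" using that by simp
    show ?thesis unfolding V w eq using v0 D0 by (simp add: ennreal_mult'')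
  qed
  show "ennreal (marginal_weight k u) = ennreal D + ennreal \<bar>\<beta>\<bar> * ennreal e" if "\<beta> < 0"
  proof -
    have eq: "D - \<beta> * e = D + \<bar>\<beta>\<bar> * e" using that by simp
    show ?thesis unfolding w' eq using e D0 by (simp add: ennreal_mult'')
  qed
  have "u 0 \<le> (\<Sum>j<k. u j)" using k u01 by (intro member_le_sum) auto
  then have "\<bar>\<beta>\<bar> * e \<le> 1 * (1 - u 0)"
    using e gamma index by (intro mult_mono) (auto simp: \<beta>_def)
  then show "ennreal \<bar>\<beta>\<bar> * ennreal e \<le> ennreal (1 - u 0)"
    using e by (simp add: ennreal_mult''[symmetric] ennreal_leI)
qed

lemma marginal_weight_measurable:
  "(\<lambda>x. ennreal (marginal_weight k x)) \<in> borel_measurable (\<Pi>\<^sub>M i\<in>{..<k}. unit_interval)"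
  unfolding marginal_weight_def
  by (intro measurable_compose[OF _ measurable_ennreal] borel_measurable_add borel_measurable_times borel_measurable_diff
    borel_measurable_sum borel_measurable_power unit_coordinate_measurable borel_measurable_const) auto

lemma ratios_measurable:
  "(\<lambda>\<omega>. ratios k is \<omega>) \<in> M \<rightarrow>\<^sub>M (\<Pi>\<^sub>M j\<in>{..<k}. borel)"
  "(\<lambda>\<omega>. ratios k is \<omega>) \<in> M \<rightarrow>\<^sub>M (\<Pi>\<^sub>M j\<in>{..<k}. unit_interval)"
  by (intro measurable_restrict measurable_restrict_space2;
    auto simp: mass_partitionD[OF normalized_jumps_in, unfolded normalized_jumps_def])+

lemma first_marginals_alpha_gamma:
  assumes k: "k \<ge> 1"
  shows "first_marginals k (size_biased (alpha_gamma_dislocation M \<sigma> \<alpha> \<gamma>)) =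
    density (first_marginals k (GEM_star M \<sigma> (- \<alpha> - \<gamma>))) (\<lambda>x. ennreal (marginal_weight k x))"
  (is "?L = ?R")
proof (rule measure_eqI)
  interpret PD: size_bias PD by (rule size_bias_PD)
  let ?U = "\<Pi>\<^sub>M i\<in>{..<k}. unit_interval"
  show "sets ?L
    = sets ?R"
    by (simp add: first_marginals_def)
  fix A assume "A \<in> sets ?L"
  then have A: "A \<in> sets ?U" by (simp add: first_marginals_def)
  define \<beta> where "\<beta> = 1 - \<alpha> - \<gamma>"
  \<comment> \<open>Size-biasing weight and event enter the Mecke formula as one function of the
    ratios. The clamping changes nothing there, since ratios lie in \<open>{0..1}\<close>.\<close>
  define G :: "(nat \<Rightarrow> real) \<Rightarrow> ennreal"
    where "G x = ennreal (vector_weight k x) * indicator A (\<lambda>j\<in>{..<k}. min 1 (max 0 (x j)))" for x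
  have Gm: "G \<in> borel_measurable (\<Pi>\<^sub>M j\<in>{..<k}. borel)"
    unfolding G_def by (intro borel_measurable_times_ennreal measurable_compose[OF vector_weight_measurable measurable_ennreal]
      measurable_compose[OF clamp_measurable borel_measurable_indicator[OF A]])
  have G: "G (ratios k is \<omega>) = ennreal (vector_weight k (ratios k is \<omega>)) * indicator A (ratios k is \<omega>)"
    if "\<omega> \<in> space M" for "is" \<omega>
  proof -
    have "0 \<le> Z i \<omega> / T \<omega>" "Z i \<omega> / T \<omega> \<le> 1" for i
      using mass_partitionD(2,5)[OF normalized_jumps_in[OF that], of i] by (auto simp: normalized_jumps_def)
    then have "(\<lambda>j\<in>{..<k}. min 1 (max 0 (ratios k is \<omega> j))) = ratios k is \<omega>" by (auto simp: fun_eq_iff)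
    then show ?thesis by (simp only: G_def)
  qed
  define t where "t is \<omega> = tilt \<omega> * G (ratios k is \<omega>)" for "is" \<omega>
  have [measurable]: "t is \<in> borel_measurable M" for "is"
    unfolding t_def by (intro borel_measurable_times_ennreal measurable_compose[OF ratios_measurable(1) Gm]) measurable
  have [measurable]: "rest_squares is \<in> borel_measurable M" for "is"
    unfolding rest_squares_def by measurable
  have [measurable]: "(\<lambda>\<omega>. ennreal (marginal_weight k (ratios k is \<omega>))) \<in> borel_measurable M" for "is"
    by (rule measurable_compose[OF ratios_measurable(2) marginal_weight_measurable])
  define e where "e is \<omega> = rest_const k * (1 - (\<Sum>j<k. ratios k is \<omega> j))\<^sup>2" for "is" \<omega>
  have [measurable]: "(\<lambda>\<omega>. (1 - (\<Sum>j<k. ratios k is \<omega> j))\<^sup>2) \<in> borel_measurable M" for "is" by simp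
  then have [measurable]: "e is \<in> borel_measurable M" for "is" unfolding e_def by measurable
  define D where "D is \<omega> = \<gamma> + \<beta> * (1 - (\<Sum>j<k. (ratios k is \<omega> j)\<^sup>2))" for "is" \<omega>
  have [measurable]: "D is \<in> borel_measurable M" for "is"
  proof -
    have "D is = (\<lambda>\<omega>. \<gamma> + \<beta> * (1 - (\<Sum>j<k. (Z (is ! j) \<omega> / T \<omega>)\<^sup>2)))" by (simp add: D_def fun_eq_iff)
    then show ?thesis by simp
  qed
  have L: "emeasure ?L A
    = (\<integral>\<^sup>+is. \<integral>\<^sup>+\<omega>. t is \<omega> * ennreal (weight (normalized_jumps \<omega>)) \<partial>M \<partial>index_lists k)"
  proof -
    have "emeasure ?L A
      = (\<integral>\<^sup>+x. indicator A x \<partial>first_marginals k (size_biased (density PD (\<lambda>s. ennreal (weight s)))))"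
      unfolding alpha_gamma_dislocation_eq by (rule nn_integral_indicator[symmetric]) (simp add: first_marginals_def A)
    also have "\<dots> = (\<integral>\<^sup>+is. \<integral>\<^sup>+\<omega>. tilt \<omega> * (ennreal (weight (normalized_jumps \<omega>)) *
        (ennreal (vector_weight k (ratios k is \<omega>)) * indicator A (ratios k is \<omega>))) \<partial>M \<partial>index_lists k)"
      by (rule marginals_density) (use weight_bounds A in auto)
    also have "\<dots> = (\<integral>\<^sup>+is. \<integral>\<^sup>+\<omega>. t is \<omega> * ennreal (weight (normalized_jumps \<omega>)) \<partial>M \<partial>index_lists k)"
      by (intro nn_integral_cong) (simp add: t_def G mult_ac)
    finally show ?thesis .
  qed
  have R: "emeasure ?R A
    = (\<integral>\<^sup>+is. \<integral>\<^sup>+\<omega>. t is \<omega> * ennreal (marginal_weight k (ratios k is \<omega>)) \<partial>M \<partial>index_lists k)"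
  proof -
    have "emeasure ?R A
      = (\<integral>\<^sup>+x. ennreal (marginal_weight k x) * indicator A x \<partial>first_marginals k (size_biased PD))"
      unfolding GEM_star_def using marginal_weight_measurable[of k]
      by (subst emeasure_density) (simp_all add: first_marginals_def A)
    also have "\<dots> = (\<integral>\<^sup>+is. \<integral>\<^sup>+\<omega>. tilt \<omega> * (ennreal (vector_weight k (ratios k is \<omega>)) *
        (ennreal (marginal_weight k (ratios k is \<omega>)) * indicator A (ratios k is \<omega>))) \<partial>M \<partial>index_lists k)"
      by (rule marginals_PD) (intro borel_measurable_times_ennreal marginal_weight_measurable borel_measurable_indicator A)
    also have "\<dots> = (\<integral>\<^sup>+is. \<integral>\<^sup>+\<omega>. t is \<omega> * ennreal (marginal_weight k (ratios k is \<omega>)) \<partial>M \<partial>index_lists k)"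
      by (intro nn_integral_cong) (simp add: t_def G mult_ac)
    finally show ?thesis .
  qed
  \<comment> \<open>The exponent is \<open>q = (k - 1) * \<alpha> - \<gamma>\<close>. It is smallest
    for \<open>k = 1\<close>, where it equals - \<gamma> and still exceeds -1.\<close>
  have q: "real k * \<alpha> + (- \<alpha> - \<gamma>) > -1" and c: "(1 - \<alpha>) / (1 + (real k * \<alpha> + (- \<alpha> - \<gamma>))) = rest_const k"
  proof -
    have "real k * \<alpha> \<ge> 1 * \<alpha>" using k index by (intro mult_right_mono) auto
    then show "real k * \<alpha> + (- \<alpha> - \<gamma>) > -1" using gamma index by linarith
    show "(1 - \<alpha>) / (1 + (real k * \<alpha> + (- \<alpha> - \<gamma>))) = rest_const k" by (simp add: rest_const_def algebra_simps)
  qed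
  have swap: "(\<integral>\<^sup>+\<omega>. \<integral>\<^sup>+is. f is \<omega> \<partial>index_lists k \<partial>M) = (\<integral>\<^sup>+is. \<integral>\<^sup>+\<omega>. f is \<omega> \<partial>M \<partial>index_lists k)"
    if "\<And>is. f is \<in> borel_measurable M" for f :: "nat list \<Rightarrow> 'a \<Rightarrow> ennreal"
    by (rule nn_integral_count_space_nn_integral) (use that in auto)
  have cmult: "(\<integral>\<^sup>+is. \<integral>\<^sup>+\<omega>. t is \<omega> * (ennreal a * f is \<omega>) \<partial>M \<partial>index_lists k)
      = ennreal a * (\<integral>\<^sup>+is. \<integral>\<^sup>+\<omega>. t is \<omega> * f is \<omega> \<partial>M \<partial>index_lists k)"
    if [measurable]: "\<And>is. f is \<in> borel_measurable M" for a and f :: "nat list \<Rightarrow> 'a \<Rightarrow> ennreal"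
    by (simp add: mult.left_commute[of _ "ennreal a"] nn_integral_cmult)
  have "(\<integral>\<^sup>+is. \<integral>\<^sup>+\<omega>. t is \<omega> * rest_squares is \<omega> \<partial>M \<partial>index_lists k)
    = (\<integral>\<^sup>+\<omega>. \<integral>\<^sup>+is. t is \<omega> * rest_squares is \<omega> \<partial>index_lists k \<partial>M)"
    by (rule swap[symmetric]) measurable
  also have "\<dots> = ennreal (rest_const k) * (\<integral>\<^sup>+\<omega>. \<integral>\<^sup>+is. t is \<omega> * ennreal ((1 - (\<Sum>j<k. ratios k is \<omega> j))\<^sup>2) \<partial>index_lists k \<partial>M)"
    using sampled_identity[OF Gm q] unfolding c t_def rest_squares_def .
  also have "(\<integral>\<^sup>+\<omega>. \<integral>\<^sup>+is. t is \<omega> * ennreal ((1 - (\<Sum>j<k. ratios k is \<omega> j))\<^sup>2) \<partial>index_lists k \<partial>M)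
    = (\<integral>\<^sup>+is. \<integral>\<^sup>+\<omega>. t is \<omega> * ennreal ((1 - (\<Sum>j<k. ratios k is \<omega> j))\<^sup>2) \<partial>M \<partial>index_lists k)"
    by (rule swap) measurable
  also have "ennreal (rest_const k) * \<dots> = (\<integral>\<^sup>+is. \<integral>\<^sup>+\<omega>. t is \<omega> * ennreal (e is \<omega>) \<partial>M \<partial>index_lists k)"
    by (subst cmult[symmetric]) (simp_all add: e_def ennreal_mult'' del: restrict_apply)
  finally have "ennreal \<bar>\<beta>\<bar> * (\<integral>\<^sup>+is. \<integral>\<^sup>+\<omega>. t is \<omega> * rest_squares is \<omega> \<partial>M \<partial>index_lists k)
    = ennreal \<bar>\<beta>\<bar> * (\<integral>\<^sup>+is. \<integral>\<^sup>+\<omega>. t is \<omega> * ennreal (e is \<omega>) \<partial>M \<partial>index_lists k)" by simp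
  then have b: "(\<integral>\<^sup>+is. \<integral>\<^sup>+\<omega>. t is \<omega> * (ennreal \<bar>\<beta>\<bar> * rest_squares is \<omega>) \<partial>M \<partial>index_lists k)
    = (\<integral>\<^sup>+is. \<integral>\<^sup>+\<omega>. t is \<omega> * (ennreal \<bar>\<beta>\<bar> * ennreal (e is \<omega>)) \<partial>M \<partial>index_lists k)"
    (is "?b = ?b'") by (simp add: cmult)
  have add: "(\<integral>\<^sup>+is. \<integral>\<^sup>+\<omega>. t is \<omega> * f is \<omega> \<partial>M \<partial>index_lists k) + (\<integral>\<^sup>+is. \<integral>\<^sup>+\<omega>. t is \<omega> * g is \<omega> \<partial>M \<partial>index_lists k)
    = (\<integral>\<^sup>+is. \<integral>\<^sup>+\<omega>. t is \<omega> * (f is \<omega> + g is \<omega>) \<partial>M \<partial>index_lists k)"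
    if [measurable]: "\<And>is. f is \<in> borel_measurable M" "\<And>is. g is \<in> borel_measurable M" for f g :: "nat list \<Rightarrow> 'a \<Rightarrow> ennreal"
    by (simp add: nn_integral_add distrib_left)
  have cong: "(\<integral>\<^sup>+is. \<integral>\<^sup>+\<omega>. t is \<omega> * f is \<omega> \<partial>M \<partial>index_lists k) = (\<integral>\<^sup>+is. \<integral>\<^sup>+\<omega>. t is \<omega> * g is \<omega> \<partial>M \<partial>index_lists k)"
    if "\<And>is \<omega>. suminf (normalized_jumps \<omega>) = 1 \<Longrightarrow> \<omega> \<in> space M \<Longrightarrow> is \<in> distinct_lists k UNIV \<Longrightarrow> f is \<omega> = g is \<omega>"
    for f g :: "nat list \<Rightarrow> 'a \<Rightarrow> ennreal"
  proof (rule nn_integral_cong)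
    fix "is" assume "is \<in> space (index_lists k)"
    then have "is": "is \<in> distinct_lists k UNIV" by simp
    show "(\<integral>\<^sup>+\<omega>. t is \<omega> * f is \<omega> \<partial>M) = (\<integral>\<^sup>+\<omega>. t is \<omega> * g is \<omega> \<partial>M)"
    proof (intro nn_integral_cong_AE, use AE_normalized AE_space in eventually_elim)
      case (elim \<omega>)
      then show ?case using that[OF _ elim(2) "is"] by simp
    qed
  qed
  have [measurable]: "(\<lambda>\<omega>. ennreal (weight (normalized_jumps \<omega>))) \<in> borel_measurable M" by measurable
  note decomposition = weight_decomposition[OF _ _ _ k, folded \<beta>_def, folded D_def e_def]
  show "emeasure ?L A
    = emeasure ?R A"
  proof (cases "\<beta> \<ge> 0") \<comment> \<open>extended reals do not cancel under subtraction, so the correction is added on the side where its sign is positive\<close>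
    case True
    have "emeasure ?L A + ?b
      = (\<integral>\<^sup>+is. \<integral>\<^sup>+\<omega>. t is \<omega> * ennreal (D is \<omega>) \<partial>M \<partial>index_lists k)"
      unfolding L by (subst add) (measurable, intro cong decomposition(1) True)
    also have "\<dots> = emeasure ?R A + ?b'"
      unfolding R by (subst add) (measurable, intro cong decomposition(2)[symmetric] True)
    finally have sum: "emeasure ?L A + ?b'
      = emeasure ?R A + ?b'"
      unfolding b .
    \<comment> \<open>Cancellation requires a finite correction. The correction is at most
      \<open>1 - u 0\<close>, whose integral against the marginal of the size-biased measure of
      \<open>PD\<close> is the dislocation integral.\<close>
    have "?b' < \<infinity>"
    proof -
      have f1: "(\<lambda>x. ennreal (1 - x)) \<in> borel_measurable borel" by measurable
      have "?b' \<le> (\<integral>\<^sup>+is. \<integral>\<^sup>+\<omega>. tilt \<omega> * (ennreal (vector_weight k (ratios k is \<omega>)) * ennreal (1 - ratios k is \<omega> 0)) \<partial>M \<partial>index_lists k)"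
      proof (rule nn_integral_mono)
        fix "is" assume "is \<in> space (index_lists k)"
        then have "is": "is \<in> distinct_lists k UNIV" by simp
        show "(\<integral>\<^sup>+\<omega>. t is \<omega> * (ennreal \<bar>\<beta>\<bar> * ennreal (e is \<omega>)) \<partial>M)
          \<le> (\<integral>\<^sup>+\<omega>. tilt \<omega> * (ennreal (vector_weight k (ratios k is \<omega>)) * ennreal (1 - ratios k is \<omega> 0)) \<partial>M)"
        proof (intro nn_integral_mono_AE, use AE_normalized AE_space in eventually_elim)
          case (elim \<omega>)
          have "t is \<omega> \<le> tilt \<omega> * ennreal (vector_weight k (ratios k is \<omega>))"
            unfolding t_def G[OF elim(2)] by (intro mult_left_mono) (auto simp: indicator_def)
          moreover have "ennreal \<bar>\<beta>\<bar> * ennreal (e is \<omega>) \<le> ennreal (1 - ratios k is \<omega> 0)"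
            using decomposition(5) elim "is" by blast
          ultimately have "t is \<omega> * (ennreal \<bar>\<beta>\<bar> * ennreal (e is \<omega>)) \<le> tilt \<omega> * ennreal (vector_weight k (ratios k is \<omega>)) * ennreal (1 - ratios k is \<omega> 0)"
            by (rule mult_mono) auto
          then show ?case by (simp only: mult.assoc)
        qed
      qed
      also have "\<dots> = (\<integral>\<^sup>+x. ennreal (1 - x 0) \<partial>first_marginals k (size_biased PD))"
        by (rule marginals_PD[symmetric]) (rule measurable_compose[OF unit_coordinate_measurable f1], use k in auto)
      also have "\<dots> = (\<integral>\<^sup>+s. (\<Sum>i. ennreal (s i) * ennreal (1 - s i)) \<partial>PD)"
        by (rule PD.nn_integral_first_coordinate[OF k f1])
      also have "\<dots> = (\<integral>\<^sup>+s. (\<Sum>i. ennreal (s i * (1 - s i))) \<partial>PD)"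
        by (intro nn_integral_cong suminf_cong) (auto simp: PD.space_\<nu> mass_partitionD ennreal_mult')
      finally show ?thesis using PD.dislocation by simp
    qed
    then show ?thesis using sum unfolding add.commute[of _ ?b'] ennreal_add_left_cancel by auto
  next
    case False
    then have neg: "\<beta> < 0" by simp
    have "emeasure ?L A
      = (\<integral>\<^sup>+is. \<integral>\<^sup>+\<omega>. t is \<omega> * ennreal (D is \<omega>) \<partial>M \<partial>index_lists k) + ?b"
      unfolding L by (subst add) (measurable, intro cong decomposition(3) neg)
    also have "\<dots> = (\<integral>\<^sup>+is. \<integral>\<^sup>+\<omega>. t is \<omega> * ennreal (D is \<omega>) \<partial>M \<partial>index_lists k) + ?b'" unfolding b ..
    also have "\<dots> = emeasure ?R A"
      unfolding R by (subst add) (measurable, intro cong decomposition(4)[symmetric] neg)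
    finally show ?thesis .
  qed
qed

end

theorem proposition4:
  fixes M :: "'a measure" and \<sigma> :: "real \<Rightarrow> 'a \<Rightarrow> real" and \<alpha> \<gamma> :: real and k :: nat
  assumes "0 < \<alpha>" and "\<alpha> < 1" and "0 \<le> \<gamma>" and "\<gamma> < \<alpha>" and "k \<ge> 1"
    and "stable_subordinator M \<sigma> \<alpha>"
  shows "first_marginals k (size_biased (alpha_gamma_dislocation M \<sigma> \<alpha> \<gamma>)) =
    density (first_marginals k (GEM_star M \<sigma> (- \<alpha> - \<gamma>)))
      (\<lambda>x. ennreal (\<gamma> + (1 - \<alpha> - \<gamma>) *
        (1 - (\<Sum>i<k. (x i)\<^sup>2)
           - (1 - \<alpha>) / (1 + (real k - 1) * \<alpha> - \<gamma>) * (1 - (\<Sum>i<k. x i))\<^sup>2)))"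
proof -
  interpret stable_subordinator M \<sigma> \<alpha> by fact
  interpret alpha_gamma M \<sigma> \<alpha> \<gamma> by unfold_locales (use assms in auto)
  show ?thesis using first_marginals_alpha_gamma[OF assms(5)] unfolding marginal_weight_def rest_const_def .
qed

end
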